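(* Let $d\ge 2$, $m\ge 1$, $G=\mathbb{Z}^m$, let $F$ be a Keane, infinitely complete IET of $d$ intervals on $[0,1)$ with continuous extension $T:K\to K$, and let $\phi=(\phi_1,\dots,\phi_d)\in G^d$ be such that $\phi_1,\dots,\phi_d$ generate $G$. Suppose that $T_\phi:K\times G\to K\times G$ is of periodic type. For $\psi\in\mathrm{Hom}(G,\mathbb{R})\cong\mathbb{R}^m$ (with the standard topology) let $\mu_\psi$ be the Maharam measure on $K\times G$ associated with $\psi$, normalised by $\mu_\psi(K\times\{0\})=1$. Then $\mu_\psi$ depends weak-* continuously on $\psi$; i.e. for every continuous compactly supported $h:K\times G\to\mathbb{R}$ the map $\psi\mapsto\int h\,d\mu_\psi$ is continuous on $\mathrm{Hom}(G,\mathbb{R})$.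
   Context: **IETs.** Let $d\ge2$. An interval exchange transformation (IET) of $d$ intervals on $[a,b)$ is a bijection $F:[a,b)\to[a,b)$ together with marked points $a=x_0<x_1<\dots<x_{d-1}<x_d=b$ (part of the data; $F$ may be continuous at some $x_i$) such that $F$ is a translation on each $I_i=[x_{i-1},x_i)$. $F$ is Keane if $F^n(x_i)\notin\{x_1,\dots,x_{d-1}\}$ for all $0\le i\le d-1$, $n\ge1$. **Rauzy–Veech induction.** Let $F$ be a Keane IET on $[a,b)$ whose exchanged intervals $I_j$ are labelled by $\{1,\dots,d\}$. Let $I_\alpha$ be the rightmost interval and let $\beta$ be such that $F(I_\beta)$ is rightmost; then $|I_\alpha|\ne|I_\beta|$. If $|I_\alpha|>|I_\beta|$ put $I^{(1)}=[a,b)\setminus F(I_\beta)$, $I^{(1)}_\alpha=I_\alpha\setminus F(I_\beta)$ and $I^{(1)}_j=I_j$ for $j\ne\alpha$. If $|I_\alpha|<|I_\beta|$ put $I^{(1)}=[a,b)\setminus I_\alpha$, $I^{(1)}_\alpha=F^{-1}(I_\alpha)$, $I^{(1)}_\beta=I_\beta\setminus F^{-1}(I_\alpha)$ and $I^{(1)}_j=I_j$ otherwise. The first return map $F^{(1)}$ of $F$ to $I^{(1)}$ is again a Keane IET exchanging the $I^{(1)}_j$. Iterating gives nested intervals $I^{(0)}\supset I^{(1)}\supset\cdots$ with the same left endpoint, the first return maps $F^{(k)}$ on $I^{(k)}$, and the labelled intervals $I^{(k)}_j$ (for $F^{(0)}=F$, $I_j=[x_{j-1},x_j)$). Let $q^{(0,k)}_j$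 be the return time of $I^{(k)}_j$ to $I^{(k)}$ under $F$, and $A^{(0,k)}_{ij}=\#\{0\le l<q^{(0,k)}_j: F^l(I^{(k)}_j)\subset I_i\}$. $F$ is infinitely complete if $\lim_{n\to\infty}A^{(0,n)}_{ij}=\infty$ for all $i,j$. **Compactification.** For $F$ Keane on $[0,1)$ let $\{y_1,\dots,y_{d-1}\}=\{F(x_i):0\le i\le d-1\}\setminus\{0\}$ and, for $n\ge0$, $D_n^+=\{F^n(y_i)\}_i$, $D_n^-=\{F^{-n}(x_i):1\le i\le d-1\}$. Put $\rho=\sum_{n\ge0}\sum_{x\in D_n^+\sqcup D_n^-}2^{-n}\delta_x$, $l(x)=\rho([0,x))$ for $x\in[0,1]$, $r(x)=\rho([0,x])$ for $x\in[0,1)$, and $K=l((0,1])\cup r([0,1))\subset\mathbb{R}$, a Cantor set. The continuous extension $T:K\to K$ is the homeomorphism with $T\circ r=r\circ F$ on $[0,1)$ (so $T(l(x))=l(\lim_{y\to x^-}F(y))$). Put $K_i=l((x_{i-1},x_i])\cup r([x_{i-1},x_i))$, clopen sets partitioning $K$. **Skew-products.** For $\phi\in G^d$ define $\phi:K\to G$ by $\phi|_{K_i}=\phi_i$ (and similarly $\phi:[0,1)\to G$ by $\phi|_{I_i}=\phi_i$). Put $T_\phi(x,a)=(T(x),a+\phi(x))$ on $K\times G$ and $F_\phi(x,a)=(F(x),a+\phi(x))$ on $[0,1)\times G$. **Periodic type.** $\widetilde{\mathcal R}^N(F_\phi)$ denotes the first return map of $F_\phi$ to $I^{(N)}\times G$,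 rescaled in the first coordinate by $1/|I^{(N)}|$ to a map of $[0,1)\times G$. $F_\phi$ (with $F$ infinitely complete), and equally $T_\phi$, is of periodic type if $\widetilde{\mathcal R}^N(F_\phi)=F_\phi$ for some $N\ge1$ (equality including labelled exchanged intervals; thus the rescaled $F^{(N)}$ equals $F$ and $(A^{(0,N)})^T\phi=\phi$). **Maharam measures.** In this setting, for each homomorphism $\psi:G\to\mathbb{R}$ there is a unique (up to scaling) nonzero finite Borel measure $\nu_\psi$ on $K$ with $\frac{d(\nu_\psi\circ T)}{d\nu_\psi}=e^{-\psi\circ\phi}$, where $(\nu\circ T)(B)=\nu(T(B))$. The Maharam measure is $d\mu_\psi(x,a)=d\nu_\psi(x)\,e^{\psi(a)}\,d\mu_G(a)$ with $\mu_G$ the counting measure on $G$. *)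

theory Defs
  imports "HOL-Analysis.Analysis" "HOL-Computational_Algebra.Group_Closure"
begin

section \<open>Interval exchange transformations\<close>

text \<open>The marked points are \<open>x 0, \<dots>, x d\<close>; values of \<open>x\<close> at indices above \<open>d\<close>, and of \<open>F\<close>
  outside the interval, are irrelevant. Labels of exchanged intervals range over \<open>{1..d}\<close>.\<close>

definition iet :: "nat \<Rightarrow> real \<Rightarrow> real \<Rightarrow> (nat \<Rightarrow> real) \<Rightarrow> (real \<Rightarrow> real) \<Rightarrow> bool" where
  "iet d a b x F \<longleftrightarrow>
     x 0 = a \<and> x d = b \<and> (\<forall>i<d. x i < x (Suc i)) \<and>
     bij_betw F {a..<b} {a..<b} \<and>
     (\<forall>i\<in>{1..d}. \<exists>c. \<forall>t\<in>{x (i - 1)..<x i}. F t = t + c)"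

definition keane :: "nat \<Rightarrow> (nat \<Rightarrow> real) \<Rightarrow> (real \<Rightarrow> real) \<Rightarrow> bool" where
  "keane d x F \<longleftrightarrow> (\<forall>i<d. \<forall>n\<ge>1. (F ^^ n) (x i) \<notin> x ` {1..<d})"

definition exch_interval :: "(nat \<Rightarrow> real) \<Rightarrow> nat \<Rightarrow> real set" where
  "exch_interval x j = {x (j - 1)..<x j}"


section \<open>First return maps\<close>

definition return_time :: "('a \<Rightarrow> 'a) \<Rightarrow> 'a set \<Rightarrow> 'a \<Rightarrow> nat" where
  "return_time f A t = (LEAST n. 1 \<le> n \<and> (f ^^ n) t \<in> A)"

definition first_return :: "('a \<Rightarrow> 'a) \<Rightarrow> 'a set \<Rightarrow> 'a \<Rightarrow> 'a" where
  "first_return f A t = (f ^^ return_time f A t) t"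


section \<open>Rauzy--Veech induction\<close>

text \<open>A state \<open>(I, J, F)\<close> consists of the interval \<open>I\<close>, its labelled exchanged subintervals
  \<open>J 1, \<dots>, J d\<close> (not necessarily in left-to-right order) and the map \<open>F\<close> on \<open>I\<close>.\<close>

type_synonym rv_state = "real set \<times> (nat \<Rightarrow> real set) \<times> (real \<Rightarrow> real)"

definition rightmost :: "nat \<Rightarrow> (nat \<Rightarrow> real set) \<Rightarrow> nat \<Rightarrow> bool" where
  "rightmost d J j \<longleftrightarrow>
     j \<in> {1..d} \<and> (\<forall>i\<in>{1..d}. i \<noteq> j \<longrightarrow> (\<forall>s\<in>J i. \<forall>t\<in>J j. s < t))"

definition rv_step :: "nat \<Rightarrow> rv_state \<Rightarrow> rv_state" where
  "rv_step d = (\<lambda>(I, J, F).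
     let \<alpha> = (THE j. rightmost d J j);
         \<beta> = (THE j. rightmost d (\<lambda>i. F ` J i) j);
         P = {t \<in> I. F t \<in> J \<alpha>}
     in if measure lborel (J \<alpha>) > measure lborel (J \<beta>)
        then (let I' = I - F ` J \<beta> in
               (I', J(\<alpha> := J \<alpha> - F ` J \<beta>), first_return F I'))
        else (let I' = I - J \<alpha> in
               (I', J(\<alpha> := P, \<beta> := J \<beta> - P), first_return F I')))"

definition rv_iter :: "nat \<Rightarrow> (nat \<Rightarrow> real) \<Rightarrow> (real \<Rightarrow> real) \<Rightarrow> nat \<Rightarrow> rv_state" where
  "rv_iter d x F k = (rv_step d ^^ k) ({x 0..<x d}, exch_interval x, F)"

definition rv_dom :: "nat \<Rightarrow> (nat \<Rightarrow> real) \<Rightarrow> (real \<Rightarrow> real) \<Rightarrow> nat \<Rightarrow> real set" where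
  "rv_dom d x F k = fst (rv_iter d x F k)"

definition rv_int :: "nat \<Rightarrow> (nat \<Rightarrow> real) \<Rightarrow> (real \<Rightarrow> real) \<Rightarrow> nat \<Rightarrow> nat \<Rightarrow> real set" where
  "rv_int d x F k = fst (snd (rv_iter d x F k))"

text \<open>The return time to \<open>rv_dom d x F k\<close> is constant on each \<open>rv_int d x F k j\<close>.\<close>

definition rv_time :: "nat \<Rightarrow> (nat \<Rightarrow> real) \<Rightarrow> (real \<Rightarrow> real) \<Rightarrow> nat \<Rightarrow> nat \<Rightarrow> nat" where
  "rv_time d x F k j = (THE q. \<forall>t\<in>rv_int d x F k j. return_time F (rv_dom d x F k) t = q)"

definition rv_matrix :: "nat \<Rightarrow> (nat \<Rightarrow> real) \<Rightarrow> (real \<Rightarrow> real) \<Rightarrow> nat \<Rightarrow> nat \<Rightarrow> nat \<Rightarrow> nat" where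
  "rv_matrix d x F k i j =
     card {l. l < rv_time d x F k j \<and> (F ^^ l) ` rv_int d x F k j \<subseteq> exch_interval x i}"

definition infinitely_complete :: "nat \<Rightarrow> (nat \<Rightarrow> real) \<Rightarrow> (real \<Rightarrow> real) \<Rightarrow> bool" where
  "infinitely_complete d x F \<longleftrightarrow>
     (\<forall>i\<in>{1..d}. \<forall>j\<in>{1..d}. filterlim (\<lambda>n. rv_matrix d x F n i j) at_top sequentially)"


section \<open>Compactification of an interval exchange transformation on \<open>[0,1)\<close>\<close>

definition Dplus :: "nat \<Rightarrow> (nat \<Rightarrow> real) \<Rightarrow> (real \<Rightarrow> real) \<Rightarrow> nat \<Rightarrow> real set" where
  "Dplus d x F n = (F ^^ n) ` (F ` x ` {0..<d} - {0})"

definition Dminus :: "nat \<Rightarrow> (nat \<Rightarrow> real) \<Rightarrow> (real \<Rightarrow> real) \<Rightarrow> nat \<Rightarrow> real set" where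
  "Dminus d x F n = (inv_into {0..<1} F ^^ n) ` x ` {1..<d}"

text \<open>The value on \<open>A\<close> of the purely atomic measure
  \<open>\<Sum>n. \<Sum>p \<in> Dplus n \<squnion> Dminus n. 2\<^sup>-\<^sup>n \<delta>\<^sub>p\<close> (disjoint union: a point lying in both sets counts twice).\<close>

definition rho :: "nat \<Rightarrow> (nat \<Rightarrow> real) \<Rightarrow> (real \<Rightarrow> real) \<Rightarrow> real set \<Rightarrow> real" where
  "rho d x F A =
     (\<Sum>n. (1 / 2) ^ n * (real (card (Dplus d x F n \<inter> A)) + real (card (Dminus d x F n \<inter> A))))"

definition lmap :: "nat \<Rightarrow> (nat \<Rightarrow> real) \<Rightarrow> (real \<Rightarrow> real) \<Rightarrow> real \<Rightarrow> real" where
  "lmap d x F t = rho d x F {0..<t}"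

definition rmap :: "nat \<Rightarrow> (nat \<Rightarrow> real) \<Rightarrow> (real \<Rightarrow> real) \<Rightarrow> real \<Rightarrow> real" where
  "rmap d x F t = rho d x F {0..t}"

definition Kset :: "nat \<Rightarrow> (nat \<Rightarrow> real) \<Rightarrow> (real \<Rightarrow> real) \<Rightarrow> real set" where
  "Kset d x F = lmap d x F ` {0<..1} \<union> rmap d x F ` {0..<1}"

definition Kpart :: "nat \<Rightarrow> (nat \<Rightarrow> real) \<Rightarrow> (real \<Rightarrow> real) \<Rightarrow> nat \<Rightarrow> real set" where
  "Kpart d x F i = lmap d x F ` {x (i - 1)<..x i} \<union> rmap d x F ` {x (i - 1)..<x i}"

text \<open>These conditions determine \<open>T\<close> on \<open>Kset d x F\<close>, in which the image of \<open>rmap d x F\<close> is dense.\<close>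

definition continuous_extension ::
    "nat \<Rightarrow> (nat \<Rightarrow> real) \<Rightarrow> (real \<Rightarrow> real) \<Rightarrow> (real \<Rightarrow> real) \<Rightarrow> bool" where
  "continuous_extension d x F T \<longleftrightarrow>
     (\<exists>S. homeomorphism (Kset d x F) (Kset d x F) T S) \<and>
     (\<forall>t\<in>{0..<1}. T (rmap d x F t) = rmap d x F (F t))"


section \<open>Skew products and periodic type\<close>

definition cocycle_I :: "nat \<Rightarrow> (nat \<Rightarrow> real) \<Rightarrow> (nat \<Rightarrow> 'g) \<Rightarrow> real \<Rightarrow> 'g" where
  "cocycle_I d x \<phi> t = \<phi> (THE i. i \<in> {1..d} \<and> t \<in> exch_interval x i)"

definition cocycle_K ::
    "nat \<Rightarrow> (nat \<Rightarrow> real) \<Rightarrow> (real \<Rightarrow> real) \<Rightarrow> (nat \<Rightarrow> 'g) \<Rightarrow> real \<Rightarrow> 'g" where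
  "cocycle_K d x F \<phi> p = \<phi> (THE i. i \<in> {1..d} \<and> p \<in> Kpart d x F i)"

definition skew :: "('a \<Rightarrow> 'a) \<Rightarrow> ('a \<Rightarrow> 'g::plus) \<Rightarrow> 'a \<times> 'g \<Rightarrow> 'a \<times> 'g" where
  "skew S f = (\<lambda>(p, a). (S p, a + f p))"

definition rescaled_return ::
    "nat \<Rightarrow> (nat \<Rightarrow> real) \<Rightarrow> (real \<Rightarrow> real) \<Rightarrow> (nat \<Rightarrow> 'g::plus) \<Rightarrow> nat \<Rightarrow> real \<times> 'g \<Rightarrow> real \<times> 'g" where
  "rescaled_return d x F \<phi> N = (\<lambda>(t, a).
     let I = rv_dom d x F N;
         c = measure lborel I;
         (s, b) = first_return (skew F (cocycle_I d x \<phi>)) (I \<times> UNIV) (c * t, a)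
     in (s / c, b))"

text \<open>The last conjunct is equality of the labelled exchanged intervals. The extension \<open>T\<^sub>\<phi>\<close> to the
  compactification is by definition of periodic type iff \<open>F\<^sub>\<phi>\<close> is.\<close>

definition periodic_type ::
    "nat \<Rightarrow> (nat \<Rightarrow> real) \<Rightarrow> (real \<Rightarrow> real) \<Rightarrow> (nat \<Rightarrow> 'g::plus) \<Rightarrow> bool" where
  "periodic_type d x F \<phi> \<longleftrightarrow>
     (\<exists>N\<ge>1.
        (\<forall>t\<in>{0..<1}. \<forall>a. rescaled_return d x F \<phi> N (t, a) = skew F (cocycle_I d x \<phi>) (t, a)) \<and>
        (\<forall>j\<in>{1..d}. (\<lambda>t. t / measure lborel (rv_dom d x F N)) ` rv_int d x F N j
                      = exch_interval x j))"


section \<open>Maharam measures\<close>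

text \<open>Nonzero finite Borel measures \<open>\<nu>\<close> on \<open>Kset d x F\<close> for which \<open>exp (- \<psi> \<circ> \<phi>)\<close> is the
  Radon--Nikodym derivative of \<open>B \<mapsto> \<nu> (T ` B)\<close> with respect to \<open>\<nu>\<close>.\<close>

definition conformal_measure ::
    "nat \<Rightarrow> (nat \<Rightarrow> real) \<Rightarrow> (real \<Rightarrow> real) \<Rightarrow> (real \<Rightarrow> real) \<Rightarrow> (nat \<Rightarrow> 'g) \<Rightarrow> ('g \<Rightarrow> real)
       \<Rightarrow> real measure \<Rightarrow> bool" where
  "conformal_measure d x F T \<phi> \<psi> \<nu> \<longleftrightarrow>
     sets \<nu> = sets (restrict_space borel (Kset d x F)) \<and>
     finite_measure \<nu> \<and> emeasure \<nu> (Kset d x F) \<noteq> 0 \<and>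
     (\<forall>B\<in>sets \<nu>. emeasure \<nu> (T ` B) =
        (\<integral>\<^sup>+p\<in>B. ennreal (exp (- \<psi> (cocycle_K d x F \<phi> p))) \<partial>\<nu>))"

text \<open>As the group is countable and discrete, the product \<open>\<sigma>\<close>-algebra is the Borel \<open>\<sigma>\<close>-algebra.\<close>

definition maharam_measure ::
    "nat \<Rightarrow> (nat \<Rightarrow> real) \<Rightarrow> (real \<Rightarrow> real) \<Rightarrow> (real \<Rightarrow> real) \<Rightarrow> (nat \<Rightarrow> 'g) \<Rightarrow> ('g \<Rightarrow> real)
       \<Rightarrow> (real \<times> 'g) measure \<Rightarrow> bool" where
  "maharam_measure d x F T \<phi> \<psi> \<mu> \<longleftrightarrow>
     (\<exists>\<nu>. conformal_measure d x F T \<phi> \<psi> \<nu> \<and>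
          \<mu> = density (\<nu> \<Otimes>\<^sub>M count_space UNIV) (\<lambda>(p, a). ennreal (exp (\<psi> a))))"


section \<open>The space of homomorphisms\<close>

text \<open>\<open>Hom_real\<close> is regarded as a subspace of the function space, so it carries the topology of
  pointwise convergence; by the lemma below this is the standard topology of \<open>\<real>\<^sup>m\<close>.\<close>

definition Hom_real :: "('g::ab_group_add \<Rightarrow> real) set" where
  "Hom_real = {\<psi>. Modules.additive \<psi>}"

lemma additive_sum_expansion:
  fixes \<psi> :: "int ^ 'm \<Rightarrow> real"
  assumes "Modules.additive \<psi>"
  shows "\<psi> a = (\<Sum>i\<in>UNIV. \<psi> (axis i 1) * of_int (a $ i))"
proof -
  interpret Modules.additive \<psi> by fact
  have nat: "\<psi> (of_nat n *s v) = of_nat n * \<psi> v" for n v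
    by (induction n) (simp_all add: zero add vector_sadd_rdistrib distrib_right)
  have int: "\<psi> (k *s v) = of_int k * \<psi> v" for k v
  proof (cases k rule: int_cases2)
    case (nonneg n)
    then show ?thesis using nat[of n v] by simp
  next
    case (nonpos n)
    then have "k *s v = - (of_nat n *s v)" by (simp add: vec_eq_iff)
    then show ?thesis using nat[of n v] nonpos by (simp add: minus)
  qed
  have "(\<Sum>j\<in>UNIV. a $ j * (if i = j then 1 else 0)) = a $ i" for i
    by (subst sum.mono_neutral_right[of _ "{i}"]) auto
  then have "a = (\<Sum>i\<in>UNIV. (a $ i) *s axis i 1)"
    by (simp add: vec_eq_iff axis_def)
  then have "\<psi> a = \<psi> (\<Sum>i\<in>UNIV. (a $ i) *s axis i 1)" by (rule arg_cong)
  also have "\<dots> = (\<Sum>i\<in>UNIV. \<psi> ((a $ i) *s axis i 1))" by (rule sum)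
  finally show ?thesis unfolding int by (simp only: mult.commute)
qed

lemma homeomorphism_Hom_real:
  "homeomorphism UNIV (Hom_real :: (int ^ 'm \<Rightarrow> real) set)
     (\<lambda>t a. \<Sum>i\<in>UNIV. t $ i * of_int (a $ i)) (\<lambda>\<psi>. \<chi> i. \<psi> (axis i 1))"
proof (rule homeomorphismI)
  show "continuous_on UNIV (\<lambda>(t :: real ^ 'm) (a :: int ^ 'm). \<Sum>i\<in>UNIV. t $ i * of_int (a $ i))"
    by (intro continuous_on_coordinatewise_then_product continuous_intros)
  show "continuous_on Hom_real (\<lambda>\<psi> :: int ^ 'm \<Rightarrow> real. \<chi> i. \<psi> (axis i 1))"
    by (rule continuous_on_vec_lambda, rule continuous_on_product_then_coordinatewise) (rule continuous_on_id)
  show "(\<lambda>(t :: real ^ 'm) a. \<Sum>i\<in>UNIV. t $ i * of_int (a $ i)) ` UNIV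
      \<subseteq> (Hom_real :: (int ^ 'm \<Rightarrow> real) set)"
    by (auto simp: Hom_real_def Modules.additive_def distrib_left sum.distrib)
  show "(\<chi> i. \<Sum>j\<in>UNIV. t $ j * of_int (axis i 1 $ j :: int)) = t" for t :: "real ^ 'm"
  proof -
    have "(\<Sum>j\<in>UNIV. t $ j * of_int (axis i 1 $ j :: int)) = t $ i" for i
      by (subst sum.mono_neutral_right[of _ "{i}"]) (auto simp: axis_def)
    then show ?thesis by (simp add: vec_eq_iff)
  qed
  show "(\<lambda>a. \<Sum>i\<in>UNIV. (\<chi> i. \<psi> (axis i 1)) $ i * of_int (a $ i)) = \<psi>"
    if "\<psi> \<in> Hom_real" for \<psi> :: "int ^ 'm \<Rightarrow> real"
  proof
    fix a
    have "Modules.additive \<psi>" using that by (simp add: Hom_real_def)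
    from additive_sum_expansion[OF this, of a]
    show "(\<Sum>i\<in>UNIV. (\<chi> i. \<psi> (axis i 1)) $ i * of_int (a $ i)) = \<psi> a"
      by (simp only: vec_lambda_beta)
  qed
qed simp

end

theory Submission
  imports Defs
begin

text \<open>By periodicity the first return map to \<open>[0, c\<^sup>k)\<close> is a rescaled copy of \<open>F\<^sub>\<phi>\<close> for every \<open>k\<close>, so for a
  conformal measure \<open>\<nu>\<^sub>\<psi>\<close> the masses \<open>V k i\<close> of the intervals \<open>c\<^sup>k I\<^sub>i\<close> satisfy
  \<open>V k = M\<^sub>\<psi> (V (k + 1))\<close> with one and the same matrix \<open>M\<^sub>\<psi>\<close>, whose entries are finite sums of
  exponentials of \<open>-\<psi>\<close>. Infinite completeness makes \<open>M\<^sub>\<psi>\<close> positive after passing to a power of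
  the period. A Birkhoff contraction estimate for the ratios of two such backward orbits, applied to
  \<open>M\<^sub>\<psi>\<close> and a nearby \<open>M\<^sub>\<psi>'\<close>, shows that the normalised \<open>V k\<close> depends continuously on \<open>\<psi>\<close>; hence so
  does the mass of every tower floor. The floors have mesh tending to \<open>0\<close> in \<open>K\<close>, so integrals of
  continuous functions are limits, uniform in \<open>\<psi>\<close>, of continuous functions of \<open>\<psi>\<close>.\<close>


section \<open>Backward orbits of positive matrices\<close>

text \<open>Rauzy--Veech induction cuts half-open intervals of [0,1), but the measures live on
  \<open>K\<close>, and disjoint intervals may still have closures in \<open>K\<close> that touch,
  which would spoil additivity. The combinatorics is therefore done for an arbitrary relation
  \<open>sep\<close> that is invariant under the map. Disjointness in [0,1) is one instance,
  disjointness of closures in \<open>K\<close> another, and each cut made by the induction has to be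
  shown to separate. One matrix serves all k because V k = M (V (k + 1)) is the formula of a single
  tower applied to the set functions S \<mapsto> m (c^k S). By periodicity they transform under F
  like m, but they are additive only for a rescaled relation and do not come as measures on
  \<open>K\<close>; this is why \<open>conformal\<close> asks for a finitely additive set function.
  The contraction acts on the spread b / a of bounds a v \<le> u \<le> b v. A backward orbit has no
  last term, so contraction can start arbitrarily far out, where positivity bounds the spread
  independently of the level. What survives is the fixed point of the error recursion, which tends
  to 1 as the two matrices approach each other.\<close>

lemma positive_ratio_step:
  fixes M M' :: "'i \<Rightarrow> 'i \<Rightarrow> real" and u v :: "'i \<Rightarrow> real"
  assumes D: "finite D" "D \<noteq> {}" and E: "E \<ge> 1"
    and lo: "\<And>i j. i \<in> D \<Longrightarrow> j \<in> D \<Longrightarrow> \<delta> \<le> M' i j"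
    and hi: "\<And>i j. i \<in> D \<Longrightarrow> j \<in> D \<Longrightarrow> M' i j \<le> \<Delta>"
    and dD: "0 < \<delta>" "\<delta> \<le> \<Delta>"
    and MM': "\<And>i j. i \<in> D \<Longrightarrow> j \<in> D \<Longrightarrow> M i j \<le> E * M' i j"
    and M'M: "\<And>i j. i \<in> D \<Longrightarrow> j \<in> D \<Longrightarrow> M' i j \<le> E * M i j"
    and pos: "\<And>i. i \<in> D \<Longrightarrow> 0 < u i" "\<And>i. i \<in> D \<Longrightarrow> 0 < v i"
    and ab: "\<And>i. i \<in> D \<Longrightarrow> a * v i \<le> u i" "\<And>i. i \<in> D \<Longrightarrow> u i \<le> b * v i"
    and a: "0 < a" and bC: "b \<le> C * a" and C: "1 \<le> C"
  shows "\<exists>a' b'. 0 < a' \<and> b' \<le> E\<^sup>2 * (1 + (1 - \<delta> / \<Delta>) * (C - 1)) * a' \<and>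
     (\<forall>i\<in>D. a' * (\<Sum>j\<in>D. M' i j * v j) \<le> (\<Sum>j\<in>D. M i j * u j) \<and>
            (\<Sum>j\<in>D. M i j * u j) \<le> b' * (\<Sum>j\<in>D. M' i j * v j))"
proof -
  define U W where "U = sum u D" and "W = sum v D"
  have W: "W > 0" unfolding W_def using D pos by (intro sum_pos) auto
  define s where "s = U / W"
  define \<kappa> where "\<kappa> = \<delta> / \<Delta>"
  have \<kappa>: "0 < \<kappa>" "\<kappa> \<le> 1" using dD by (auto simp: \<kappa>_def)
  have U: "U = s * W" using W by (simp add: s_def)
  have "a * W \<le> U" "U \<le> b * W"
    unfolding U_def W_def sum_distrib_left using ab by (auto intro: sum_mono)
  then have s: "a \<le> s" "s \<le> b" using W by (auto simp: U)
  \<comment> \<open>Both bounds move at least the fraction \<open>\<kappa>\<close> of the way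
    towards the mean ratio \<open>s\<close>: the vector \<open>u - a v\<close> is nonnegative, so
    \<open>M'\<close> sends it above \<open>\<delta>\<close> times its sum
    \<open>(s - a) * W\<close>, while \<open>\<kappa>\<close> times an entry of \<open>M' v\<close>
    is at most \<open>\<delta> * W\<close>. The upper bound is symmetric, with
    \<open>b v - u\<close>.\<close>
  define a1 b1 where "a1 = a + \<kappa> * (s - a)" and "b1 = b - \<kappa> * (b - s)"
  have a1: "0 < a1" using a s \<kappa> by (simp add: a1_def add_pos_nonneg)
  have b1a1: "b1 \<le> (1 + (1 - \<kappa>) * (C - 1)) * a1"
  proof -
    have "b1 = (1 - \<kappa>) * b + \<kappa> * s" by (simp add: b1_def algebra_simps)
    also have "\<dots> \<le> (1 - \<kappa>) * (C * a) + \<kappa> * s" using bC \<kappa> by (intro add_right_mono mult_left_mono) auto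
    \<comment> \<open>The added term is nonnegative and is exactly what turns the right-hand side
      into a multiple of \<open>a1\<close>.\<close>
    also have "\<dots> \<le> (1 - \<kappa>) * (C * a) + \<kappa> * s + \<kappa> * (1 - \<kappa>) * (C - 1) * (s - a)"
      using \<kappa> C s by auto
    also have "\<dots> = (1 + (1 - \<kappa>) * (C - 1)) * a1" by (simp add: a1_def algebra_simps)
    finally show ?thesis .
  qed
  have key: "a1 * (\<Sum>j\<in>D. M' i j * v j) \<le> (\<Sum>j\<in>D. M' i j * u j)
      \<and> (\<Sum>j\<in>D. M' i j * u j) \<le> b1 * (\<Sum>j\<in>D. M' i j * v j)" if i: "i \<in> D" for i
  proof -
    define y where "y = (\<Sum>j\<in>D. M' i j * v j)"
    have "y \<le> (\<Sum>j\<in>D. \<Delta> * v j)" unfolding y_def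
      using hi[OF i] pos by (intro sum_mono mult_right_mono) (auto intro: less_imp_le)
    then have "y \<le> \<Delta> * W" by (simp add: W_def sum_distrib_left)
    then have "\<delta> * (y / \<Delta>) \<le> \<delta> * W" using dD by (intro mult_left_mono) (auto simp: field_simps)
    then have yW: "\<kappa> * y \<le> \<delta> * W" by (simp add: \<kappa>_def)
    have "(\<Sum>j\<in>D. \<delta> * (u j - a * v j)) \<le> (\<Sum>j\<in>D. M' i j * (u j - a * v j))"
      using lo[OF i] ab by (intro sum_mono mult_right_mono) auto
    then have "\<delta> * (U - a * W) \<le> (\<Sum>j\<in>D. M' i j * u j) - a * y"
      by (simp add: U_def W_def y_def sum_distrib_left sum_subtractf right_diff_distrib mult.left_commute)
    moreover have "(s - a) * (\<kappa> * y) \<le> (s - a) * (\<delta> * W)" using yW s by (intro mult_left_mono) auto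
    ultimately have 1: "a1 * y \<le> (\<Sum>j\<in>D. M' i j * u j)" by (simp add: a1_def U algebra_simps)
    have "(\<Sum>j\<in>D. \<delta> * (b * v j - u j)) \<le> (\<Sum>j\<in>D. M' i j * (b * v j - u j))"
      using lo[OF i] ab by (intro sum_mono mult_right_mono) auto
    then have "\<delta> * (b * W - U) \<le> b * y - (\<Sum>j\<in>D. M' i j * u j)"
      by (simp add: U_def W_def y_def sum_distrib_left sum_subtractf right_diff_distrib mult.left_commute)
    moreover have "(b - s) * (\<kappa> * y) \<le> (b - s) * (\<delta> * W)" using yW s by (intro mult_left_mono) auto
    ultimately have "(\<Sum>j\<in>D. M' i j * u j) \<le> b1 * y" by (simp add: b1_def U algebra_simps)
    with 1 show ?thesis by (simp add: y_def)
  qed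
  \<comment> \<open>The vector \<open>u\<close> is really moved by \<open>M\<close>. Exchanging
    \<open>M'\<close> for \<open>M\<close> costs a factor \<open>E\<close> in the lower and in the
    upper bound, hence \<open>E\<^sup>2\<close> in the spread.\<close>
  have comp: "(\<Sum>j\<in>D. M' i j * u j) \<le> E * (\<Sum>j\<in>D. M i j * u j)"
       "(\<Sum>j\<in>D. M i j * u j) \<le> E * (\<Sum>j\<in>D. M' i j * u j)" if "i \<in> D" for i
    unfolding sum_distrib_left mult.assoc[symmetric]
    using MM'[OF that] M'M[OF that] pos by (auto intro!: sum_mono mult_right_mono simp: less_imp_le)
  show ?thesis
  proof (rule exI[of _ "a1 / E"], rule exI[of _ "E * b1"], intro conjI ballI)
    show "0 < a1 / E" using a1 E by simp
    show "E * b1 \<le> E\<^sup>2 * (1 + (1 - \<delta> / \<Delta>) * (C - 1)) * (a1 / E)"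
      using mult_left_mono[OF b1a1, of E] E by (simp add: power2_eq_square \<kappa>_def mult.assoc)
    fix i assume i: "i \<in> D"
    show "a1 / E * (\<Sum>j\<in>D. M' i j * v j) \<le> (\<Sum>j\<in>D. M i j * u j)"
      using key[OF i] comp[OF i] E by (simp add: field_simps)
    show "(\<Sum>j\<in>D. M i j * u j) \<le> E * b1 * (\<Sum>j\<in>D. M' i j * v j)"
    proof -
      have "E * (\<Sum>j\<in>D. M' i j * u j) \<le> E * (b1 * (\<Sum>j\<in>D. M' i j * v j))"
        using key[OF i] E by (intro mult_left_mono) auto
      then show ?thesis using comp(2)[OF i] by (simp only: mult.assoc)
    qed
  qed
qed

text \<open>A level that vanished on \<open>D\<close> would force level 0 to vanish, against the
  normalisation. So level \<open>Suc k\<close> has a nonzero entry, and one positive entry is enough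
  for a positive matrix to make all of level \<open>k\<close> positive.\<close>

lemma backward_orbit_pos:
  fixes M :: "'i \<Rightarrow> 'i \<Rightarrow> real" and V :: "nat \<Rightarrow> 'i \<Rightarrow> real"
  assumes D: "finite D"
    and M: "\<And>i j. i \<in> D \<Longrightarrow> j \<in> D \<Longrightarrow> 0 < M i j"
    and nonneg: "\<And>k i. i \<in> D \<Longrightarrow> 0 \<le> V k i"
    and rec: "\<And>k i. i \<in> D \<Longrightarrow> V k i = (\<Sum>j\<in>D. M i j * V (Suc k) j)"
    and norm: "(\<Sum>i\<in>D. V 0 i) = 1"
    and i: "i \<in> D"
  shows "0 < V k i"
proof -
  have nz: "\<exists>j\<in>D. V k j \<noteq> 0" for k
  proof (induction k)
    case 0
    then show ?case using norm by (metis sum.neutral zero_neq_one)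
  next
    case (Suc k)
    then obtain j where j: "j \<in> D" "V k j \<noteq> 0" by blast
    then have "(\<Sum>l\<in>D. M j l * V (Suc k) l) \<noteq> 0" using rec by simp
    then show ?case by (metis (no_types, lifting) mult_zero_right sum.neutral)
  qed
  then obtain j where j: "j \<in> D" "V (Suc k) j \<noteq> 0" by blast
  then have "0 < M i j * V (Suc k) j" using M[OF i] nonneg by (simp add: order_less_le)
  then show ?thesis unfolding rec[OF i]
    using D j i M nonneg by (intro sum_pos2[of _ j]) (auto simp: less_imp_le)
qed

text \<open>For \<open>E = 1\<close> this is uniqueness of the normalised backward orbit of a
  positive matrix; the lemma is its quantitative form. The spread of the ratios at level
  \<open>k\<close> is bounded by contracting from level \<open>k + n\<close> and letting n tend to
  infinity. This is a projective statement; the scale is then fixed at level 0, where both sums are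
  1, and reaching level 0 costs a factor \<open>E\<close> per level, whence
  \<open>E ^ k\<close>.\<close>

lemma ratio_limit_bound:
  fixes M M' :: "'i \<Rightarrow> 'i \<Rightarrow> real" and u v :: "nat \<Rightarrow> 'i \<Rightarrow> real"
  assumes D: "finite D" "D \<noteq> {}" and E: "E \<ge> 1"
    and lo: "\<And>i j. i \<in> D \<Longrightarrow> j \<in> D \<Longrightarrow> \<delta> \<le> M' i j"
    and hi: "\<And>i j. i \<in> D \<Longrightarrow> j \<in> D \<Longrightarrow> M' i j \<le> \<Delta>"
    and dD: "0 < \<delta>" "\<delta> \<le> \<Delta>"
    and MM': "\<And>i j. i \<in> D \<Longrightarrow> j \<in> D \<Longrightarrow> M i j \<le> E * M' i j"
    and M'M: "\<And>i j. i \<in> D \<Longrightarrow> j \<in> D \<Longrightarrow> M' i j \<le> E * M i j"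
    and nonneg: "\<And>k i. i \<in> D \<Longrightarrow> 0 \<le> u k i" "\<And>k i. i \<in> D \<Longrightarrow> 0 \<le> v k i"
    and rec: "\<And>k i. i \<in> D \<Longrightarrow> u k i = (\<Sum>j\<in>D. M i j * u (Suc k) j)"
      "\<And>k i. i \<in> D \<Longrightarrow> v k i = (\<Sum>j\<in>D. M' i j * v (Suc k) j)"
    and norm: "(\<Sum>i\<in>D. u 0 i) = 1" "(\<Sum>i\<in>D. v 0 i) = 1"
    and \<theta>: "E\<^sup>2 * (1 - \<delta> / \<Delta>) \<le> \<theta>" "0 \<le> \<theta>" "\<theta> < 1"
    and i: "i \<in> D"
  shows "u k i \<le> (1 + (E\<^sup>2 - 1) / (1 - \<theta>)) * E ^ k * v k i"
    and "v k i \<le> (1 + (E\<^sup>2 - 1) / (1 - \<theta>)) * E ^ k * u k i"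
proof -
  have M'pos: "0 < M' i j" if "i \<in> D" "j \<in> D" for i j using lo[OF that] dD by simp
  have Mpos: "0 < M i j" if "i \<in> D" "j \<in> D" for i j
    using M'M[OF that] M'pos[OF that] E by (smt (verit) mult_nonneg_nonpos)
  have upos: "0 < u k i" if "i \<in> D" for k i
    by (rule backward_orbit_pos[OF D(1) Mpos nonneg(1) rec(1) norm(1) that])
  have vpos: "0 < v k i" if "i \<in> D" for k i
    by (rule backward_orbit_pos[OF D(1) M'pos nonneg(2) rec(2) norm(2) that])
  define P where "P k C \<longleftrightarrow> (\<exists>a b. 0 < a \<and> b \<le> C * a \<and> (\<forall>i\<in>D. a * v k i \<le> u k i \<and> u k i \<le> b * v k i))"
    for k C
  have P_mono: "P k C'" if "P k C" "C \<le> C'" for k C C'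
    using that unfolding P_def by (meson mult_right_mono less_imp_le order_trans)
  \<comment> \<open>All entries of \<open>u k\<close> and of \<open>v k\<close> lie within fixed
    factors of the sums at level \<open>Suc k\<close>, so the spread is at most
    \<open>E\<^sup>2 * (\<Delta> / \<delta>)\<^sup>2\<close> at every level. The summand 1 makes
    \<open>C0 \<ge> 1\<close> immediate.\<close>
  define C0 where "C0 = 1 + E\<^sup>2 * (\<Delta> / \<delta>)\<^sup>2"
  have C0: "C0 \<ge> 1" by (simp add: C0_def)
  have base: "P k C0" for k
  proof -
    define U W where "U = sum (u (Suc k)) D" and "W = sum (v (Suc k)) D"
    have UW: "U > 0" "W > 0" unfolding U_def W_def using D upos vpos by (auto intro: sum_pos)
    have *: "\<delta> * U \<le> E * u k i \<and> u k i \<le> E * \<Delta> * U \<and> \<delta> * W \<le> v k i \<and> v k i \<le> \<Delta> * W" if i: "i \<in> D" for i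
    proof (intro conjI)
      have "\<delta> * U \<le> (\<Sum>j\<in>D. M' i j * u (Suc k) j)" unfolding U_def sum_distrib_left
        using lo[OF i] upos by (intro sum_mono mult_right_mono) (auto simp: less_imp_le)
      also have "\<dots> \<le> (\<Sum>j\<in>D. E * M i j * u (Suc k) j)"
        using M'M[OF i] upos by (intro sum_mono mult_right_mono) (auto simp: less_imp_le)
      finally show "\<delta> * U \<le> E * u k i" by (simp add: rec(1)[OF i, of k] sum_distrib_left mult.assoc)
      have "u k i \<le> (\<Sum>j\<in>D. E * M' i j * u (Suc k) j)" unfolding rec(1)[OF i, of k]
        using MM'[OF i] upos by (intro sum_mono mult_right_mono) (auto simp: less_imp_le)
      also have "\<dots> \<le> (\<Sum>j\<in>D. E * \<Delta> * u (Suc k) j)"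
        using hi[OF i] upos E by (intro sum_mono mult_right_mono) (auto simp: less_imp_le)
      finally show "u k i \<le> E * \<Delta> * U" by (simp add: U_def sum_distrib_left)
      show "\<delta> * W \<le> v k i" unfolding W_def sum_distrib_left rec(2)[OF i, of k]
        using lo[OF i] vpos by (intro sum_mono mult_right_mono) (auto simp: less_imp_le)
      show "v k i \<le> \<Delta> * W" unfolding W_def sum_distrib_left rec(2)[OF i, of k]
        using hi[OF i] vpos by (intro sum_mono mult_right_mono) (auto simp: less_imp_le)
    qed
    define a b where "a = \<delta> * U / (E * \<Delta> * W)" and "b = E * \<Delta> * U / (\<delta> * W)"
    have D0: "0 < \<Delta>" using dD by simp
    have a0: "0 < a" using UW dD E by (simp add: a_def)
    have "b = E\<^sup>2 * (\<Delta> / \<delta>)\<^sup>2 * a" using UW dD E by (simp add: a_def b_def field_simps power2_eq_square)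
    then have "b \<le> C0 * a" using a0 by (simp add: C0_def algebra_simps)
    moreover have "a * v k i \<le> u k i \<and> u k i \<le> b * v k i" if i: "i \<in> D" for i
    proof
      have "a * v k i \<le> a * (\<Delta> * W)" using a0 *[OF i] by (intro mult_left_mono) auto
      also have "\<dots> = \<delta> * U / E" using UW D0 E by (simp add: a_def)
      also have "\<dots> \<le> u k i" using *[OF i] E by (simp add: field_simps)
      finally show "a * v k i \<le> u k i" .
      have b0: "0 \<le> b" using UW D0 dD E by (simp add: b_def)
      have "u k i \<le> b * (\<delta> * W)" using *[OF i] UW dD by (simp add: b_def)
      also have "\<dots> \<le> b * v k i" using b0 *[OF i] by (intro mult_left_mono) auto
      finally show "u k i \<le> b * v k i" .
    qed
    ultimately show ?thesis unfolding P_def using a0 by blast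
  qed
  \<comment> \<open>\<open>\<epsilon>\<close> is the fixed point of t \<mapsto> \<theta> t + (E^2 -
    1), the recursion that \<open>step\<close> yields for the excess of the spread over 1.\<close>
  define \<epsilon> where "\<epsilon> = (E\<^sup>2 - 1) / (1 - \<theta>)"
  have E2: "1 \<le> E\<^sup>2" using E by simp
  have \<epsilon>: "0 \<le> \<epsilon>" using E2 \<theta> by (simp add: \<epsilon>_def)
  have \<epsilon>_eq: "\<epsilon> * \<theta> + (E\<^sup>2 - 1) = \<epsilon>" using \<theta> by (simp add: \<epsilon>_def field_simps)
  have step: "P k (1 + \<theta> * (C - 1) + (E\<^sup>2 - 1))" if "P (Suc k) C" "1 \<le> C" for k C
  proof -
    from that(1) obtain a b where ab: "0 < a" "b \<le> C * a"
      "\<And>i. i \<in> D \<Longrightarrow> a * v (Suc k) i \<le> u (Suc k) i" "\<And>i. i \<in> D \<Longrightarrow> u (Suc k) i \<le> b * v (Suc k) i"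
      unfolding P_def by blast
    have "P k (E\<^sup>2 * (1 + (1 - \<delta> / \<Delta>) * (C - 1)))"
      using positive_ratio_step[OF D E lo hi dD MM' M'M upos[of _ "Suc k"] vpos[of _ "Suc k"] ab(3,4) ab(1,2) that(2)]
      unfolding P_def by (simp add: rec[of _ k])
    moreover have "E\<^sup>2 * (1 + (1 - \<delta> / \<Delta>) * (C - 1)) = E\<^sup>2 + E\<^sup>2 * (1 - \<delta> / \<Delta>) * (C - 1)"
      by (simp add: algebra_simps)
    moreover have "\<dots> \<le> E\<^sup>2 + \<theta> * (C - 1)" using \<theta> that by (intro add_left_mono mult_right_mono) auto
    ultimately show ?thesis by (auto intro: P_mono)
  qed
  have iter: "P k (1 + \<epsilon> + \<theta> ^ n * C0)" for n k
  proof (induction n arbitrary: k)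
    case 0
    then show ?case using base[of k] \<epsilon> by (auto intro: P_mono)
  next
    case (Suc n)
    have "P k (1 + \<theta> * (1 + \<epsilon> + \<theta> ^ n * C0 - 1) + (E\<^sup>2 - 1))"
      using Suc[of "Suc k"] \<epsilon> \<theta> C0 by (intro step) auto
    also have "1 + \<theta> * (1 + \<epsilon> + \<theta> ^ n * C0 - 1) + (E\<^sup>2 - 1) = 1 + (\<epsilon> * \<theta> + (E\<^sup>2 - 1)) + \<theta> ^ Suc n * C0"
      by (simp add: algebra_simps)
    finally show ?case unfolding \<epsilon>_eq .
  qed
  \<comment> \<open>A ratio bound at level \<open>k\<close> survives down to level 0 with a loss of
    \<open>E\<close> per level; comparing the two sums there turns it into a bound on
    \<open>a\<close> itself.\<close>
  have down_a: "a \<le> E ^ k" if "\<And>i. i \<in> D \<Longrightarrow> a * v k i \<le> u k i" "0 < a" for a k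
    using that
  proof (induction k arbitrary: a)
    case 0
    have "a * (\<Sum>i\<in>D. v 0 i) \<le> (\<Sum>i\<in>D. u 0 i)" unfolding sum_distrib_left using 0 by (intro sum_mono)
    then show ?case using norm by simp
  next
    case (Suc k)
    have "a / E \<le> E ^ k"
    proof (rule Suc.IH)
      fix i assume i: "i \<in> D"
      have "a * v k i = (\<Sum>j\<in>D. M' i j * (a * v (Suc k) j))"
        by (simp add: rec(2)[OF i] sum_distrib_left mult.left_commute)
      also have "\<dots> \<le> (\<Sum>j\<in>D. E * M i j * u (Suc k) j)"
        using M'M[OF i] Suc.prems(1) M'pos[OF i] Mpos[OF i] E vpos Suc.prems(2)
        by (intro sum_mono mult_mono) (auto simp: less_imp_le)
      also have "\<dots> = E * u k i" by (simp add: rec(1)[OF i] sum_distrib_left mult.assoc)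
      finally show "a / E * v k i \<le> u k i" using E by (simp add: field_simps)
    qed (use E Suc.prems in auto)
    then show ?case using E by (simp add: field_simps)
  qed
  have down_b: "1 \<le> E ^ k * b" if "\<And>i. i \<in> D \<Longrightarrow> u k i \<le> b * v k i" "0 < b" for b k
    using that
  proof (induction k arbitrary: b)
    case 0
    have "(\<Sum>i\<in>D. u 0 i) \<le> b * (\<Sum>i\<in>D. v 0 i)" unfolding sum_distrib_left using 0 by (intro sum_mono)
    then show ?case using norm by simp
  next
    case (Suc k)
    have "1 \<le> E ^ k * (E * b)"
    proof (rule Suc.IH)
      fix i assume i: "i \<in> D"
      have "u k i \<le> (\<Sum>j\<in>D. (E * M' i j) * (b * v (Suc k) j))"
        unfolding rec(1)[OF i, of k] using MM'[OF i] Suc.prems(1) M'pos[OF i] upos E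
        by (intro sum_mono mult_mono) (auto simp: less_imp_le)
      also have "\<dots> = E * b * v k i" by (simp add: rec(2)[OF i, of k] sum_distrib_left ac_simps)
      finally show "u k i \<le> E * b * v k i" .
    qed (use E Suc.prems in auto)
    then show ?case by (simp add: ac_simps)
  qed
  have both: "u k i \<le> (1 + \<epsilon> + \<theta> ^ n * C0) * E ^ k * v k i \<and> v k i \<le> (1 + \<epsilon> + \<theta> ^ n * C0) * E ^ k * u k i" for n
  proof -
    define C where "C = 1 + \<epsilon> + \<theta> ^ n * C0"
    have C: "0 \<le> C" using \<epsilon> \<theta> C0 by (simp add: C_def)
    from iter[of k n] obtain a b where ab: "0 < a" "b \<le> C * a"
      "\<And>i. i \<in> D \<Longrightarrow> a * v k i \<le> u k i" "\<And>i. i \<in> D \<Longrightarrow> u k i \<le> b * v k i"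
      unfolding P_def C_def by blast
    have b: "0 < b" using ab(4)[OF i] upos[OF i, of k] vpos[OF i, of k] by (smt (verit) mult_nonpos_nonneg)
    have a': "a \<le> E ^ k" using down_a ab by blast
    have b': "1 \<le> E ^ k * b" using down_b[OF ab(4) b] by blast
    have "u k i \<le> (C * a) * v k i" using ab(4)[OF i] ab(2) vpos[OF i, of k] by (meson mult_right_mono less_imp_le order_trans)
    also have "\<dots> \<le> C * E ^ k * v k i" using a' C vpos[OF i, of k] by (intro mult_right_mono mult_left_mono) auto
    finally have 1: "u k i \<le> C * E ^ k * v k i" .
    have "v k i \<le> E ^ k * b * v k i" using mult_right_mono[OF b', of "v k i"] vpos[OF i, of k] by simp
    also have "\<dots> \<le> E ^ k * (C * a) * v k i" using ab(2) E vpos[OF i, of k] by (intro mult_right_mono mult_left_mono) auto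
    also have "\<dots> = C * E ^ k * (a * v k i)" by simp
    also have "\<dots> \<le> C * E ^ k * u k i" using ab(3)[OF i] C E by (intro mult_left_mono) auto
    finally show ?thesis using 1 by (simp add: C_def)
  qed
  have lim: "(\<lambda>n. (1 + \<epsilon> + \<theta> ^ n * C0) * E ^ k * y) \<longlonglongrightarrow> (1 + \<epsilon> + 0 * C0) * E ^ k * y" for y
    using \<theta> by (intro tendsto_intros LIMSEQ_power_zero) auto
  show "u k i \<le> (1 + (E\<^sup>2 - 1) / (1 - \<theta>)) * E ^ k * v k i"
    using LIMSEQ_le_const[OF lim, of "u k i" "v k i"] both by (auto simp: \<epsilon>_def)
  show "v k i \<le> (1 + (E\<^sup>2 - 1) / (1 - \<theta>)) * E ^ k * u k i"
    using LIMSEQ_le_const[OF lim, of "v k i" "u k i"] both by (auto simp: \<epsilon>_def)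
qed

text \<open>For fixed \<open>E > 1\<close> the entries of \<open>M s\<close> and \<open>M s0\<close>
  agree up to the factor \<open>E\<close> once s is near \<open>s0\<close>, which pins
  \<open>V s k i\<close> to \<open>V s0 k i\<close> up to a factor that tends to 1 as
  \<open>E\<close> decreases to 1. The level \<open>k\<close> stays fixed throughout, so the power
  \<open>E ^ k\<close> in that factor is harmless.\<close>

lemma continuous_on_backward_orbit:
  fixes M :: "'s::topological_space \<Rightarrow> 'i \<Rightarrow> 'i \<Rightarrow> real" and V :: "'s \<Rightarrow> nat \<Rightarrow> 'i \<Rightarrow> real"
  assumes D: "finite D" "D \<noteq> {}"
    and Mpos: "\<And>s i j. s \<in> X \<Longrightarrow> i \<in> D \<Longrightarrow> j \<in> D \<Longrightarrow> 0 < M s i j"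
    and Mcont: "\<And>i j. i \<in> D \<Longrightarrow> j \<in> D \<Longrightarrow> continuous_on X (\<lambda>s. M s i j)"
    and nonneg: "\<And>s k i. s \<in> X \<Longrightarrow> i \<in> D \<Longrightarrow> 0 \<le> V s k i"
    and rec: "\<And>s k i. s \<in> X \<Longrightarrow> i \<in> D \<Longrightarrow> V s k i = (\<Sum>j\<in>D. M s i j * V s (Suc k) j)"
    and norm: "\<And>s. s \<in> X \<Longrightarrow> (\<Sum>i\<in>D. V s 0 i) = 1"
    and i: "i \<in> D"
  shows "continuous_on X (\<lambda>s. V s k i)"
  unfolding continuous_on_def
proof
  fix s0 assume s0: "s0 \<in> X"
  define Z where "Z = (\<lambda>(i,j). M s0 i j) ` (D \<times> D)"
  have Z: "finite Z" "Z \<noteq> {}" using D by (auto simp: Z_def)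
  define \<delta> \<Delta> where "\<delta> = Min Z" and "\<Delta> = Max Z"
  have \<delta>: "0 < \<delta>" unfolding \<delta>_def using Z Mpos[OF s0] by (subst Min_gr_iff) (auto simp: Z_def)
  have lo: "\<delta> \<le> M s0 i j" and hi: "M s0 i j \<le> \<Delta>" if "i \<in> D" "j \<in> D" for i j
    unfolding \<delta>_def \<Delta>_def using Z that by (auto intro!: Min_le Max_ge simp: Z_def)
  have \<delta>\<Delta>: "\<delta> \<le> \<Delta>" using lo[OF i i] hi[OF i i] by simp
  define \<kappa> where "\<kappa> = \<delta> / \<Delta>"
  have \<kappa>: "0 < \<kappa>" "\<kappa> \<le> 1" using \<delta> \<delta>\<Delta> by (auto simp: \<kappa>_def)
  \<comment> \<open>The factor of \<open>ratio_limit_bound\<close> for the rate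
    \<open>1 - \<kappa> / 2\<close>. The true rate at \<open>s0\<close> is
    \<open>1 - \<kappa>\<close>; the weaker one leaves room for the loss \<open>E\<^sup>2\<close>
    when \<open>E\<close> is close to 1.\<close>
  define g where "g E = (1 + (E\<^sup>2 - 1) / (1 - (1 - \<kappa> / 2))) * E ^ k" for E :: real
  define v where "v = V s0 k i"
  have v: "0 \<le> v" unfolding v_def using nonneg s0 i by blast
  have close: "\<forall>\<^sub>F s in at s0 within X. V s k i \<le> g E * v \<and> v \<le> g E * V s k i"
    if E: "1 < E" "E\<^sup>2 * (1 - \<kappa>) \<le> 1 - \<kappa> / 2" for E
  proof -
    have "\<forall>\<^sub>F s in at s0 within X. M s i j < E * M s0 i j \<and> M s0 i j / E < M s i j"
      if ij: "i \<in> D" "j \<in> D" for i j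
    proof -
      have t: "((\<lambda>s. M s i j) \<longlongrightarrow> M s0 i j) (at s0 within X)"
        using Mcont[OF ij] s0 by (auto simp: continuous_on_def)
      show ?thesis using Mpos[OF s0 ij] E
        by (intro eventually_conj order_tendstoD[OF t]) (auto simp: field_simps)
    qed
    then have "\<forall>\<^sub>F s in at s0 within X. \<forall>i\<in>D. \<forall>j\<in>D. M s i j < E * M s0 i j \<and> M s0 i j / E < M s i j"
      using D by (simp add: eventually_ball_finite_distrib)
    moreover have "\<forall>\<^sub>F s in at s0 within X. s \<in> X" by (simp add: eventually_at_filter)
    ultimately show ?thesis
    proof eventually_elim
      case (elim s)
      then have MM: "M s i j \<le> E * M s0 i j" "M s0 i j \<le> E * M s i j" if "i \<in> D" "j \<in> D" for i j
        using that E by (auto simp: field_simps less_imp_le)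
      note B = ratio_limit_bound[OF D less_imp_le[OF E(1)] lo hi \<delta> \<delta>\<Delta> MM(1,2)
          nonneg[OF elim(2)] nonneg[OF s0] rec[OF elim(2)] rec[OF s0] norm[OF elim(2)] norm[OF s0]]
      show ?case unfolding v_def g_def
        using B[of "1 - \<kappa> / 2" i k] E \<kappa> i by (simp add: \<kappa>_def)
    qed
  qed
  have gt: "(g \<longlongrightarrow> g 1) (at_right 1)" unfolding g_def using \<kappa> by (intro tendsto_intros) auto
  have g1: "g 1 = 1" by (simp add: g_def)
  have evE: "\<forall>\<^sub>F E in at_right 1. E\<^sup>2 * (1 - \<kappa>) \<le> 1 - \<kappa> / 2"
  proof -
    have "((\<lambda>E::real. E\<^sup>2 * (1 - \<kappa>)) \<longlongrightarrow> 1\<^sup>2 * (1 - \<kappa>)) (at_right 1)" by (intro tendsto_intros)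
    then have "\<forall>\<^sub>F E in at_right 1. E\<^sup>2 * (1 - \<kappa>) < 1 - \<kappa> / 2"
      using \<kappa> by (intro order_tendstoD) auto
    then show ?thesis by eventually_elim simp
  qed
  have ev1: "\<forall>\<^sub>F E in at_right 1. (1::real) < E" by (simp add: eventually_at_right_less)
  show "((\<lambda>s. V s k i) \<longlongrightarrow> V s0 k i) (at s0 within X)"
    unfolding v_def[symmetric]
  proof (rule order_tendstoI)
    fix a assume a: "a < v"
    have "((\<lambda>E. a * g E) \<longlongrightarrow> a * 1) (at_right 1)" using gt g1 by (intro tendsto_intros) auto
    then have "\<forall>\<^sub>F E in at_right 1. a * g E < v" using a by (intro order_tendstoD) auto
    moreover have "\<forall>\<^sub>F E in at_right 1. 0 < g E" using gt g1 by (intro order_tendstoD) auto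
    ultimately have "\<forall>\<^sub>F E in at_right 1. a * g E < v \<and> 0 < g E \<and> 1 < E \<and> E\<^sup>2 * (1 - \<kappa>) \<le> 1 - \<kappa> / 2"
      using evE ev1 by eventually_elim auto
    then obtain E where E: "a * g E < v" "0 < g E" "1 < E" "E\<^sup>2 * (1 - \<kappa>) \<le> 1 - \<kappa> / 2"
      using eventually_happens[OF _] trivial_limit_at_right_real by blast
    show "\<forall>\<^sub>F s in at s0 within X. a < V s k i"
      using close[OF E(3,4)]
    proof eventually_elim
      case (elim s)
      then have "a * g E < g E * V s k i" using E(1) by linarith
      then show ?case using E(2) by (metis mult.commute mult_less_cancel_left_pos)
    qed
  next
    fix a assume a: "v < a"
    have "((\<lambda>E. g E * v) \<longlongrightarrow> 1 * v) (at_right 1)" using gt g1 by (intro tendsto_intros) auto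
    then have "\<forall>\<^sub>F E in at_right 1. g E * v < a" using a by (intro order_tendstoD) auto
    then have "\<forall>\<^sub>F E in at_right 1. g E * v < a \<and> 1 < E \<and> E\<^sup>2 * (1 - \<kappa>) \<le> 1 - \<kappa> / 2"
      using evE ev1 by eventually_elim auto
    then obtain E where E: "g E * v < a" "1 < E" "E\<^sup>2 * (1 - \<kappa>) \<le> 1 - \<kappa> / 2"
      using eventually_happens[OF _] trivial_limit_at_right_real by blast
    show "\<forall>\<^sub>F s in at s0 within X. V s k i < a"
      using close[OF E(2,3)] by eventually_elim (use E in auto)
  qed
qed


section \<open>Towers and induced maps\<close>

text \<open>A notion of being apart, respected by subsets, finite unions and the map. Its instances
  are disjointness, disjointness of closures in \<open>K\<close>, and rescalings of such relations.
  \<open>sep_image\<close> is an equivalence because separation must also be pulled back: the two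
  halves of a freshly cut interval are sometimes known to be apart only because their images
  are.\<close>

locale separation =
  fixes D :: "'i set" and sep :: "'a set \<Rightarrow> 'a set \<Rightarrow> bool" and F :: "'a \<Rightarrow> 'a"
    and \<Omega> :: "'a set" and I :: "'i \<Rightarrow> 'a set"
  assumes finite_D: "finite D"
    and union_I: "(\<Union>i\<in>D. I i) = \<Omega>"
    and maps: "F ` \<Omega> \<subseteq> \<Omega>"
    and sep_sym: "sep S U \<Longrightarrow> sep U S"
    and sep_mono: "sep S U \<Longrightarrow> S' \<subseteq> S \<Longrightarrow> U' \<subseteq> U \<Longrightarrow> sep S' U'"
    and sep_Un: "sep S U \<Longrightarrow> sep S' U \<Longrightarrow> sep (S \<union> S') U"
    and sep_empty: "sep {} U"
    and sep_disjoint: "S \<subseteq> \<Omega> \<Longrightarrow> U \<subseteq> \<Omega> \<Longrightarrow> sep S U \<Longrightarrow> S \<inter> U = {}"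
    and sep_image: "S \<subseteq> \<Omega> \<Longrightarrow> U \<subseteq> \<Omega> \<Longrightarrow> sep (F ` S) (F ` U) \<longleftrightarrow> sep S U"
    and sep_I: "i \<in> D \<Longrightarrow> j \<in> D \<Longrightarrow> i \<noteq> j \<Longrightarrow> sep (I i) (I j)"
begin

lemma I_subset: "i \<in> D \<Longrightarrow> I i \<subseteq> \<Omega>"
  using union_I by blast

lemma iter_maps: "S \<subseteq> \<Omega> \<Longrightarrow> (F ^^ n) ` S \<subseteq> \<Omega>"
proof (induction n)
  case (Suc n)
  then have "(F ^^ Suc n) ` S = F ` (F ^^ n) ` S" by (simp add: image_comp)
  then show ?case using Suc maps by (metis image_mono order_trans)
qed simp

lemma sep_image_iter: "S \<subseteq> \<Omega> \<Longrightarrow> U \<subseteq> \<Omega> \<Longrightarrow> sep ((F ^^ n) ` S) ((F ^^ n) ` U) \<longleftrightarrow> sep S U"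
proof (induction n)
  case (Suc n)
  then show ?case using sep_image[of "(F ^^ n) ` S" "(F ^^ n) ` U"] iter_maps
    by (simp add: image_comp)
qed simp

lemma sep_UN: "finite X \<Longrightarrow> (\<And>i. i \<in> X \<Longrightarrow> sep (S i) U) \<Longrightarrow> sep (\<Union>i\<in>X. S i) U"
  by (induction X rule: finite_induct) (auto intro: sep_empty sep_Un)

lemma sep_UN_UN:
  assumes "finite X" "finite Y" "\<And>i j. i \<in> X \<Longrightarrow> j \<in> Y \<Longrightarrow> sep (S i) (U j)"
  shows "sep (\<Union>i\<in>X. S i) (\<Union>j\<in>Y. U j)"
  using assms by (intro sep_UN sep_sym[OF sep_UN]) (auto intro: sep_sym)

lemma I_disjoint: "i \<in> D \<Longrightarrow> j \<in> D \<Longrightarrow> i \<noteq> j \<Longrightarrow> I i \<inter> I j = {}"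
  by (rule sep_disjoint[OF I_subset I_subset sep_I])

end

text \<open>A Kakutani--Rokhlin partition over the base \<open>A\<close>. The pieces of the base
  carry the same labels \<open>D\<close> as the exchanged sets, so that towers can be stacked on
  each other.\<close>

locale tower = separation +
  fixes A :: "'b set" and J :: "'a \<Rightarrow> 'b set" and q :: "'a \<Rightarrow> nat"
  assumes q_pos: "j \<in> D \<Longrightarrow> 0 < q j"
    and union_J: "(\<Union>j\<in>D. J j) = A"
    and floor_subset: "j \<in> D \<Longrightarrow> l < q j \<Longrightarrow> \<exists>i\<in>D. (F ^^ l) ` J j \<subseteq> I i"
    and top_returns: "j \<in> D \<Longrightarrow> (F ^^ q j) ` J j \<subseteq> A"
    and floors_cover: "\<Omega> \<subseteq> (\<Union>j\<in>D. \<Union>l<q j. (F ^^ l) ` J j)"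
    and floors_sep: "j \<in> D \<Longrightarrow> j' \<in> D \<Longrightarrow> l < q j \<Longrightarrow> l' < q j' \<Longrightarrow> (j, l) \<noteq> (j', l')
        \<Longrightarrow> sep ((F ^^ l) ` J j) ((F ^^ l') ` J j')"
begin

lemma A_subset: "A \<subseteq> \<Omega>"
  unfolding union_J[symmetric]
proof
  fix t assume "t \<in> (\<Union>j\<in>D. J j)"
  then obtain j where j: "j \<in> D" "t \<in> J j" by blast
  from floor_subset[OF j(1) q_pos[OF j(1)]] obtain i where "i \<in> D" "J j \<subseteq> I i" by auto
  then show "t \<in> \<Omega>" using j I_subset by blast
qed

lemma J_subset: "j \<in> D \<Longrightarrow> J j \<subseteq> \<Omega>"
  using A_subset union_J by blast

lemma sep_J: "i \<in> D \<Longrightarrow> j \<in> D \<Longrightarrow> i \<noteq> j \<Longrightarrow> sep (J i) (J j)"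
  using floors_sep[of i j 0 0] q_pos by auto

lemma J_disjoint: "i \<in> D \<Longrightarrow> j \<in> D \<Longrightarrow> i \<noteq> j \<Longrightarrow> J i \<inter> J j = {}"
  by (rule sep_disjoint[OF J_subset J_subset sep_J])

lemma floors_disjoint:
  assumes "j \<in> D" "j' \<in> D" "l < q j" "l' < q j'" "(j, l) \<noteq> (j', l')"
  shows "(F ^^ l) ` J j \<inter> (F ^^ l') ` J j' = {}"
  by (rule sep_disjoint[OF _ _ floors_sep[OF assms]]) (intro iter_maps J_subset assms)+

lemma return_time_eq:
  assumes j: "j \<in> D" and t: "t \<in> J j"
  shows "return_time F A t = q j"
  unfolding return_time_def
proof (rule Least_equality)
  show "1 \<le> q j \<and> (F ^^ q j) t \<in> A" using q_pos[OF j] top_returns[OF j] t by (auto simp: Suc_le_eq)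
next
  fix n assume n: "1 \<le> n \<and> (F ^^ n) t \<in> A"
  show "q j \<le> n"
  proof (rule ccontr)
    assume "\<not> q j \<le> n"
    then have nq: "n < q j" by simp
    from n obtain j' where j': "j' \<in> D" "(F ^^ n) t \<in> J j'" using union_J by blast
    then show False using floors_disjoint[OF j j'(1) nq q_pos[OF j'(1)]] n t by fastforce
  qed
qed

lemma first_return_eq: "j \<in> D \<Longrightarrow> t \<in> J j \<Longrightarrow> first_return F A t = (F ^^ q j) t"
  by (simp add: first_return_def return_time_eq)

text \<open>This makes the construction iterable: the relation serves the return map as well. Within
  one piece \<open>R\<close> is an iterate of the map. Two different pieces are apart as bottom
  floors, and their returns are apart as images of two different top floors.\<close>

lemma induced_separation:
  assumes R: "\<And>j t. j \<in> D \<Longrightarrow> t \<in> J j \<Longrightarrow> R t = (F ^^ q j) t"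
  shows "separation D sep R A J"
proof
  show "R ` A \<subseteq> A"
  proof
    fix s assume "s \<in> R ` A"
    then obtain j t where jt: "j \<in> D" "t \<in> J j" "s = R t" using union_J by blast
    then have "s = (F ^^ q j) t" using R by simp
    then show "s \<in> A" using jt top_returns[OF jt(1)] by blast
  qed
  fix S U assume SU: "S \<subseteq> A" "U \<subseteq> A"
  show "S \<inter> U = {}" if "sep S U" using sep_disjoint[OF _ _ that] SU A_subset by (meson order_trans)
  have img: "R ` (X \<inter> J i) = (F ^^ q i) ` (X \<inter> J i)" if "i \<in> D" for X i
    using R that by (auto simp: image_def)
  have dec: "X = (\<Union>i\<in>D. X \<inter> J i)" if "X \<subseteq> A" for X using that union_J by blast
  have same: "sep (R ` (S \<inter> J i)) (R ` (U \<inter> J i)) \<longleftrightarrow> sep (S \<inter> J i) (U \<inter> J i)" if "i \<in> D" for i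
    unfolding img[OF that] using that J_subset by (intro sep_image_iter) blast+
  have diff: "sep (R ` J i) (R ` J j)" if ij: "i \<in> D" "j \<in> D" "i \<noteq> j" for i j
  proof -
    have top: "R ` J k = F ` (F ^^ (q k - 1)) ` J k" if "k \<in> D" for k
    proof -
      have "q k = Suc (q k - 1)" using q_pos[OF that] by simp
      then have "F ^^ q k = F \<circ> (F ^^ (q k - 1))" by (metis funpow.simps(2))
      then show ?thesis using img[OF that, of UNIV] by (simp add: image_comp)
    qed
    have "sep ((F ^^ (q i - 1)) ` J i) ((F ^^ (q j - 1)) ` J j)"
      using ij q_pos by (intro floors_sep) auto
    then show ?thesis unfolding top[OF ij(1)] top[OF ij(2)]
      using sep_image[OF iter_maps[OF J_subset[OF ij(1)]] iter_maps[OF J_subset[OF ij(2)]]] by simp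
  qed
  show "sep (R ` S) (R ` U) \<longleftrightarrow> sep S U"
  proof
    assume *: "sep (R ` S) (R ` U)"
    have "sep (\<Union>i\<in>D. S \<inter> J i) (\<Union>j\<in>D. U \<inter> J j)"
    proof (rule sep_UN_UN[OF finite_D finite_D])
      fix i j assume ij: "i \<in> D" "j \<in> D"
      show "sep (S \<inter> J i) (U \<inter> J j)"
      proof (cases "i = j")
        case True
        have "sep (R ` (S \<inter> J i)) (R ` (U \<inter> J i))" by (rule sep_mono[OF *]) auto
        then show ?thesis using same[OF ij(1)] True by simp
      next
        case False
        show ?thesis by (rule sep_mono[OF sep_J[OF ij False]]) auto
      qed
    qed
    then show "sep S U" by (simp only: dec[OF SU(1), symmetric] dec[OF SU(2), symmetric])
  next
    assume *: "sep S U"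
    have "sep (\<Union>i\<in>D. R ` (S \<inter> J i)) (\<Union>j\<in>D. R ` (U \<inter> J j))"
    proof (rule sep_UN_UN[OF finite_D finite_D])
      fix i j assume ij: "i \<in> D" "j \<in> D"
      show "sep (R ` (S \<inter> J i)) (R ` (U \<inter> J j))"
      proof (cases "i = j")
        case True
        have "sep (S \<inter> J i) (U \<inter> J i)" by (rule sep_mono[OF *]) auto
        then show ?thesis using same[OF ij(1)] True by simp
      next
        case False
        have "R ` (S \<inter> J i) \<subseteq> R ` J i" "R ` (U \<inter> J j) \<subseteq> R ` J j" by auto
        then show ?thesis using sep_mono[OF diff[OF ij False]] by blast
      qed
    qed
    then have "sep (R ` (\<Union>i\<in>D. S \<inter> J i)) (R ` (\<Union>j\<in>D. U \<inter> J j))" by (simp only: image_UN)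
    then show "sep (R ` S) (R ` U)" by (simp only: dec[OF SU(1), symmetric] dec[OF SU(2), symmetric])
  qed
qed (fact finite_D union_J sep_empty | (rule sep_sym, assumption) | (rule sep_Un, assumption+)
      | (rule sep_mono, assumption+) | (rule sep_J, assumption+))+

end

lemma sum_index_decomp:
  fixes f :: "nat \<Rightarrow> nat"
  shows "l < (\<Sum>i<n. f i) \<Longrightarrow> \<exists>m<n. \<exists>l0<f m. l = (\<Sum>i<m. f i) + l0"
proof (induction n)
  case (Suc n)
  show ?case
  proof (cases "l < (\<Sum>i<n. f i)")
    case True
    then obtain m l0 where "m < n" "l0 < f m" "l = (\<Sum>i<m. f i) + l0" using Suc.IH by auto
    then show ?thesis by (intro exI[of _ m] conjI exI[of _ l0]) auto
  next
    case False
    then show ?thesis using Suc.prems by (intro exI[of _ n] conjI exI[of _ "l - (\<Sum>i<n. f i)"]) auto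
  qed
qed simp

lemma sum_index_less:
  fixes f :: "nat \<Rightarrow> nat"
  assumes "m < n" "l0 < f m"
  shows "(\<Sum>i<m. f i) + l0 < (\<Sum>i<n. f i)"
proof -
  have "(\<Sum>i<m. f i) + l0 < (\<Sum>i<Suc m. f i)" using assms by simp
  also have "\<dots> \<le> (\<Sum>i<n. f i)" using assms by (intro sum_mono2) auto
  finally show ?thesis .
qed

lemma funpow_compose_iter:
  assumes R: "\<And>i t. i \<in> D \<Longrightarrow> t \<in> J i \<Longrightarrow> R t = (F ^^ q i) t"
    and a: "\<And>l. l < n \<Longrightarrow> a l \<in> D \<and> (R ^^ l) t \<in> J (a l)"
  shows "m \<le> n \<Longrightarrow> (R ^^ m) t = (F ^^ (\<Sum>l<m. q (a l))) t"
proof (induction m)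
  case (Suc m)
  have "(R ^^ Suc m) t = (F ^^ q (a m)) ((R ^^ m) t)" using R a[of m] Suc.prems by simp
  also have "\<dots> = (F ^^ (q (a m) + (\<Sum>l<m. q (a l)))) t" using Suc by (simp add: funpow_add)
  finally show ?case by (simp add: add.commute)
qed simp

text \<open>\<open>a j l\<close> is the piece of the first base visited by \<open>J' j\<close> at
  time \<open>l\<close>. The new column over \<open>J' j\<close> is therefore a stack of old
  columns, its height is the sum of theirs, and each level is a partial sum plus a position inside
  the next old column.\<close>

lemma tower_compose:
  assumes T: "tower D sep F \<Omega> I A J q"
    and R: "\<And>j t. j \<in> D \<Longrightarrow> t \<in> J j \<Longrightarrow> R t = (F ^^ q j) t"
    and T': "tower D sep R A J A' J' q'"
    and a: "\<And>j l. j \<in> D \<Longrightarrow> l < q' j \<Longrightarrow> a j l \<in> D \<and> (R ^^ l) ` J' j \<subseteq> J (a j l)"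
  shows "tower D sep F \<Omega> I A' J' (\<lambda>j. \<Sum>l<q' j. q (a j l))"
proof -
  interpret T: tower D sep F \<Omega> I A J q by fact
  interpret T': tower D sep R A J A' J' q' by fact
  define Q where "Q j m = (\<Sum>l<m. q (a j l))" for j m
  have iter: "(R ^^ m) t = (F ^^ Q j m) t" if "j \<in> D" "t \<in> J' j" "m \<le> q' j" for j m t
    unfolding Q_def using that a
    by (intro funpow_compose_iter[where D = D and J = J and n = "q' j"] R) blast+
  have floor: "(F ^^ (Q j m + l0)) ` J' j = (F ^^ l0) ` (R ^^ m) ` J' j" if "j \<in> D" "m \<le> q' j" for j m l0
  proof -
    have "(F ^^ (l0 + Q j m)) t = (F ^^ l0) ((R ^^ m) t)" if "t \<in> J' j" for t
      using iter that \<open>j \<in> D\<close> \<open>m \<le> q' j\<close> by (simp add: funpow_add)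
    then show ?thesis by (auto simp: image_def add.commute)
  qed
  have decomp: "\<exists>m l0. m < q' j \<and> l0 < q (a j m) \<and> l = Q j m + l0" if "l < Q j (q' j)" for j l
    using sum_index_decomp[of l "\<lambda>l. q (a j l)"] that unfolding Q_def by blast
  have "tower D sep F \<Omega> I A' J' (\<lambda>j. Q j (q' j))"
  proof
    fix j assume j: "j \<in> D"
    have "0 < q (a j 0)" using T.q_pos a[OF j T'.q_pos[OF j]] by blast
    then show "0 < Q j (q' j)"
      using sum_index_less[of 0 "q' j" 0 "\<lambda>l. q (a j l)"] T'.q_pos[OF j] by (simp add: Q_def)
    show "(F ^^ Q j (q' j)) ` J' j \<subseteq> A'"
      using floor[OF j, of "q' j" 0] T'.top_returns[OF j] by simp
    fix l assume l: "l < Q j (q' j)"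
    then obtain m l0 where m: "m < q' j" "l0 < q (a j m)" "l = Q j m + l0" using decomp by blast
    have "(F ^^ l) ` J' j \<subseteq> (F ^^ l0) ` J (a j m)"
      using m floor[OF j, of m l0] a[OF j m(1)] by (simp add: image_mono)
    then show "\<exists>i\<in>D. (F ^^ l) ` J' j \<subseteq> I i"
      using T.floor_subset[of "a j m" l0] m a[OF j m(1)] by (meson order_trans)
  next
    show "(\<Union>j\<in>D. J' j) = A'" by (rule T'.union_J)
    show "\<Omega> \<subseteq> (\<Union>j\<in>D. \<Union>l<Q j (q' j). (F ^^ l) ` J' j)"
    proof
      fix t assume "t \<in> \<Omega>"
      then obtain i l0 s where i: "i \<in> D" "l0 < q i" "s \<in> J i" "t = (F ^^ l0) s"
        using T.floors_cover by blast
      then have "s \<in> A" using T.union_J by blast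
      then obtain j m u where j: "j \<in> D" "m < q' j" "u \<in> J' j" "s = (R ^^ m) u"
        using T'.floors_cover by blast
      then have "s \<in> J (a j m)" using a by blast
      then have "a j m = i" using T.J_disjoint a[OF j(1,2)] i by blast
      then have "Q j m + l0 < Q j (q' j)"
        using sum_index_less[of m "q' j" l0 "\<lambda>l. q (a j l)"] j i by (simp add: Q_def)
      moreover have "t \<in> (F ^^ (Q j m + l0)) ` J' j" using floor[OF j(1), of m l0] j i by auto
      ultimately show "t \<in> (\<Union>j\<in>D. \<Union>l<Q j (q' j). (F ^^ l) ` J' j)" using j(1) by blast
    qed
    fix j j' l l' assume jl: "j \<in> D" "j' \<in> D" "l < Q j (q' j)" "l' < Q j' (q' j')" "(j, l) \<noteq> (j', l')"
    obtain m l0 where m: "m < q' j" "l0 < q (a j m)" "l = Q j m + l0" using decomp jl by blast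
    obtain m' l0' where m': "m' < q' j'" "l0' < q (a j' m')" "l' = Q j' m' + l0'" using decomp jl by blast
    note aj = a[OF jl(1) m(1)] and aj' = a[OF jl(2) m'(1)]
    have eq: "(F ^^ l) ` J' j = (F ^^ l0) ` (R ^^ m) ` J' j" "(F ^^ l') ` J' j' = (F ^^ l0') ` (R ^^ m') ` J' j'"
      using floor m m' jl by auto
    \<comment> \<open>Two floors inside the same old floor are told apart by the second tower at the
      base of that column; all other pairs are already told apart by the first tower.\<close>
    show "sep ((F ^^ l) ` J' j) ((F ^^ l') ` J' j')"
    proof (cases "(a j m, l0) = (a j' m', l0')")
      case True
      then have "(j, m) \<noteq> (j', m')" using jl m m' by auto
      then have "sep ((R ^^ m) ` J' j) ((R ^^ m') ` J' j')" using T'.floors_sep jl m m' by blast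
      moreover have "(R ^^ m) ` J' j \<subseteq> \<Omega>" "(R ^^ m') ` J' j' \<subseteq> \<Omega>"
        using aj aj' T.J_subset by blast+
      moreover have "l0' = l0" using True by simp
      ultimately show ?thesis unfolding eq by (simp only: T.sep_image_iter)
    next
      case False
      then have "sep ((F ^^ l0) ` J (a j m)) ((F ^^ l0') ` J (a j' m'))"
        using T.floors_sep aj aj' m m' by blast
      then show ?thesis unfolding eq
        by (rule T.sep_mono) (intro image_mono; use aj aj' in blast)+
    qed
  qed
  then show ?thesis by (simp add: Q_def)
qed

section \<open>Birkhoff sums and composition of induced maps\<close>

definition birkhoff :: "('a \<Rightarrow> 'g::comm_monoid_add) \<Rightarrow> ('a \<Rightarrow> 'a) \<Rightarrow> nat \<Rightarrow> 'a \<Rightarrow> 'g" where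
  "birkhoff f F n t = (\<Sum>l<n. f ((F ^^ l) t))"

lemma birkhoff_add: "birkhoff f F (m + n) t = birkhoff f F m t + birkhoff f F n ((F ^^ m) t)"
proof -
  have "(F ^^ (m + l)) t = (F ^^ l) ((F ^^ m) t)" for l
    by (metis add.commute comp_apply funpow_add)
  then show ?thesis by (induction n) (simp_all add: birkhoff_def add.assoc)
qed

text \<open>The quantifier over all \<open>sep\<close> lets one combinatorial argument serve [0,1),
  the compactification and their rescalings, with the same return times \<open>q\<close> in
  each.\<close>

definition induced :: "'i set \<Rightarrow> ('a \<Rightarrow> 'a) \<Rightarrow> 'a set \<Rightarrow> ('i \<Rightarrow> 'a set) \<Rightarrow> 'a set \<Rightarrow> ('i \<Rightarrow> 'a set)
    \<Rightarrow> ('i \<Rightarrow> nat) \<Rightarrow> ('a \<Rightarrow> 'a) \<Rightarrow> bool" where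
  "induced D F \<Omega> I A J q R \<longleftrightarrow>
     (\<forall>sep. separation D sep F \<Omega> I \<longrightarrow> tower D sep F \<Omega> I A J q) \<and>
     (\<forall>j\<in>D. \<forall>t\<in>J j. R t = (F ^^ q j) t)"

lemma inducedD:
  assumes "induced D F \<Omega> I A J q R"
  shows "separation D sep F \<Omega> I \<Longrightarrow> tower D sep F \<Omega> I A J q"
    and "j \<in> D \<Longrightarrow> t \<in> J j \<Longrightarrow> R t = (F ^^ q j) t"
  using assms by (auto simp: induced_def)

lemma separation_induced:
  assumes "separation D sep F \<Omega> I" "induced D F \<Omega> I A J q R"
  shows "separation D sep R A J"
proof -
  interpret tower D sep F \<Omega> I A J q using assms by (intro inducedD)
  show ?thesis by (rule induced_separation) (rule inducedD[OF assms(2)])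
qed

text \<open>The itineraries \<open>a\<close> are read off from the tower for the one relation
  \<open>sep0\<close>; the same \<open>a\<close> then works for every other relation, so
  \<open>q''\<close> does not depend on the relation. The second conclusion regroups a Birkhoff sum
  along a long column into the sums \<open>g\<close> along the short columns it consists of.\<close>

lemma induced_compose:
  fixes F :: "'a \<Rightarrow> 'a"
  assumes ex: "separation D sep0 F \<Omega> I"
    and 1: "induced D F \<Omega> I A J q R" and 2: "induced D R A J A' J' q' R'"
  obtains q'' where "induced D F \<Omega> I A' J' q'' R'"
    and "\<And>(f :: 'a \<Rightarrow> 'g::comm_monoid_add) g j t. \<lbrakk>\<And>i s. i \<in> D \<Longrightarrow> s \<in> J i \<Longrightarrow> birkhoff f F (q i) s = g s; j \<in> D; t \<in> J' j\<rbrakk>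
       \<Longrightarrow> birkhoff f F (q'' j) t = birkhoff g R (q' j) t"
proof -
  interpret T': tower D sep0 R A J A' J' q'
    using inducedD(1)[OF 2] separation_induced[OF ex 1] .
  have "\<exists>i\<in>D. (R ^^ l) ` J' j \<subseteq> J i" if "j \<in> D" "l < q' j" for j l
    using T'.floor_subset that .
  then obtain a where a: "\<And>j l. j \<in> D \<Longrightarrow> l < q' j \<Longrightarrow> a j l \<in> D \<and> (R ^^ l) ` J' j \<subseteq> J (a j l)" by metis
  note iter = funpow_compose_iter[where D = D and J = J and R = R and F = F and q = q, OF inducedD(2)[OF 1]]
  show thesis
  proof (rule that)
    show "induced D F \<Omega> I A' J' (\<lambda>j. \<Sum>l<q' j. q (a j l)) R'"
      unfolding induced_def
    proof (intro conjI allI ballI impI)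
      fix sep assume s: "separation D sep F \<Omega> I"
      show "tower D sep F \<Omega> I A' J' (\<lambda>j. \<Sum>l<q' j. q (a j l))"
        by (rule tower_compose[OF inducedD(1)[OF 1 s] inducedD(2)[OF 1]
              inducedD(1)[OF 2 separation_induced[OF s 1]] a])
    next
      fix j t assume jt: "j \<in> D" "t \<in> J' j"
      have "R' t = (R ^^ q' j) t" using inducedD(2)[OF 2] jt .
      also have "\<dots> = (F ^^ (\<Sum>l<q' j. q (a j l))) t"
        using a jt by (intro iter[where n = "q' j"]) blast+
      finally show "R' t = (F ^^ (\<Sum>l<q' j. q (a j l))) t" .
    qed
    fix f :: "'a \<Rightarrow> 'g" and g j t
    assume g: "\<And>i s. i \<in> D \<Longrightarrow> s \<in> J i \<Longrightarrow> birkhoff f F (q i) s = g s" and jt: "j \<in> D" "t \<in> J' j"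
    have "birkhoff f F (\<Sum>l<m. q (a j l)) t = birkhoff g R m t" if "m \<le> q' j" for m
      using that
    proof (induction m)
      case 0
      then show ?case by (simp add: birkhoff_def)
    next
      case (Suc m)
      have "(R ^^ m) t = (F ^^ (\<Sum>l<m. q (a j l))) t"
        using a jt Suc.prems by (intro iter[where n = "q' j"]) auto
      moreover have "birkhoff f F (q (a j m)) ((R ^^ m) t) = g ((R ^^ m) t)"
        using a[of j m] jt Suc.prems by (intro g) auto
      ultimately show ?case using Suc by (simp add: birkhoff_add) (simp add: birkhoff_def)
    qed
    then show "birkhoff f F (\<Sum>l<q' j. q (a j l)) t = birkhoff g R (q' j) t" by blast
  qed
qed


section \<open>Rauzy--Veech induction\<close>

text \<open>By \<open>bk\<close> a point that has left \<open>A'\<close> comes back at the next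
  step, so every excursion from \<open>A'\<close> lasts one step.\<close>

lemma
  assumes bij: "bij_betw R A A" and sub: "A' \<subseteq> A" and bk: "R ` (A - A') \<subseteq> A'"
  shows first_return_two_step: "t \<in> A' \<Longrightarrow> first_return R A' t = (if R t \<in> A' then R t else R (R t))"
    and bij_first_return_two_step: "bij_betw (first_return R A') A' A'"
proof -
  have RA: "R t \<in> A" if "t \<in> A" for t using bij that by (auto simp: bij_betw_def)
  have inj: "inj_on R A" using bij by (simp add: bij_betw_def)
  have RR: "R (R t) \<in> A'" if "t \<in> A'" "R t \<notin> A'" for t using that bk sub RA by blast
  show eq: "first_return R A' t = (if R t \<in> A' then R t else R (R t))" if "t \<in> A'" for t
  proof (cases "R t \<in> A'")
    case True
    then have "return_time R A' t = 1" unfolding return_time_def by (intro Least_equality) auto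
    then show ?thesis using True by (simp add: first_return_def)
  next
    case False
    have "return_time R A' t = 2" unfolding return_time_def
    proof (rule Least_equality)
      show "1 \<le> (2::nat) \<and> (R ^^ 2) t \<in> A'" using RR that False by (simp add: numeral_2_eq_2)
      fix n assume "1 \<le> n \<and> (R ^^ n) t \<in> A'"
      then show "2 \<le> n" using False by (cases "n = 1") auto
    qed
    then show ?thesis using False by (simp add: first_return_def numeral_2_eq_2)
  qed
  show "bij_betw (first_return R A') A' A'" unfolding bij_betw_def
  proof
    show "inj_on (first_return R A') A'"
    proof (rule inj_onI)
      fix s t assume st: "s \<in> A'" "t \<in> A'" "first_return R A' s = first_return R A' t"
      have *: "R u = R v \<longleftrightarrow> u = v" if "u \<in> A" "v \<in> A" for u v using inj that by (auto dest: inj_onD)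
      show "s = t" using st sub RA by (auto simp: eq * subset_iff split: if_splits)
    qed
    show "first_return R A' ` A' = A'"
    proof
      show "first_return R A' ` A' \<subseteq> A'" using eq RR by auto
      show "A' \<subseteq> first_return R A' ` A'"
      proof
        fix y assume y: "y \<in> A'"
        then obtain t where t: "t \<in> A" "y = R t" using bij sub by (auto simp: bij_betw_def)
        show "y \<in> first_return R A' ` A'"
        proof (cases "t \<in> A'")
          case True
          then show ?thesis using t y eq[of t] by force
        next
          case False
          obtain u where u: "u \<in> A" "t = R u" using t(1) bij by (auto simp: bij_betw_def)
          then have "u \<in> A'" using bk False by blast
          then show ?thesis using u t False eq[of u] by force
        qed
      qed
    qed
  qed
qed

text \<open>The shape of a single induction step. In both of its cases \<open>g\<close> is the label
  of the shorter of the two competing intervals, the only one whose points leave the new base before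
  returning.\<close>

lemma (in separation) tower_one_two:
  assumes g: "g \<in> D" and union: "(\<Union>j\<in>D. J j) = A"
    and sub: "\<And>j. j \<in> D \<Longrightarrow> \<exists>i\<in>D. J j \<subseteq> I i" "\<exists>i\<in>D. F ` J g \<subseteq> I i"
    and ret: "\<And>j. j \<in> D \<Longrightarrow> j \<noteq> g \<Longrightarrow> F ` J j \<subseteq> A" "F ` F ` J g \<subseteq> A"
    and cov: "\<Omega> \<subseteq> A \<union> F ` J g"
    and sJ: "\<And>i j. i \<in> D \<Longrightarrow> j \<in> D \<Longrightarrow> i \<noteq> j \<Longrightarrow> sep (J i) (J j)"
    and sg: "\<And>j. j \<in> D \<Longrightarrow> sep (F ` J g) (J j)"
  shows "tower D sep F \<Omega> I A J (\<lambda>j. if j = g then 2 else 1)"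
proof (unfold_locales)
  show "(\<Union>j\<in>D. J j) = A" by fact
  show "\<Omega> \<subseteq> (\<Union>j\<in>D. \<Union>l<if j = g then 2 else 1. (F ^^ l) ` J j)"
  proof
    fix t assume "t \<in> \<Omega>"
    then consider j where "j \<in> D" "t \<in> J j" | "t \<in> F ` J g" using cov union by blast
    then show "t \<in> (\<Union>j\<in>D. \<Union>l<if j = g then 2 else 1. (F ^^ l) ` J j)"
    proof cases
      case 1
      then show ?thesis by (intro UN_I[of j] UN_I[of 0]) auto
    next
      case 2
      then show ?thesis using g by (intro UN_I[of g] UN_I[of 1]) auto
    qed
  qed
  fix j assume j: "j \<in> D"
  show "0 < (if j = g then 2 else 1 :: nat)" by simp
  show "(F ^^ (if j = g then 2 else 1)) ` J j \<subseteq> A"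
    using ret j by (auto simp: numeral_2_eq_2)
  show "\<exists>i\<in>D. (F ^^ l) ` J j \<subseteq> I i" if "l < (if j = g then 2 else 1 :: nat)" for l
  proof (cases "l = 0")
    case False
    then have "l = 1" "j = g" using that by (auto split: if_splits)
    then show ?thesis using sub(2) by simp
  qed (use sub(1)[OF j] in simp)
  fix j' l l' assume j': "j' \<in> D" and l: "l < (if j = g then 2 else 1 :: nat)" "l' < (if j' = g then 2 else 1 :: nat)"
    and ne: "(j, l) \<noteq> (j', l')"
  have l01: "l = 0 \<or> l = 1 \<and> j = g" "l' = 0 \<or> l' = 1 \<and> j' = g" using l by (auto split: if_splits)
  then show "sep ((F ^^ l) ` J j) ((F ^^ l') ` J j')"
    using sJ[OF j j'] sg[OF j'] sep_sym[OF sg[OF j]] ne by auto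
qed

text \<open>The invariant of the induction. The labelled intervals are not ordered from left to
  right, hence two endpoint functions. The Keane condition is phrased with left endpoints; the value
  0 is exempt because it is the left end of the whole interval and orbits of endpoints may hit
  it.\<close>

locale rv_valid =
  fixes d :: nat and b :: real and J :: "nat \<Rightarrow> real set" and R :: "real \<Rightarrow> real" and e f :: "nat \<Rightarrow> real"
  assumes b_pos: "0 < b"
    and J_eq: "j \<in> {1..d} \<Longrightarrow> J j = {e j..<f j}" and e_less_f: "j \<in> {1..d} \<Longrightarrow> e j < f j"
    and union: "(\<Union>j\<in>{1..d}. J j) = {0..<b}"
    and disj: "i \<in> {1..d} \<Longrightarrow> j \<in> {1..d} \<Longrightarrow> i \<noteq> j \<Longrightarrow> J i \<inter> J j = {}"
    and bij: "bij_betw R {0..<b} {0..<b}"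
    and trans: "j \<in> {1..d} \<Longrightarrow> \<exists>\<tau>. \<forall>t\<in>J j. R t = t + \<tau>"
    and keane: "i \<in> {1..d} \<Longrightarrow> j \<in> {1..d} \<Longrightarrow> 1 \<le> n \<Longrightarrow> (R ^^ n) (e j) = e i \<Longrightarrow> e i = 0"

lemma rightmostD: "rightmost d J j \<Longrightarrow> i \<in> {1..d} \<Longrightarrow> i \<noteq> j \<Longrightarrow> s \<in> J i \<Longrightarrow> t \<in> J j \<Longrightarrow> s < t"
  by (simp add: rightmost_def)

text \<open>Stated for any labelled partition into half-open intervals, since it is applied to the
  exchanged intervals to find \<open>\<alpha>\<close> and to their images to find
  \<open>\<beta>\<close>.\<close>

lemma rightmost_interval:
  fixes e f :: "nat \<Rightarrow> real"
  assumes d: "1 \<le> d" and J: "\<And>j. j \<in> {1..d} \<Longrightarrow> J j = {e j..<f j}" "\<And>j. j \<in> {1..d} \<Longrightarrow> e j < f j"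
    and union: "(\<Union>j\<in>{1..d}. J j) = {0..<b}"
    and disj: "\<And>i j. i \<in> {1..d} \<Longrightarrow> j \<in> {1..d} \<Longrightarrow> i \<noteq> j \<Longrightarrow> J i \<inter> J j = {}"
  obtains j where "j \<in> {1..d}" "(THE j. rightmost d J j) = j" "f j = b"
    "\<And>i. i \<in> {1..d} \<Longrightarrow> i \<noteq> j \<Longrightarrow> f i \<le> e j"
proof -
  have "finite (e ` {1..d})" "e ` {1..d} \<noteq> {}" using d by auto
  then have "Max (e ` {1..d}) \<in> e ` {1..d}" by (rule Max_in)
  then obtain j where j: "j \<in> {1..d}" "e j = Max (e ` {1..d})" by auto
  have max: "e i \<le> e j" if "i \<in> {1..d}" for i using that by (auto simp: j(2) intro: Max_ge)
  have le: "f i \<le> e j" if "i \<in> {1..d}" "i \<noteq> j" for i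
  proof (rule ccontr)
    assume "\<not> f i \<le> e j"
    then have "e j \<in> J i \<inter> J j"
      using max[OF that(1)] J(1)[OF that(1)] J(1)[OF j(1)] J(2)[OF j(1)] by simp
    then show False using disj that j by blast
  qed
  have rm: "rightmost d J j" unfolding rightmost_def
  proof (intro conjI ballI impI j(1))
    fix i s t assume "i \<in> {1..d}" "i \<noteq> j" "s \<in> J i" "t \<in> J j"
    then show "s < t" using le[of i] J(1)[of i] J(1)[OF j(1)] by simp
  qed
  have the: "(THE j. rightmost d J j) = j"
  proof (rule the_equality, rule rm)
    fix i assume i: "rightmost d J i"
    show "i = j"
    proof (rule ccontr)
      assume ne: "i \<noteq> j"
      have "i \<in> {1..d}" using i by (simp add: rightmost_def)
      from this have "e i \<in> J i" "e j \<in> J j" 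
        using J(1)[of i] J(2)[of i] J(1)[OF j(1)] J(2)[OF j(1)] by simp_all
      then have "e i < e j" "e j < e i"
        using rightmostD[OF rm \<open>i \<in> {1..d}\<close> ne] rightmostD[OF i j(1) ne[symmetric]] by blast+
      then show False by simp
    qed
  qed
  have "f j = b"
  proof (rule antisym)
    show "f j \<le> b"
    proof (rule ccontr)
      assume "\<not> f j \<le> b"
      then have "max b (e j) \<in> J j" using J(1)[OF j(1)] J(2)[OF j(1)] by simp
      then have "max b (e j) \<in> {0..<b}" using union j(1) by blast
      then show False by simp
    qed
    show "b \<le> f j"
    proof (rule ccontr)
      assume "\<not> b \<le> f j"
      moreover have "e j \<in> J j" using J(1)[OF j(1)] J(2)[OF j(1)] by simp
      then have "e j \<in> {0..<b}" using union j(1) by blast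
      ultimately have "f j \<in> {0..<b}" using J(2)[OF j(1)] by simp
      then obtain i where i: "i \<in> {1..d}" "f j \<in> J i" using union by blast
      then have "i \<noteq> j" using J(1)[OF j(1)] by auto
      then show False using le[OF i(1)] i J(1)[OF i(1)] J(2)[OF j(1)] by simp
    qed
  qed
  then show thesis using that j(1) the le by blast
qed

lemma image_translation_Ico:
  fixes R :: "real \<Rightarrow> real"
  assumes "\<And>t. t \<in> {a..<b} \<Longrightarrow> R t = t + \<tau>"
  shows "R ` {a..<b} = {a + \<tau>..<b + \<tau>}"
proof -
  have "R ` {a..<b} = (\<lambda>t. t + \<tau>) ` {a..<b}" by (intro image_cong) (auto simp: assms)
  then show ?thesis by simp
qed

lemma first_return_iterates:
  assumes "\<And>t. t \<in> A \<Longrightarrow> R' t \<in> A" "\<And>t. t \<in> A \<Longrightarrow> \<exists>k\<ge>1. R' t = (R ^^ k) t" "t \<in> A"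
  shows "\<exists>m\<ge>n. (R' ^^ n) t = (R ^^ m) t"
proof (induction n)
  case (Suc n)
  then obtain m where m: "m \<ge> n" "(R' ^^ n) t = (R ^^ m) t" by blast
  have "(R' ^^ n) t \<in> A" by (induction n) (use assms in auto)
  then obtain k where k: "k \<ge> 1" "R' ((R' ^^ n) t) = (R ^^ k) ((R' ^^ n) t)" using assms by blast
  then have "(R' ^^ Suc n) t = (R ^^ (k + m)) t" using m by (simp add: funpow_add)
  then show ?case using m k by (intro exI[of _ "k + m"]) auto
qed (intro exI[of _ 0], simp)

text \<open>Besides the usual facts on one step, separation must be re-established across the new
  cut. If the last interval is the longer one, it is cut at the boundary of an image; otherwise the
  other interval is cut at the preimage of a boundary. In either case invariance of the relation
  under \<open>R\<close> applies.\<close>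

lemma (in rv_valid) rv_step_valid:
  assumes d: "2 \<le> d"
  shows "\<exists>b' J' R' e' f' q. rv_step d ({0..<b}, J, R) = ({0..<b'}, J', R') \<and>
     rv_valid d b' J' R' e' f' \<and> b' < b \<and> induced {1..d} R {0..<b} J {0..<b'} J' q R'"
proof -
  let ?D = "{1..d}" and ?A = "{0..<b}"
  obtain \<alpha> where \<alpha>: "\<alpha> \<in> ?D" "(THE j. rightmost d J j) = \<alpha>" "f \<alpha> = b"
    and \<alpha>_le: "\<And>i. i \<in> ?D \<Longrightarrow> i \<noteq> \<alpha> \<Longrightarrow> f i \<le> e \<alpha>"
    by (rule rightmost_interval[OF _ J_eq e_less_f union disj]) (use d in auto)
  obtain \<tau> where \<tau>: "\<And>j t. j \<in> ?D \<Longrightarrow> t \<in> J j \<Longrightarrow> R t = t + \<tau> j" using trans by metis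
  have RJ: "R ` J j = {e j + \<tau> j..<f j + \<tau> j}" if "j \<in> ?D" for j
    using image_translation_Ico[of "e j" "f j" R "\<tau> j"] \<tau>[OF that] J_eq[OF that] by simp
  have RA: "R ` ?A = ?A" and inj: "inj_on R ?A" using bij by (auto simp: bij_betw_def)
  have Rin: "R t \<in> ?A" if "t \<in> ?A" for t using RA that by blast
  have JA: "J j \<subseteq> ?A" if "j \<in> ?D" for j using union that by blast
  have union_RJ: "(\<Union>j\<in>?D. R ` J j) = ?A" using RA union by (metis image_UN)
  have RJA: "R ` J j \<subseteq> ?A" if "j \<in> ?D" for j using image_mono[OF JA[OF that], of R] RA by simp
  have RRJA: "R ` R ` J j \<subseteq> ?A" if "j \<in> ?D" for j using image_mono[OF RJA[OF that], of R] RA by simp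
  have disj_RJ: "R ` J i \<inter> R ` J j = {}" if "i \<in> ?D" "j \<in> ?D" "i \<noteq> j" for i j
    using inj_on_image_Int[OF inj JA JA] disj that by (metis image_empty)
  have d1: "1 \<le> d" using d by simp
  have e_less_f': "e j + \<tau> j < f j + \<tau> j" if "j \<in> ?D" for j using e_less_f[OF that] by simp
  obtain \<beta> where \<beta>: "\<beta> \<in> ?D" "(THE j. rightmost d (\<lambda>i. R ` J i) j) = \<beta>" "f \<beta> + \<tau> \<beta> = b"
    by (rule rightmost_interval[OF d1 RJ e_less_f' union_RJ disj_RJ])
  have e0: "0 \<le> e j" if "j \<in> ?D" for j using JA[OF that] J_eq[OF that] e_less_f[OF that] by auto
  have "\<exists>i\<in>?D. i \<noteq> \<alpha>" using d \<alpha> by (intro bexI[of _ "if \<alpha> = 1 then 2 else 1"]) auto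
  then obtain i0 where i0: "i0 \<in> ?D" "i0 \<noteq> \<alpha>" by blast
  have e\<alpha>: "0 < e \<alpha>" using \<alpha>_le[OF i0] e0[OF i0(1)] e_less_f[OF i0(1)] by simp
  define L\<alpha> L\<beta> where "L\<alpha> = b - e \<alpha>" and "L\<beta> = f \<beta> - e \<beta>"
  have Lpos: "0 < L\<alpha>" "0 < L\<beta>" using e_less_f[OF \<alpha>(1)] e_less_f[OF \<beta>(1)] \<alpha>(3) by (auto simp: L\<alpha>_def L\<beta>_def)
  have meas: "measure lborel (J \<alpha>) = L\<alpha>" "measure lborel (J \<beta>) = L\<beta>"
    using J_eq[OF \<alpha>(1)] J_eq[OF \<beta>(1)] e_less_f[OF \<alpha>(1)] e_less_f[OF \<beta>(1)] \<alpha>(3)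
    by (auto simp: L\<alpha>_def L\<beta>_def)
  have J\<alpha>: "J \<alpha> = {e \<alpha>..<b}" using J_eq[OF \<alpha>(1)] \<alpha>(3) by simp
  have J\<beta>: "J \<beta> = {e \<beta>..<f \<beta>}" using J_eq[OF \<beta>(1)] .
  have "e \<beta> + \<tau> \<beta> = b - L\<beta>" using \<beta>(3) by (simp add: L\<beta>_def)
  then have RJ\<beta>: "R ` J \<beta> = {b - L\<beta>..<b}" using RJ[OF \<beta>(1)] \<beta>(3) by simp
  \<comment> \<open>Equal lengths would mean \<open>R (e \<beta>) = e \<alpha>\<close>, and
    \<open>e \<alpha>\<close> is positive because another interval lies to its left; this is
    excluded by the Keane condition.\<close>
  have Lne: "L\<alpha> \<noteq> L\<beta>"
  proof
    assume "L\<alpha> = L\<beta>"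
    moreover have "R (e \<beta>) = e \<beta> + \<tau> \<beta>" using \<tau>[OF \<beta>(1)] J\<beta> e_less_f[OF \<beta>(1)] by simp
    ultimately have "(R ^^ 1) (e \<beta>) = e \<alpha>" using \<beta>(3) by (simp add: L\<alpha>_def L\<beta>_def)
    then show False using keane[OF \<alpha>(1) \<beta>(1), of 1] e\<alpha> by simp
  qed
  have \<alpha>\<beta>: "\<alpha> \<noteq> \<beta>" using Lne \<alpha>(3) by (auto simp: L\<alpha>_def L\<beta>_def)
  have step: "rv_step d (?A, J, R) = (if L\<alpha> > L\<beta>
      then (?A - R ` J \<beta>, J(\<alpha> := J \<alpha> - R ` J \<beta>), first_return R (?A - R ` J \<beta>))
      else (?A - J \<alpha>, J(\<alpha> := {t \<in> ?A. R t \<in> J \<alpha>}, \<beta> := J \<beta> - {t \<in> ?A. R t \<in> J \<alpha>}), first_return R (?A - J \<alpha>)))"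
    unfolding rv_step_def using \<alpha>(2) \<beta>(2) by (simp add: Let_def meas)
  show ?thesis
  proof (cases "L\<beta> < L\<alpha>")
    case True
    define b' where "b' = b - L\<beta>"
    define J' where "J' = J(\<alpha> := {e \<alpha>..<b'})"
    define R' where "R' = first_return R {0..<b'}"
    have b': "0 < b'" "b' < b" "e \<alpha> < b'" using True Lpos e\<alpha> by (auto simp: b'_def L\<alpha>_def)
    have A': "?A - R ` J \<beta> = {0..<b'}" using b' by (auto simp: RJ\<beta> b'_def)
    have J'\<alpha>: "J \<alpha> - R ` J \<beta> = {e \<alpha>..<b'}" using True Lpos by (auto simp: J\<alpha> RJ\<beta> b'_def L\<alpha>_def)
    have st: "rv_step d (?A, J, R) = ({0..<b'}, J', R')"
      using step True by (simp add: A' J'\<alpha> J'_def R'_def)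
    have RJ\<beta>_sub: "R ` J \<beta> \<subseteq> J \<alpha>" using True by (auto simp: RJ\<beta> J\<alpha> L\<alpha>_def)
    have RRJ\<beta>: "R ` R ` J \<beta> \<inter> R ` J \<beta> = {}"
      using disj_RJ[OF \<alpha>(1) \<beta>(1) \<alpha>\<beta>] image_mono[OF RJ\<beta>_sub, of R] by blast
    have bk: "R ` (?A - {0..<b'}) \<subseteq> {0..<b'}"
    proof -
      have "?A - {0..<b'} = R ` J \<beta>" using A' RJA[OF \<beta>(1)] by blast
      moreover have "R ` R ` J \<beta> \<subseteq> {0..<b'}" using RRJ\<beta> A' RRJA[OF \<beta>(1)] by blast
      ultimately show ?thesis by simp
    qed
    note R'_eq = first_return_two_step[OF bij _ bk, folded R'_def] and R'_bij = bij_first_return_two_step[OF bij _ bk, folded R'_def]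
    have J'sub: "J' j \<subseteq> J j" if "j \<in> ?D" for j using b' by (auto simp: J'_def J\<alpha>)
    have union': "(\<Union>j\<in>?D. J' j) = {0..<b'}"
    proof -
      have "(\<Union>j\<in>?D. J' j) = (\<Union>j\<in>?D. J j) - R ` J \<beta>"
      proof -
        have "J' j = J j - R ` J \<beta>" if "j \<in> ?D" for j
          using that RJ\<beta>_sub disj[OF that \<alpha>(1)] J'\<alpha> by (cases "j = \<alpha>") (auto simp: J'_def)
        then show ?thesis by auto
      qed
      then show ?thesis using union A' by simp
    qed
    have ret1: "R t \<in> {0..<b'}" if "j \<in> ?D" "j \<noteq> \<beta>" "t \<in> J' j" for j t
      using disj_RJ[OF that(1) \<beta>(1) that(2)] J'sub[OF that(1)] RJA[OF that(1)] that(3) A' by blast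
    have ret2: "R t \<notin> {0..<b'}" "R t \<in> J \<alpha>" "R (R t) \<in> {0..<b'}" if "t \<in> J' \<beta>" for t
    proof -
      have R: "R t \<in> R ` J \<beta>" "R (R t) \<in> R ` R ` J \<beta>" using that J'sub[OF \<beta>(1)] by auto
      show "R t \<notin> {0..<b'}" using R(1) A' by blast
      show "R t \<in> J \<alpha>" using R(1) RJ\<beta>_sub by blast
      show "R (R t) \<in> {0..<b'}" using R(2) RRJ\<beta> A' RRJA[OF \<beta>(1)] by blast
    qed
    have A'A: "{0..<b'} \<subseteq> ?A" using b' by simp
    have R'1: "R' t = R t" if "j \<in> ?D" "j \<noteq> \<beta>" "t \<in> J' j" for j t
    proof -
      have "t \<in> {0..<b'}" using that union' by blast
      then show ?thesis using R'_eq[OF A'A] ret1[OF that] by presburger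
    qed
    have R'2: "R' t = R (R t)" if "t \<in> J' \<beta>" for t
    proof -
      have "t \<in> {0..<b'}" using that union' \<beta>(1) by blast
      then show ?thesis using R'_eq[OF A'A] ret2(1)[OF that] by presburger
    qed
    define q where "q j = (if j = \<beta> then 2 else 1 :: nat)" for j
    have valid: "rv_valid d b' J' R' e (f(\<alpha> := b'))"
    proof
      show "0 < b'" by (rule b')
      show "J' j = {e j..<(f(\<alpha> := b')) j}" "e j < (f(\<alpha> := b')) j" if "j \<in> ?D" for j
        using J_eq[OF that] e_less_f[OF that] b' by (auto simp: J'_def)
      show "(\<Union>j\<in>?D. J' j) = {0..<b'}" by (rule union')
      show "J' i \<inter> J' j = {}" if "i \<in> ?D" "j \<in> ?D" "i \<noteq> j" for i j
        using disj[OF that] J'sub that by blast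
      show "bij_betw R' {0..<b'} {0..<b'}" by (rule R'_bij[OF A'A])
      show "\<exists>\<tau>. \<forall>t\<in>J' j. R' t = t + \<tau>" if j: "j \<in> ?D" for j
      proof (cases "j = \<beta>")
        case True
        then have "R' t = t + (\<tau> \<beta> + \<tau> \<alpha>)" if "t \<in> J' \<beta>" for t
          using R'2[OF that] \<tau>[OF \<alpha>(1) ret2(2)[OF that]] \<tau>[OF \<beta>(1)] J'sub[OF \<beta>(1)] that by auto
        then show ?thesis using True by blast
      next
        case False
        then have "R' t = t + \<tau> j" if "t \<in> J' j" for t
          using R'1[OF j False that] \<tau>[OF j] J'sub[OF j] that by auto
        then show ?thesis by blast
      qed
      fix i j n assume ij: "i \<in> ?D" "j \<in> ?D" "1 \<le> n" "(R' ^^ n) (e j) = e i"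
      have "e j \<in> J' j" using J_eq[OF ij(2)] e_less_f[OF ij(2)] b' by (simp add: J'_def)
      then have "e j \<in> {0..<b'}" using union' ij(2) by blast
      moreover have "\<exists>k\<ge>1. R' t = (R ^^ k) t" if "t \<in> {0..<b'}" for t
      proof (cases "R t \<in> {0..<b'}")
        case True
        then show ?thesis using R'_eq[OF A'A that] by (intro exI[of _ 1]) auto
      next
        case False
        then show ?thesis using R'_eq[OF A'A that] by (intro exI[of _ 2]) (auto simp: numeral_2_eq_2)
      qed
      moreover have "R' t \<in> {0..<b'}" if "t \<in> {0..<b'}" for t
        using R'_bij[OF A'A] that by (auto simp: bij_betw_def)
      ultimately obtain m where "m \<ge> n" "(R' ^^ n) (e j) = (R ^^ m) (e j)"
        using first_return_iterates[of "{0..<b'}" R' R "e j" n] by blast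
      then show "e i = 0" using keane[OF ij(1,2), of m] ij by simp
    qed
    have "induced ?D R ?A J {0..<b'} J' q R'"
      unfolding induced_def
    proof (intro conjI allI impI ballI)
      fix sep assume "separation ?D sep R ?A J"
      then interpret separation ?D sep R ?A J .
      \<comment> \<open>What remains of \<open>J \<alpha>\<close> is covered by the images of the
        pieces other than \<open>J \<beta>\<close>, and images of different pieces are
        apart.\<close>
      have s\<alpha>: "sep (R ` J \<beta>) (J' \<alpha>)"
      proof -
        have 1: "sep (\<Union>i\<in>?D - {\<beta>}. R ` J i) (R ` J \<beta>)"
          using sep_I \<beta>(1) I_subset by (intro sep_UN) (auto simp: sep_image)
        have 2: "J' \<alpha> \<subseteq> (\<Union>i\<in>?D - {\<beta>}. R ` J i)"
        proof
          fix t assume "t \<in> J' \<alpha>"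
          then have t: "t \<in> J \<alpha>" "t \<notin> R ` J \<beta>" by (simp_all add: J'_def J'\<alpha>[symmetric])
          then have "t \<in> (\<Union>i\<in>?D. R ` J i)" using union_RJ JA[OF \<alpha>(1)] by auto
          then obtain i where "i \<in> ?D" "t \<in> R ` J i" by blast
          then show "t \<in> (\<Union>i\<in>?D - {\<beta>}. R ` J i)" using t(2) by (cases "i = \<beta>") auto
        qed
        show ?thesis by (rule sep_sym[OF sep_mono[OF 1 2 order_refl]])
      qed
      show "tower ?D sep R ?A J {0..<b'} J' q" unfolding q_def
      proof (rule tower_one_two[OF \<beta>(1) union'])
        show "\<exists>i\<in>?D. J' j \<subseteq> J i" if "j \<in> ?D" for j using J'sub that by blast
        show "\<exists>i\<in>?D. R ` J' \<beta> \<subseteq> J i" using ret2 \<alpha>(1) by blast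
        show "R ` J' j \<subseteq> {0..<b'}" if "j \<in> ?D" "j \<noteq> \<beta>" for j using ret1[OF that] by blast
        show "R ` R ` J' \<beta> \<subseteq> {0..<b'}" using ret2 by blast
        show "?A \<subseteq> {0..<b'} \<union> R ` J' \<beta>" using A' \<alpha>\<beta> by (auto simp: J'_def)
        show "sep (J' i) (J' j)" if "i \<in> ?D" "j \<in> ?D" "i \<noteq> j" for i j
          by (rule sep_mono[OF sep_I[OF that] J'sub[OF that(1)] J'sub[OF that(2)]])
        show "sep (R ` J' \<beta>) (J' j)" if "j \<in> ?D" for j
        proof (cases "j = \<alpha>")
          case True
          then show ?thesis using s\<alpha> \<alpha>\<beta> by (simp add: J'_def)
        next
          case False
          have "R ` J' \<beta> \<subseteq> J \<alpha>" using ret2 by blast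
          then show ?thesis by (rule sep_mono[OF sep_I[OF \<alpha>(1) that False[symmetric]] _ J'sub[OF that]])
        qed
      qed
    next
      fix j t assume "j \<in> ?D" "t \<in> J' j"
      then show "R' t = (R ^^ q j) t" using R'1 R'2 by (auto simp: q_def numeral_2_eq_2)
    qed
    then show ?thesis using st valid b' by blast
  next
    case False
    then have L: "L\<alpha> < L\<beta>" using Lne by simp
    define b' where "b' = e \<alpha>"
    \<comment> \<open>The cut point in \<open>J \<beta>\<close>: the part from \<open>p\<close> on
      is the one that \<open>R\<close> maps onto \<open>J \<alpha>\<close>.\<close>
    define p where "p = f \<beta> - L\<alpha>"
    define J' where "J' = J(\<alpha> := {p..<f \<beta>}, \<beta> := {e \<beta>..<p})"
    define R' where "R' = first_return R {0..<b'}"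
    define e' f' where "e' = e(\<alpha> := p)" and "f' = f(\<alpha> := f \<beta>, \<beta> := p)"
    have b': "0 < b'" "b' < b" using Lpos e\<alpha> by (auto simp: b'_def L\<alpha>_def)
    have p: "e \<beta> < p" "p < f \<beta>" using L Lpos by (auto simp: p_def L\<beta>_def)
    have A': "?A - J \<alpha> = {0..<b'}" using b' by (auto simp: J\<alpha> b'_def)
    have RP: "R ` {p..<f \<beta>} = J \<alpha>"
    proof -
      have "R ` {p..<f \<beta>} = {p + \<tau> \<beta>..<f \<beta> + \<tau> \<beta>}"
        using \<tau>[OF \<beta>(1)] p J\<beta> by (intro image_translation_Ico) auto
      moreover have "p + \<tau> \<beta> = e \<alpha>" using \<beta>(3) by (simp add: p_def L\<alpha>_def)
      ultimately show ?thesis using \<beta>(3) by (simp add: J\<alpha>)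
    qed
    have P: "{t \<in> ?A. R t \<in> J \<alpha>} = {p..<f \<beta>}"
    proof
      show "{p..<f \<beta>} \<subseteq> {t \<in> ?A. R t \<in> J \<alpha>}" using RP JA[OF \<beta>(1)] p J\<beta> by auto
      show "{t \<in> ?A. R t \<in> J \<alpha>} \<subseteq> {p..<f \<beta>}"
      proof
        fix t assume t: "t \<in> {t \<in> ?A. R t \<in> J \<alpha>}"
        then obtain s where s: "s \<in> {p..<f \<beta>}" "R t = R s" using RP by blast
        then have "s \<in> ?A" using JA[OF \<beta>(1)] p J\<beta> by auto
        then show "t \<in> {p..<f \<beta>}" using s t inj by (auto dest: inj_onD)
      qed
    qed
    have J\<beta>P: "J \<beta> - {p..<f \<beta>} = {e \<beta>..<p}" using p by (auto simp: J\<beta>)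
    have st: "rv_step d (?A, J, R) = ({0..<b'}, J', R')"
      using step[unfolded P J\<beta>P A'] False by (simp add: J'_def R'_def)
    have J\<alpha>_sub: "J \<alpha> \<subseteq> R ` J \<beta>" using L by (auto simp: RJ\<beta> J\<alpha> L\<alpha>_def)
    have RJ\<alpha>: "R ` J \<alpha> \<inter> J \<alpha> = {}" using disj_RJ[OF \<alpha>(1) \<beta>(1) \<alpha>\<beta>] J\<alpha>_sub by blast
    have bk: "R ` (?A - {0..<b'}) \<subseteq> {0..<b'}"
    proof -
      have "?A - {0..<b'} = J \<alpha>" using A' JA[OF \<alpha>(1)] by blast
      moreover have "R ` J \<alpha> \<subseteq> {0..<b'}" using RJ\<alpha> A' RJA[OF \<alpha>(1)] by blast
      ultimately show ?thesis by simp
    qed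
    note R'_eq = first_return_two_step[OF bij _ bk, folded R'_def] and R'_bij = bij_first_return_two_step[OF bij _ bk, folded R'_def]
    have J'sub: "J' j \<subseteq> J (if j = \<alpha> then \<beta> else j)" for j
      using p \<alpha>\<beta> by (auto simp: J'_def J\<beta>)
    have J'eq: "J' j = {e' j..<f' j}" "e' j < f' j" if "j \<in> ?D" for j
      using J_eq[OF that] e_less_f[OF that] p \<alpha>\<beta> by (auto simp: J'_def e'_def f'_def)
    have union': "(\<Union>j\<in>?D. J' j) = {0..<b'}"
    proof -
      have "(\<Union>j\<in>?D. J' j) = (\<Union>j\<in>?D - {\<alpha>}. J j)"
      proof
        show "(\<Union>j\<in>?D. J' j) \<subseteq> (\<Union>j\<in>?D - {\<alpha>}. J j)"
        proof (rule UN_least)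
          fix j assume "j \<in> ?D"
          then show "J' j \<subseteq> (\<Union>j\<in>?D - {\<alpha>}. J j)" using J'sub[of j] \<beta>(1) \<alpha>\<beta> by (cases "j = \<alpha>") auto
        qed
        have "J j \<subseteq> J' \<alpha> \<union> J' j" if "j \<noteq> \<alpha>" for j using that \<alpha>\<beta> by (auto simp: J'_def J\<beta>)
        then show "(\<Union>j\<in>?D - {\<alpha>}. J j) \<subseteq> (\<Union>j\<in>?D. J' j)" using \<alpha>(1) by blast
      qed
      also have "\<dots> = ?A - J \<alpha>" using union disj[OF _ \<alpha>(1)] by blast
      finally show ?thesis using A' by simp
    qed
    have ret1: "R t \<in> {0..<b'}" if "j \<in> ?D" "j \<noteq> \<alpha>" "t \<in> J' j" for j t
    proof -
      have t: "t \<in> J j" "t \<in> ?A" using J'sub[of j] that JA[OF that(1)] by auto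
      have "t \<notin> {p..<f \<beta>}" using that disj[OF that(1) \<beta>(1)] J\<beta> p by (cases "j = \<beta>") (auto simp: J'_def)
      then have "R t \<notin> J \<alpha>" using P t by blast
      then show ?thesis using Rin[OF t(2)] A' by blast
    qed
    have J'\<alpha>: "J' \<alpha> = {p..<f \<beta>}" using \<alpha>\<beta> by (simp add: J'_def)
    have ret2: "R t \<notin> {0..<b'}" "R t \<in> J \<alpha>" "R (R t) \<in> {0..<b'}" if "t \<in> J' \<alpha>" for t
    proof -
      show "R t \<in> J \<alpha>" using RP that J'\<alpha> by blast
      then show "R t \<notin> {0..<b'}" "R (R t) \<in> {0..<b'}" using A' RJ\<alpha> RJA[OF \<alpha>(1)] by blast+
    qed
    have A'A: "{0..<b'} \<subseteq> ?A" using b' by simp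
    have R'1: "R' t = R t" if "j \<in> ?D" "j \<noteq> \<alpha>" "t \<in> J' j" for j t
    proof -
      have "t \<in> {0..<b'}" using that union' by blast
      then show ?thesis using R'_eq[OF A'A] ret1[OF that] by presburger
    qed
    have R'2: "R' t = R (R t)" if "t \<in> J' \<alpha>" for t
    proof -
      have "t \<in> {0..<b'}" using that union' \<alpha>(1) by blast
      then show ?thesis using R'_eq[OF A'A] ret2(1)[OF that] by presburger
    qed
    define q where "q j = (if j = \<alpha> then 2 else 1 :: nat)" for j
    have disj': "J' i \<inter> J' j = {}" if "i \<in> ?D" "j \<in> ?D" "i \<noteq> j" for i j
    proof -
      have *: "J' \<alpha> \<inter> J' k = {}" if "k \<in> ?D" "k \<noteq> \<alpha>" for k
        using that disj[OF \<beta>(1) that(1)] J'\<alpha> p J\<beta> by (cases "k = \<beta>") (auto simp: J'_def)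
      show ?thesis
      proof (cases "i = \<alpha> \<or> j = \<alpha>")
        case True
        then show ?thesis using * that by (auto simp: Int_commute)
      next
        case False
        then show ?thesis using disj[OF that] J'sub[of i] J'sub[of j] by auto
      qed
    qed
    have valid: "rv_valid d b' J' R' e' f'"
    proof
      show "0 < b'" by (rule b')
      show "J' j = {e' j..<f' j}" "e' j < f' j" if "j \<in> ?D" for j using J'eq[OF that] by auto
      show "(\<Union>j\<in>?D. J' j) = {0..<b'}" by (rule union')
      show "J' i \<inter> J' j = {}" if "i \<in> ?D" "j \<in> ?D" "i \<noteq> j" for i j by (rule disj'[OF that])
      show "bij_betw R' {0..<b'} {0..<b'}" by (rule R'_bij[OF A'A])
      show "\<exists>\<tau>. \<forall>t\<in>J' j. R' t = t + \<tau>" if j: "j \<in> ?D" for j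
      proof (cases "j = \<alpha>")
        case True
        have "R' t = t + (\<tau> \<beta> + \<tau> \<alpha>)" if "t \<in> J' \<alpha>" for t
          using R'2[OF that] \<tau>[OF \<alpha>(1) ret2(2)[OF that]] \<tau>[OF \<beta>(1)] J'sub[of \<alpha>] that by auto
        then show ?thesis using True by blast
      next
        case False
        then have "R' t = t + \<tau> j" if "t \<in> J' j" for t
          using R'1[OF j False that] \<tau>[OF j] J'sub[of j] that by auto
        then show ?thesis by blast
      qed
      fix i j n assume ij: "i \<in> ?D" "j \<in> ?D" "1 \<le> n" "(R' ^^ n) (e' j) = e' i"
      have in': "e' k \<in> {0..<b'}" if "k \<in> ?D" for k
      proof -
        have "e' k \<in> J' k" using J'eq[OF that] by simp
        then show ?thesis using union' that by blast
      qed
      have R'A: "R' t \<in> {0..<b'}" if "t \<in> {0..<b'}" for t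
        using R'_bij[OF A'A] that by (auto simp: bij_betw_def)
      moreover have "\<exists>k\<ge>1. R' t = (R ^^ k) t" if "t \<in> {0..<b'}" for t
      proof (cases "R t \<in> {0..<b'}")
        case True
        then show ?thesis using R'_eq[OF A'A that] by (intro exI[of _ 1]) auto
      next
        case False
        then show ?thesis using R'_eq[OF A'A that] by (intro exI[of _ 2]) (auto simp: numeral_2_eq_2)
      qed
      ultimately obtain m where m: "m \<ge> n" "(R' ^^ n) (e' j) = (R ^^ m) (e' j)"
        using first_return_iterates[of "{0..<b'}" R' R "e' j" n] in'[OF ij(2)] by blast
      have Rp: "R p = e \<alpha>" using \<tau>[OF \<beta>(1), of p] p J\<beta> \<beta>(3) by (simp add: p_def L\<alpha>_def)
      \<comment> \<open>The only new endpoint is \<open>p\<close>, and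
        \<open>R p = e \<alpha>\<close>. So a connection between new endpoints becomes one between
        old endpoints: a start at \<open>p\<close> is moved one step ahead, and below an arrival at
        \<open>p\<close> is prolonged by one step.\<close>
      have "\<exists>m'\<ge>1. e' i = (R ^^ m') (e j)"
      proof (cases "j = \<alpha>")
        case True
        obtain m' where m': "m = Suc m'" using m ij(3) by (cases m) auto
        have eq: "e' i = (R ^^ m') (e \<alpha>)"
          using m m' ij(4) True Rp by (simp add: e'_def funpow_swap1)
        \<comment> \<open>Moving the start must leave at least one step. Otherwise
          \<open>e' i\<close> would be \<open>e \<alpha>\<close>, which is the right end
          \<open>b'\<close> and lies outside the new interval.\<close>
        have "m' \<noteq> 0"
        proof
          assume "m' = 0"
          then show False using eq in'[OF ij(1)] by (simp add: b'_def)
        qed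
        then show ?thesis using eq True by (intro exI[of _ m']) auto
      next
        case False
        then show ?thesis using m ij by (intro exI[of _ m]) (auto simp: e'_def)
      qed
      then obtain m' where m': "m' \<ge> 1" "e' i = (R ^^ m') (e j)" by blast
      show "e' i = 0"
      proof (cases "i = \<alpha>")
        case True
        then have "(R ^^ Suc m') (e j) = e \<alpha>" using m' Rp by (simp add: e'_def)
        then show ?thesis using keane[OF \<alpha>(1) ij(2), of "Suc m'"] e\<alpha> by simp
      next
        case False
        then show ?thesis using keane[OF ij(1,2) m'(1)] m'(2) by (simp add: e'_def)
      qed
    qed
    have "induced ?D R ?A J {0..<b'} J' q R'"
      unfolding induced_def
    proof (intro conjI allI impI ballI)
      fix sep assume "separation ?D sep R ?A J"
      then interpret separation ?D sep R ?A J .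
      \<comment> \<open>Both parts lie in the same \<open>J \<beta>\<close> and are told apart one
        step later: \<open>R\<close> takes one onto \<open>J \<alpha>\<close> and the other into the
        union of the remaining intervals.\<close>
      have sP: "sep (J' \<alpha>) (J' \<beta>)"
      proof -
        have sub: "J' \<alpha> \<subseteq> ?A" "J' \<beta> \<subseteq> ?A" using J'sub[of \<alpha>] J'sub[of \<beta>] JA[OF \<beta>(1)] \<alpha>\<beta> by auto
        have "R ` J' \<beta> \<subseteq> {0..<b'}" using ret1[OF \<beta>(1)] \<alpha>\<beta> by blast
        moreover have "{0..<b'} \<subseteq> (\<Union>i\<in>?D - {\<alpha>}. J i)" using A' union by blast
        ultimately have 1: "R ` J' \<beta> \<subseteq> (\<Union>i\<in>?D - {\<alpha>}. J i)" by (rule order_trans)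
        have 2: "sep (\<Union>i\<in>?D - {\<alpha>}. J i) (J \<alpha>)" using \<alpha>(1) by (intro sep_UN sep_I) auto
        have "sep (R ` J' \<beta>) (R ` J' \<alpha>)" by (rule sep_mono[OF 2 1]) (simp add: RP J'\<alpha>)
        then show ?thesis using sep_image[OF sub(2,1)] sep_sym[of "J' \<beta>" "J' \<alpha>"] by simp
      qed
      have s\<alpha>: "sep (J' \<alpha>) (J' j)" if "j \<in> ?D" "j \<noteq> \<alpha>" for j
      proof (cases "j = \<beta>")
        case False
        have "J' \<alpha> \<subseteq> J \<beta>" "J' j \<subseteq> J j" using J'sub[of \<alpha>] J'sub[of j] that by auto
        then show ?thesis by (rule sep_mono[OF sep_I[OF \<beta>(1) that(1) False[symmetric]]])
      qed (use sP in simp)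
      show "tower ?D sep R ?A J {0..<b'} J' q" unfolding q_def
      proof (rule tower_one_two[OF \<alpha>(1) union'])
        show "\<exists>i\<in>?D. J' j \<subseteq> J i" if "j \<in> ?D" for j
          using J'sub[of j] that \<beta>(1) by (intro bexI[of _ "if j = \<alpha> then \<beta> else j"]) auto
        show "\<exists>i\<in>?D. R ` J' \<alpha> \<subseteq> J i" using ret2 \<alpha>(1) by blast
        show "R ` J' j \<subseteq> {0..<b'}" if "j \<in> ?D" "j \<noteq> \<alpha>" for j using ret1[OF that] by blast
        show "R ` R ` J' \<alpha> \<subseteq> {0..<b'}" using ret2 by blast
        show "?A \<subseteq> {0..<b'} \<union> R ` J' \<alpha>" using A' RP J'\<alpha> by auto
        show "sep (J' i) (J' j)" if "i \<in> ?D" "j \<in> ?D" "i \<noteq> j" for i j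
        proof (cases "i = \<alpha> \<or> j = \<alpha>")
          case True
          then show ?thesis using s\<alpha>[of i] s\<alpha>[of j] sep_sym[of "J' \<alpha>" "J' i"] that by auto
        next
          case False
          have "J' i \<subseteq> J i" "J' j \<subseteq> J j" using J'sub[of i] J'sub[of j] False by auto
          then show ?thesis by (rule sep_mono[OF sep_I[OF that]])
        qed
        show "sep (R ` J' \<alpha>) (J' j)" if "j \<in> ?D" for j
        proof -
          have 1: "R ` J' \<alpha> \<subseteq> J \<alpha>" using ret2 by blast
          have "sep (J \<alpha>) (J (if j = \<alpha> then \<beta> else j))"
            using sep_I[OF \<alpha>(1)] \<alpha>\<beta> that \<beta>(1) by auto
          then show ?thesis by (rule sep_mono[OF _ 1 J'sub])
        qed
      qed
    next
      fix j t assume "j \<in> ?D" "t \<in> J' j"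
      then show "R' t = (R ^^ q j) t" using R'1 R'2 by (auto simp: q_def numeral_2_eq_2)
    qed
    then show ?thesis using st valid b' by blast
  qed
qed


section \<open>Self-similar towers of periodic type\<close>

lemma separation_disjoint:
  assumes "finite D" "(\<Union>i\<in>D. I i) = \<Omega>" "F ` \<Omega> \<subseteq> \<Omega>" "inj_on F \<Omega>"
    and "\<And>i j. i \<in> D \<Longrightarrow> j \<in> D \<Longrightarrow> i \<noteq> j \<Longrightarrow> I i \<inter> I j = {}"
  shows "separation D (\<lambda>S U. S \<inter> U = {}) F \<Omega> I"
proof
  fix S U assume "S \<subseteq> \<Omega>" "U \<subseteq> \<Omega>"
  then show "F ` S \<inter> F ` U = {} \<longleftrightarrow> S \<inter> U = {}"
    using inj_on_image_Int[OF assms(4), of S U] by auto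
qed (use assms in auto)

lemma separation_conjugate:
  assumes s: "separation D sep F' (h ` \<Omega>) (\<lambda>i. h ` I i)" and h: "inj h" and F': "\<And>t. F' (h t) = h (F t)"
  shows "separation D (\<lambda>S U. sep (h ` S) (h ` U)) F \<Omega> I"
proof -
  interpret separation D sep F' "h ` \<Omega>" "\<lambda>i. h ` I i" by fact
  have img: "F' ` h ` S = h ` F ` S" for S by (auto simp: image_image F')
  show ?thesis
  proof
    show "(\<Union>i\<in>D. I i) = \<Omega>"
      using union_I by (simp add: inj_image_eq_iff[OF h] flip: image_UN)
    show "F ` \<Omega> \<subseteq> \<Omega>" using maps unfolding img by (simp add: inj_image_subset_iff[OF h])
    show "sep (h ` (S \<union> S')) (h ` U)" if "sep (h ` S) (h ` U)" "sep (h ` S') (h ` U)" for S S' U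
      using sep_Un[OF that] by (simp add: image_Un)
    show "sep (h ` S') (h ` U')" if "sep (h ` S) (h ` U)" "S' \<subseteq> S" "U' \<subseteq> U" for S S' U U'
      by (rule sep_mono[OF that(1)]) (use that in auto)
    show "sep (h ` {}) (h ` U)" for U using sep_empty by simp
    fix S U assume SU: "S \<subseteq> \<Omega>" "U \<subseteq> \<Omega>"
    show "sep (h ` F ` S) (h ` F ` U) \<longleftrightarrow> sep (h ` S) (h ` U)"
      using sep_image[of "h ` S" "h ` U"] SU unfolding img by (simp add: image_mono)
    show "S \<inter> U = {}" if "sep (h ` S) (h ` U)"
      using sep_disjoint[OF _ _ that] SU image_Int[OF h, of S U] by (auto simp: image_mono)
  qed (simp_all add: finite_D sep_I sep_sym)
qed

lemma induced_conjugate: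
  assumes ind: "induced D F \<Omega> I A J q R" and h: "inj h"
    and F': "\<And>t. F' (h t) = h (F t)" and R': "\<And>t. R' (h t) = h (R t)"
  shows "induced D F' (h ` \<Omega>) (\<lambda>i. h ` I i) (h ` A) (\<lambda>i. h ` J i) q R'"
proof -
  have iter: "(F' ^^ n) (h t) = h ((F ^^ n) t)" for n t by (induction n) (simp_all add: F')
  have img: "(F' ^^ n) ` h ` S = h ` (F ^^ n) ` S" for n S by (auto simp: image_image iter)
  show ?thesis unfolding induced_def
  proof (intro conjI allI impI ballI)
    fix sep assume s: "separation D sep F' (h ` \<Omega>) (\<lambda>i. h ` I i)"
    interpret separation D sep F' "h ` \<Omega>" "\<lambda>i. h ` I i" by fact
    interpret T: tower D "\<lambda>S U. sep (h ` S) (h ` U)" F \<Omega> I A J q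
      by (rule inducedD(1)[OF ind separation_conjugate[OF s h F']])
    show "tower D sep F' (h ` \<Omega>) (\<lambda>i. h ` I i) (h ` A) (\<lambda>i. h ` J i) q"
    proof (unfold_locales, unfold img)
      show "(\<Union>j\<in>D. h ` J j) = h ` A" using T.union_J by (simp flip: image_UN)
      show "h ` \<Omega> \<subseteq> (\<Union>j\<in>D. \<Union>l<q j. h ` (F ^^ l) ` J j)"
        using image_mono[OF T.floors_cover, of h] by (simp add: image_UN)
      fix j assume j: "j \<in> D"
      show "0 < q j" by (rule T.q_pos[OF j])
      show "h ` (F ^^ q j) ` J j \<subseteq> h ` A" by (rule image_mono[OF T.top_returns[OF j]])
      show "\<exists>i\<in>D. h ` (F ^^ l) ` J j \<subseteq> h ` I i" if "l < q j" for l
        using T.floor_subset[OF j that] by (meson image_mono)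
    qed (rule T.floors_sep)
  next
    fix j t assume j: "j \<in> D" "t \<in> h ` J j"
    then obtain s where "s \<in> J j" "t = h s" by blast
    then show "R' t = (F' ^^ q j) t" using inducedD(2)[OF ind j(1)] by (simp add: R' iter)
  qed
qed

text \<open>All that the later arguments retain of periodic type. Neither the induction nor the
  length of the period occurs, so that powers of the period are covered by the same notion.\<close>

definition selfsim :: "'i set \<Rightarrow> (real \<Rightarrow> real) \<Rightarrow> real set \<Rightarrow> ('i \<Rightarrow> real set) \<Rightarrow> (real \<Rightarrow> 'g::comm_monoid_add)
    \<Rightarrow> real \<Rightarrow> ('i \<Rightarrow> nat) \<Rightarrow> bool" where
  "selfsim D F \<Omega> I f c q \<longleftrightarrow> 0 < c \<and> c < 1 \<and>
     induced D F \<Omega> I ((*) c ` \<Omega>) (\<lambda>j. (*) c ` I j) q (\<lambda>t. c * F (t / c)) \<and>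
     (\<forall>j\<in>D. \<forall>t\<in>I j. birkhoff f F (q j) (c * t) = f t)"

text \<open>The second tower, rescaled by \<open>c\<close>, is a tower for the return map of the
  first one; stacking them multiplies the ratios.\<close>

lemma selfsim_compose:
  assumes ex: "separation D sep0 F \<Omega> I" and 1: "selfsim D F \<Omega> I f c q" and 2: "selfsim D F \<Omega> I f c' q'"
  shows "\<exists>q''. selfsim D F \<Omega> I f (c * c') q''"
proof -
  define R where "R t = c * F (t / c)" for t
  have c: "0 < c" "c < 1" "0 < c'" "c' < 1" using 1 2 by (auto simp: selfsim_def)
  have ind1: "induced D F \<Omega> I ((*) c ` \<Omega>) (\<lambda>j. (*) c ` I j) q R"
    using 1 by (simp add: selfsim_def R_def[abs_def])
  have "induced D R ((*) c ` \<Omega>) (\<lambda>i. (*) c ` I i) ((*) c ` (*) c' ` \<Omega>) (\<lambda>i. (*) c ` (*) c' ` I i) q'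
      (\<lambda>t. c * c' * F (t / (c * c')))"
    using 2 c by (intro induced_conjugate[where R = "\<lambda>t. c' * F (t / c')"])
      (auto simp: selfsim_def R_def inj_def)
  then have ind2: "induced D R ((*) c ` \<Omega>) (\<lambda>i. (*) c ` I i) ((*) (c * c') ` \<Omega>) (\<lambda>i. (*) (c * c') ` I i) q'
      (\<lambda>t. c * c' * F (t / (c * c')))"
    by (simp add: image_image mult.assoc)
  obtain q'' where q'': "induced D F \<Omega> I ((*) (c * c') ` \<Omega>) (\<lambda>i. (*) (c * c') ` I i) q'' (\<lambda>t. c * c' * F (t / (c * c')))"
    and bk: "\<And>g j t. \<lbrakk>\<And>i s. i \<in> D \<Longrightarrow> s \<in> (*) c ` I i \<Longrightarrow> birkhoff f F (q i) s = g s; j \<in> D;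
        t \<in> (*) (c * c') ` I j\<rbrakk> \<Longrightarrow> birkhoff f F (q'' j) t = birkhoff g R (q' j) t"
    using induced_compose[OF ex ind1 ind2, where 'g = 'b] by metis
  have iter: "(R ^^ l) (c * u) = c * (F ^^ l) u" for l u
    by (induction l) (use c in \<open>simp_all add: R_def\<close>)
  have "birkhoff f F (q'' j) (c * c' * t) = f t" if "j \<in> D" "t \<in> I j" for j t
  proof -
    have "birkhoff f F (q'' j) (c * c' * t) = birkhoff (\<lambda>s. f (s / c)) R (q' j) (c * c' * t)"
      using 1 that c by (intro bk) (auto simp: selfsim_def)
    also have "\<dots> = birkhoff f F (q' j) (c' * t)"
      using iter[of _ "c' * t"] c by (simp add: birkhoff_def mult.assoc)
    also have "\<dots> = f t" using 2 that by (simp add: selfsim_def)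
    finally show ?thesis .
  qed
  moreover have "c * c' < 1" using c mult_strict_mono[of c 1 c' 1] by simp
  ultimately show ?thesis using q'' c by (auto simp: selfsim_def)
qed

text \<open>The exponent starts at 1 because \<open>selfsim\<close> demands a ratio below 1.\<close>

lemma selfsim_power:
  assumes ex: "separation D sep0 F \<Omega> I" and "selfsim D F \<Omega> I f c q"
  shows "\<exists>q'. selfsim D F \<Omega> I f (c ^ Suc k) q'"
proof (induction k)
  case (Suc k)
  then show ?case using selfsim_compose[OF ex assms(2)] by auto
qed (use assms in auto)

lemma skew_funpow: "(skew F f ^^ n) (t, a) = ((F ^^ n) t, a + birkhoff f F n t)"
  for a :: "'g::comm_monoid_add"
  by (induction n) (simp_all add: skew_def birkhoff_def add.assoc)

lemma first_return_skew:
  "first_return (skew F f) (A \<times> UNIV) (t, a) = (first_return F A t, a + birkhoff f F (return_time F A t) t)"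
  for a :: "'g::comm_monoid_add"
  by (simp add: first_return_def return_time_def skew_funpow)

section \<open>Interval exchanges on [0,1): from the period to a positive self-similar tower\<close>

locale iet_setting =
  fixes d :: nat and x :: "nat \<Rightarrow> real" and F :: "real \<Rightarrow> real"
  assumes d: "2 \<le> d" and iet: "iet d 0 1 x F" and keane: "keane d x F"
begin

abbreviation "D \<equiv> {1..d}"
abbreviation "\<Omega> \<equiv> {0..<1::real}"
abbreviation "I \<equiv> exch_interval x"

lemma x0: "x 0 = 0" and xd: "x d = 1" and bijF: "bij_betw F \<Omega> \<Omega>"
  using iet by (auto simp: iet_def)

lemma x_less: "i < j \<Longrightarrow> j \<le> d \<Longrightarrow> x i < x j"
proof (induction j)
  case (Suc j)
  have "x j < x (Suc j)" using iet Suc.prems by (simp add: iet_def)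
  then show ?case using Suc by (cases "i = j") auto
qed simp

lemma x_le: "i \<le> j \<Longrightarrow> j \<le> d \<Longrightarrow> x i \<le> x j"
  using x_less[of i j] by (cases "i = j") auto

lemma F_trans: "j \<in> D \<Longrightarrow> \<exists>\<tau>. \<forall>t\<in>I j. F t = t + \<tau>"
  using iet by (auto simp: iet_def exch_interval_def)

lemma F_in: "t \<in> \<Omega> \<Longrightarrow> F t \<in> \<Omega>" and F_inj: "inj_on F \<Omega>"
  using bijF by (auto simp: bij_betw_def)

lemma union_exch: "(\<Union>j\<in>D. I j) = \<Omega>"
proof
  show "(\<Union>j\<in>D. I j) \<subseteq> \<Omega>"
  proof
    fix t assume "t \<in> (\<Union>j\<in>D. I j)"
    then obtain j where j: "j \<in> D" "x (j - 1) \<le> t" "t < x j" by (auto simp: exch_interval_def)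
    have "x 0 \<le> x (j - 1)" "x j \<le> x d" using j by (auto intro!: x_le)
    then show "t \<in> \<Omega>" using j x0 xd by auto
  qed
  show "\<Omega> \<subseteq> (\<Union>j\<in>D. I j)"
  proof
    fix t assume t: "t \<in> \<Omega>"
    define j where "j = (LEAST j. t < x j)"
    have "t < x d" using t xd by simp
    then have j: "t < x j" "j \<le> d" unfolding j_def by (rule LeastI, rule Least_le)
    have "j \<noteq> 0" using j t x0 by (intro notI) auto
    moreover from this have "\<not> t < x (j - 1)" unfolding j_def by (intro not_less_Least) simp
    ultimately show "t \<in> (\<Union>j\<in>D. I j)" using j by (intro UN_I[of j]) (auto simp: exch_interval_def)
  qed
qed

lemma exch_disjoint:
  assumes ij: "i \<in> D" "j \<in> D" "i \<noteq> j"
  shows "I i \<inter> I j = {}"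
proof -
  have *: "I i \<inter> I j = {}" if "i \<in> D" "j \<in> D" "i < j" for i j
  proof -
    have "x i \<le> x (j - 1)" using that by (intro x_le) auto
    then show ?thesis by (auto simp: exch_interval_def)
  qed
  show ?thesis using *[of i j] *[of j i] ij by (cases "i < j") auto
qed

lemma exch_nonempty: "j \<in> D \<Longrightarrow> x (j - 1) \<in> I j"
  using x_less[of "j - 1" j] by (auto simp: exch_interval_def)

lemma separation_disj: "separation D (\<lambda>S U. S \<inter> U = {}) F \<Omega> I"
  using bijF by (intro separation_disjoint union_exch exch_disjoint) (auto simp: bij_betw_def)

lemma rv_valid_init: "rv_valid d 1 I F (\<lambda>j. x (j - 1)) x"
proof
  show "I j = {x (j - 1)..<x j}" "x (j - 1) < x j" if "j \<in> D" for j
    using that x_less[of "j - 1" j] by (auto simp: exch_interval_def)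
  show "x (i - 1) = 0" if "i \<in> D" "j \<in> D" "1 \<le> n" "(F ^^ n) (x (j - 1)) = x (i - 1)" for i j n
  proof (rule ccontr)
    assume "x (i - 1) \<noteq> 0"
    then have "i - 1 \<noteq> 0" using x0 by (intro notI) simp
    then have "i - 1 \<in> {1..<d}" using that by auto
    moreover have "j - 1 < d" using that(2) by auto
    then have "(F ^^ n) (x (j - 1)) \<notin> x ` {1..<d}"
      using keane that(3) unfolding keane_def by blast
    ultimately show False unfolding that(4) by blast
  qed
qed (use union_exch exch_disjoint bijF F_trans in auto)

text \<open>The clause \<open>b < 1\<close> for positive \<open>n\<close> later supplies the ratio
  \<open>c < 1\<close> of the self-similarity.\<close>

lemma rv_iter_valid:
  "\<exists>b J R e f q. rv_iter d x F n = ({0..<b}, J, R) \<and> rv_valid d b J R e f \<and> b \<le> 1 \<and> (1 \<le> n \<longrightarrow> b < 1) \<and>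
     induced D F \<Omega> I {0..<b} J q R"
proof (induction n)
  case 0
  have "induced D F \<Omega> I \<Omega> I (\<lambda>_. 1) F"
    unfolding induced_def
  proof (intro conjI allI impI)
    fix sep assume "separation D sep F \<Omega> I"
    then interpret separation D sep F \<Omega> I .
    show "tower D sep F \<Omega> I \<Omega> I (\<lambda>_. 1)"
    proof (unfold_locales)
      show "(F ^^ 1) ` I j \<subseteq> \<Omega>" if "j \<in> D" for j using iter_maps[OF I_subset[OF that]] .
      show "\<Omega> \<subseteq> (\<Union>j\<in>D. \<Union>l<1. (F ^^ l) ` I j)" using union_I by (simp add: lessThan_Suc)
      show "\<exists>i\<in>D. (F ^^ l) ` I j \<subseteq> I i" if "j \<in> D" "l < 1" for j l using that by auto
      show "sep ((F ^^ l) ` I j) ((F ^^ l') ` I j')" if "j \<in> D" "j' \<in> D" "l < 1" "l' < 1" "(j, l) \<noteq> (j', l')"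
        for j j' l l' using sep_I[OF that(1,2)] that by simp
    qed (use union_I in auto)
  qed simp
  then have "rv_iter d x F 0 = ({0..<1}, I, F) \<and> rv_valid d 1 I F (\<lambda>j. x (j - 1)) x \<and> (1::real) \<le> 1 \<and>
      (1 \<le> (0::nat) \<longrightarrow> (1::real) < 1) \<and> induced D F \<Omega> I {0..<1} I (\<lambda>_. 1) F"
    using rv_valid_init by (simp add: rv_iter_def x0 xd)
  then show ?case by blast
next
  case (Suc n)
  then obtain b J R e f q where n: "rv_iter d x F n = ({0..<b}, J, R)" "rv_valid d b J R e f" "b \<le> 1"
    "induced D F \<Omega> I {0..<b} J q R" by blast
  obtain b' J' R' e' f' q' where s: "rv_step d ({0..<b}, J, R) = ({0..<b'}, J', R')"
     "rv_valid d b' J' R' e' f'" "b' < b" "induced D R {0..<b} J {0..<b'} J' q' R'"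
    using rv_valid.rv_step_valid[OF n(2) d] by blast
  obtain q'' where i: "induced D F \<Omega> I {0..<b'} J' q'' R'"
    by (rule induced_compose[OF separation_disj n(4) s(4), where 'g = nat]) (rule that)
  have it: "rv_iter d x F (Suc n) = ({0..<b'}, J', R')" using n(1) s(1) by (simp add: rv_iter_def)
  have "b' \<le> 1" "1 \<le> Suc n \<longrightarrow> b' < 1" using s(3) n(3) by auto
  with it s(2) i show ?case by blast
qed

text \<open>One level of the induction at which every column passes through every exchanged
  interval. That level need not belong to a power of the period; \<open>selfsim_visits_all\<close>
  transfers the property to all sufficiently small self-similar bases.\<close>

lemma visits_all:
  assumes "infinitely_complete d x F"
  obtains n b J q where "0 < b" "tower D (\<lambda>S U. S \<inter> U = {}) F \<Omega> I {0..<b} J q"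
    "\<And>i j. i \<in> D \<Longrightarrow> j \<in> D \<Longrightarrow> \<exists>l<q j. (F ^^ l) ` J j \<subseteq> I i"
proof -
  have "\<forall>\<^sub>F n in sequentially. \<forall>i\<in>D. \<forall>j\<in>D. 1 \<le> rv_matrix d x F n i j"
    using assms by (auto simp: infinitely_complete_def filterlim_at_top intro!: eventually_ball_finite)
  then obtain n where pos: "\<forall>i\<in>D. \<forall>j\<in>D. 1 \<le> rv_matrix d x F n i j"
    using eventually_happens by force
  obtain b J R e f q where n: "rv_iter d x F n = ({0..<b}, J, R)" "rv_valid d b J R e f"
    "induced D F \<Omega> I {0..<b} J q R" using rv_iter_valid[of n] by blast
  interpret V: rv_valid d b J R e f by fact
  interpret T: tower D "\<lambda>S U. S \<inter> U = {}" F \<Omega> I "{0..<b}" J q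
    by (rule inducedD(1)[OF n(3) separation_disj])
  have dom: "rv_dom d x F n = {0..<b}" and int: "rv_int d x F n = J"
    using n(1) by (simp_all add: rv_dom_def rv_int_def)
  have time: "rv_time d x F n j = q j" if j: "j \<in> D" for j
    unfolding rv_time_def dom int
  proof (rule the_equality)
    show "\<forall>t\<in>J j. return_time F {0..<b} t = q j" using T.return_time_eq[OF j] by blast
    fix k assume k: "\<forall>t\<in>J j. return_time F {0..<b} t = k"
    have "e j \<in> J j" using V.J_eq[OF j] V.e_less_f[OF j] by simp
    then show "k = q j" using k T.return_time_eq[OF j] by metis
  qed
  show thesis
  proof (rule that[OF V.b_pos T.tower_axioms])
    fix i j assume ij: "i \<in> D" "j \<in> D"
    have "1 \<le> card {l. l < q j \<and> (F ^^ l) ` J j \<subseteq> I i}"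
      using pos[rule_format, OF ij] time[OF ij(2)] unfolding rv_matrix_def int by simp
    then have "{l. l < q j \<and> (F ^^ l) ` J j \<subseteq> I i} \<noteq> {}" by (intro notI) (simp only: card.empty)
    then show "\<exists>l<q j. (F ^^ l) ` J j \<subseteq> I i" by blast
  qed
qed

text \<open>A point of the smaller base cannot return to it before it returns to [0,b). Its column
  therefore runs through a whole column of the tower over [0,b), which meets every exchanged
  interval; since each floor lies in a single interval, one point of the floor decides
  which.\<close>

lemma selfsim_visits_all:
  assumes T: "tower D (\<lambda>S U. S \<inter> U = {}) F \<Omega> I {0..<b} J q"
    and visits: "\<And>i j. i \<in> D \<Longrightarrow> j \<in> D \<Longrightarrow> \<exists>l<q j. (F ^^ l) ` J j \<subseteq> I i"
    and ss: "selfsim D F \<Omega> I f c q'" and cb: "c \<le> b" and ij: "i \<in> D" "j \<in> D"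
  shows "\<exists>l<q' j. (F ^^ l) ` (*) c ` I j \<subseteq> I i"
proof -
  interpret T: tower D "\<lambda>S U. S \<inter> U = {}" F \<Omega> I "{0..<b}" J q by fact
  interpret T': tower D "\<lambda>S U. S \<inter> U = {}" F \<Omega> I "(*) c ` \<Omega>" "\<lambda>j. (*) c ` I j" q'
    using ss by (intro inducedD(1)[OF _ separation_disj]) (auto simp: selfsim_def)
  have c: "0 < c" using ss by (simp add: selfsim_def)
  have sub: "(*) c ` \<Omega> \<subseteq> {0..<b}"
  proof
    fix s assume "s \<in> (*) c ` \<Omega>"
    then obtain t where t: "0 \<le> t" "t < 1" "s = c * t" by auto
    then have "c * t < c * 1" using c by (intro mult_strict_left_mono)
    then have "c * t < b" using cb by simp
    then show "s \<in> {0..<b}" using t c by simp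
  qed
  define t where "t = c * x (j - 1)"
  have t: "t \<in> (*) c ` I j" unfolding t_def using exch_nonempty[OF ij(2)] by blast
  then have "t \<in> {0..<b}" using T'.union_J ij(2) sub by blast
  then obtain j' where j': "j' \<in> D" "t \<in> J j'" using T.union_J by blast
  obtain l where l: "l < q j'" "(F ^^ l) ` J j' \<subseteq> I i" using visits[OF ij(1) j'(1)] by blast
  have "l < q' j"
  proof (rule ccontr)
    assume "\<not> l < q' j"
    then have "q' j < q j'" using l by simp
    moreover have "(F ^^ q' j) t \<in> {0..<b}" using T'.top_returns[OF ij(2)] t sub by blast
    then have "return_time F {0..<b} t \<le> q' j"
      unfolding return_time_def using T'.q_pos[OF ij(2)] by (intro Least_le) simp
    ultimately show False using T.return_time_eq[OF j'] by simp
  qed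
  moreover obtain i' where i': "i' \<in> D" "(F ^^ l) ` (*) c ` I j \<subseteq> I i'"
    using T'.floor_subset[OF ij(2) \<open>l < q' j\<close>] by blast
  moreover have "(F ^^ l) t \<in> I i \<inter> I i'" using i'(2) t l(2) j'(2) by blast
  then have "i' = i" using exch_disjoint ij(1) i'(1) by blast
  ultimately show ?thesis by blast
qed

lemma selfsim_periodic:
  fixes \<phi> :: "nat \<Rightarrow> 'g::ab_group_add"
  assumes "periodic_type d x F \<phi>"
  obtains c q where "selfsim D F \<Omega> I (cocycle_I d x \<phi>) c q"
proof -
  obtain N where N: "N \<ge> 1"
    "\<And>t a. t \<in> \<Omega> \<Longrightarrow> rescaled_return d x F \<phi> N (t, a) = skew F (cocycle_I d x \<phi>) (t, a)"
    "\<And>j. j \<in> D \<Longrightarrow> (\<lambda>t. t / measure lborel (rv_dom d x F N)) ` rv_int d x F N j = I j"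
    using assms by (auto simp: periodic_type_def)
  obtain c J R e f q where n: "rv_iter d x F N = ({0..<c}, J, R)" "rv_valid d c J R e f" "c < 1"
    "induced D F \<Omega> I {0..<c} J q R" using rv_iter_valid[of N] N(1) by blast
  interpret V: rv_valid d c J R e f by fact
  interpret T: tower D "\<lambda>S U. S \<inter> U = {}" F \<Omega> I "{0..<c}" J q
    by (rule inducedD(1)[OF n(4) separation_disj])
  have c: "0 < c" by (rule V.b_pos)
  have dom: "rv_dom d x F N = {0..<c}" and int: "rv_int d x F N = J"
    using n(1) by (simp_all add: rv_dom_def rv_int_def)
  have meas: "measure lborel {0..<c} = c" using c by simp
  have cJ: "(*) c ` I j = J j" if "j \<in> D" for j
    using N(3)[OF that, symmetric] c unfolding dom int meas by (auto simp: image_image)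
  have c\<Omega>: "(*) c ` \<Omega> = {0..<c}"
    using V.union cJ union_exch by (metis (no_types, lifting) SUP_cong image_UN)
  \<comment> \<open>One equality of skew products gives both: the first coordinate identifies the
    rescaled return map with \<open>F\<close>, the second, started at the group element 0,
    identifies the Birkhoff sum with the cocycle.\<close>
  have ret: "F t = (F ^^ q j) (c * t) / c \<and> cocycle_I d x \<phi> t = birkhoff (cocycle_I d x \<phi>) F (q j) (c * t)"
    if j: "j \<in> D" and t: "t \<in> I j" for j t
  proof -
    have "t \<in> \<Omega>" using t j union_exch by blast
    moreover have "c * t \<in> J j" using cJ[OF j] t by blast
    ultimately show ?thesis
      using N(2)[of t 0] T.first_return_eq[OF j] T.return_time_eq[OF j]
      by (simp add: rescaled_return_def dom meas Let_def first_return_skew) (simp add: skew_def)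
  qed
  show thesis
  proof (rule that)
    have "induced D F \<Omega> I ((*) c ` \<Omega>) (\<lambda>j. (*) c ` I j) q (\<lambda>t. c * F (t / c))"
      unfolding induced_def
    proof (intro conjI allI impI ballI)
      fix sep assume s: "separation D sep F \<Omega> I"
      interpret S: tower D sep F \<Omega> I "{0..<c}" J q by (rule inducedD(1)[OF n(4) s])
      show "tower D sep F \<Omega> I ((*) c ` \<Omega>) (\<lambda>j. (*) c ` I j) q"
        unfolding c\<Omega>
      proof (unfold_locales)
        show "(\<Union>j\<in>D. (*) c ` I j) = {0..<c}" using S.union_J cJ by auto
        show "\<Omega> \<subseteq> (\<Union>j\<in>D. \<Union>l<q j. (F ^^ l) ` (*) c ` I j)" using S.floors_cover cJ by simp
      qed (use S.q_pos S.floor_subset S.top_returns S.floors_sep cJ in simp_all)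
    next
      fix j t assume j: "j \<in> D" "t \<in> (*) c ` I j"
      then show "c * F (t / c) = (F ^^ q j) t" using ret[OF j(1)] c by auto
    qed
    then show "selfsim D F \<Omega> I (cocycle_I d x \<phi>) c q"
      using c n(3) ret unfolding selfsim_def by auto
  qed
qed

lemma selfsim_positive:
  fixes \<phi> :: "nat \<Rightarrow> 'g::ab_group_add"
  assumes "periodic_type d x F \<phi>" "infinitely_complete d x F"
  obtains c q where "selfsim D F \<Omega> I (cocycle_I d x \<phi>) c q"
    "\<And>i j. i \<in> D \<Longrightarrow> j \<in> D \<Longrightarrow> \<exists>l<q j. (F ^^ l) ` (*) c ` I j \<subseteq> I i"
proof -
  obtain c q where ss: "selfsim D F \<Omega> I (cocycle_I d x \<phi>) c q" using selfsim_periodic[OF assms(1)] .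
  obtain b J p where b: "0 < b" "tower D (\<lambda>S U. S \<inter> U = {}) F \<Omega> I {0..<b} J p"
    "\<And>i j. i \<in> D \<Longrightarrow> j \<in> D \<Longrightarrow> \<exists>l<p j. (F ^^ l) ` J j \<subseteq> I i"
    by (rule visits_all[OF assms(2)]) (rule that)
  have c: "0 < c" "c < 1" using ss by (auto simp: selfsim_def)
  obtain k where k: "c ^ k < b" using real_arch_pow_inv[OF b(1) c(2)] by blast
  have "c * c ^ k \<le> 1 * c ^ k" using c by (intro mult_right_mono) auto
  then have "c ^ Suc k \<le> b" using k by (simp only: power_Suc mult_1)
  obtain q' where q': "selfsim D F \<Omega> I (cocycle_I d x \<phi>) (c ^ Suc k) q'"
    using selfsim_power[OF separation_disj ss] by blast
  show thesis by (rule that[OF q' selfsim_visits_all[OF b(2,3) q' \<open>c ^ Suc k \<le> b\<close>]])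
qed

end


section \<open>The compactification\<close>

lemma continuous_image_closure_within:
  fixes T :: "'a::metric_space \<Rightarrow> 'b::metric_space"
  assumes T: "continuous_on K T" and X: "X \<subseteq> K"
  shows "T ` (K \<inter> closure X) \<subseteq> closure (T ` X)"
proof
  fix y assume "y \<in> T ` (K \<inter> closure X)"
  then obtain p where p: "p \<in> K" "p \<in> closure X" "y = T p" by blast
  obtain u where u: "\<And>n. u n \<in> X" "u \<longlonglongrightarrow> p" using p(2) by (auto simp: closure_sequential)
  have "(T \<circ> u) \<longlonglongrightarrow> T p"
    using T X u p(1) unfolding continuous_on_sequentially by blast
  then show "y \<in> closure (T ` X)"
    unfolding closure_sequential p(3) using u(1) by (intro exI[of _ "T \<circ> u"]) auto
qed

lemma image_mult_Ico:
  fixes a b c :: real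
  assumes "0 < c"
  shows "(*) c ` {a..<b} = {c * a..<c * b}"
proof
  show "{c * a..<c * b} \<subseteq> (*) c ` {a..<b}"
  proof
    fix y assume "y \<in> {c * a..<c * b}"
    then have "y / c \<in> {a..<b}" "y = c * (y / c)" using assms by (auto simp: field_simps)
    then show "y \<in> (*) c ` {a..<b}" by blast
  qed
qed (use assms in auto)

context iet_setting
begin

abbreviation "r \<equiv> rmap d x F"
abbreviation "l \<equiv> lmap d x F"
abbreviation "K \<equiv> Kset d x F"

section \<open>The atomic measure \<open>rho\<close> and its one-sided distribution
  functions\<close>

lemma finite_Dplus: "finite (Dplus d x F n)" and finite_Dminus: "finite (Dminus d x F n)"
  by (auto simp: Dplus_def Dminus_def)

lemma card_Dplus_le: "card (Dplus d x F n \<inter> A) \<le> d"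
proof -
  have "card (Dplus d x F n \<inter> A) \<le> card (Dplus d x F n)" by (intro card_mono finite_Dplus) auto
  also have "\<dots> \<le> card (F ` x ` {0..<d} - {0})" unfolding Dplus_def by (intro card_image_le) auto
  also have "\<dots> \<le> card (F ` x ` {0..<d})" by (intro card_mono) auto
  also have "\<dots> \<le> card {0..<d}" unfolding image_image by (intro card_image_le) auto
  finally show ?thesis by simp
qed

lemma card_Dminus_le: "card (Dminus d x F n \<inter> A) \<le> d"
proof -
  have "card (Dminus d x F n \<inter> A) \<le> card (Dminus d x F n)" by (intro card_mono finite_Dminus) auto
  also have "\<dots> \<le> card {1..<d}" unfolding Dminus_def image_image by (intro card_image_le) auto
  finally show ?thesis by simp
qed

definition rho_term :: "real set \<Rightarrow> nat \<Rightarrow> real" where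
  "rho_term A n = (1 / 2) ^ n * (real (card (Dplus d x F n \<inter> A)) + real (card (Dminus d x F n \<inter> A)))"

lemma rho_eq: "rho d x F A = (\<Sum>n. rho_term A n)"
  by (simp add: rho_def rho_term_def)

lemma rho_term_nonneg: "0 \<le> rho_term A n"
  by (simp add: rho_term_def)

lemma rho_term_le: "rho_term A n \<le> (1 / 2) ^ n * (2 * real d)"
  unfolding rho_term_def using card_Dplus_le[of n A] card_Dminus_le[of n A]
  by (intro mult_left_mono) auto

lemma summable_rho: "summable (rho_term A)"
proof (rule summable_comparison_test)
  show "\<exists>N. \<forall>n\<ge>N. norm (rho_term A n) \<le> (1 / 2) ^ n * (2 * real d)"
    using rho_term_le rho_term_nonneg by auto
  show "summable (\<lambda>n. (1 / 2) ^ n * (2 * real d))" by (intro summable_mult2 summable_geometric) simp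
qed

lemma rho_nonneg: "0 \<le> rho d x F A"
  unfolding rho_eq by (intro suminf_nonneg summable_rho rho_term_nonneg)

lemma rho_Un:
  assumes "A \<inter> B = {}"
  shows "rho d x F (A \<union> B) = rho d x F A + rho d x F B"
proof -
  have "rho_term (A \<union> B) n = rho_term A n + rho_term B n" for n
  proof -
    have "card (Dplus d x F n \<inter> (A \<union> B)) = card (Dplus d x F n \<inter> A) + card (Dplus d x F n \<inter> B)"
      unfolding Int_Un_distrib using assms finite_Dplus by (intro card_Un_disjoint) auto
    moreover have "card (Dminus d x F n \<inter> (A \<union> B)) = card (Dminus d x F n \<inter> A) + card (Dminus d x F n \<inter> B)"
      unfolding Int_Un_distrib using assms finite_Dminus by (intro card_Un_disjoint) auto
    ultimately show ?thesis by (simp add: rho_term_def algebra_simps)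
  qed
  then have "rho_term (A \<union> B) = (\<lambda>n. rho_term A n + rho_term B n)" by (rule ext)
  then show ?thesis by (simp add: rho_eq suminf_add[OF summable_rho summable_rho])
qed

text \<open>A set without atoms of level below m sees only the tail of the series. With at most
  \<open>d\<close> forward and \<open>d\<close> backward atoms per level the tail is at most
  \<open>(1 / 2) ^ m * (4 * real d)\<close>, which dictates the choice of \<open>m\<close>.\<close>

lemma rho_small:
  assumes "0 < \<epsilon>"
  shows "\<exists>m. \<forall>A. (\<forall>n<m. Dplus d x F n \<inter> A = {} \<and> Dminus d x F n \<inter> A = {}) \<longrightarrow> rho d x F A \<le> \<epsilon>"
proof -
  obtain m where m: "(1 / 2) ^ m < \<epsilon> / (4 * real d)"
    using real_arch_pow_inv[of "\<epsilon> / (4 * real d)" "1 / 2"] assms d by auto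
  have d0: "0 < real d" using d by simp
  show ?thesis
  proof (intro exI[of _ m] allI impI)
    fix A assume "\<forall>n<m. Dplus d x F n \<inter> A = {} \<and> Dminus d x F n \<inter> A = {}"
    then have z: "rho_term A n = 0" if "n < m" for n using that by (simp add: rho_term_def)
    have g: "summable (\<lambda>n. (1 / 2) ^ n * ((1 / 2) ^ m * (2 * real d)))"
      by (intro summable_mult2 summable_geometric) simp
    have "rho d x F A = (\<Sum>n. rho_term A (n + m)) + (\<Sum>n<m. rho_term A n)"
      unfolding rho_eq by (rule suminf_split_initial_segment[OF summable_rho])
    also have "(\<Sum>n<m. rho_term A n) = 0" using z by simp
    also have "(\<Sum>n. rho_term A (n + m)) \<le> (\<Sum>n. (1 / 2) ^ n * ((1 / 2) ^ m * (2 * real d)))"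
    proof (rule suminf_le)
      show "rho_term A (n + m) \<le> (1 / 2) ^ n * ((1 / 2) ^ m * (2 * real d))" for n
        using rho_term_le[of A "n + m"] by (simp add: power_add mult.assoc)
      show "summable (\<lambda>n. rho_term A (n + m))" using summable_ignore_initial_segment[OF summable_rho] .
    qed (rule g)
    also have "\<dots> = 2 * ((1 / 2) ^ m * (2 * real d))"
      by (subst suminf_mult2[symmetric]) (simp_all add: suminf_geometric summable_geometric)
    finally have "rho d x F A \<le> (1 / 2) ^ m * (4 * real d)" by simp
    moreover have "(1 / 2) ^ m * (4 * real d) < \<epsilon>"
      using m by (subst (asm) pos_less_divide_eq) (use d0 in auto)
    ultimately show "rho d x F A \<le> \<epsilon>" by (rule order_trans[OF _ less_imp_le])
  qed
qed

lemma r_diff: "0 \<le> s \<Longrightarrow> s \<le> t \<Longrightarrow> r t - r s = rho d x F {s<..t}"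
proof -
  assume "0 \<le> s" "s \<le> t"
  then have "{0..t} = {0..s} \<union> {s<..t}" by auto
  moreover have "rho d x F ({0..s} \<union> {s<..t}) = rho d x F {0..s} + rho d x F {s<..t}" by (rule rho_Un) auto
  ultimately show ?thesis by (simp add: rmap_def)
qed

lemma lr_diff: "0 \<le> s \<Longrightarrow> s < t \<Longrightarrow> l t - r s = rho d x F {s<..<t}"
proof -
  assume "0 \<le> s" "s < t"
  then have "{0..<t} = {0..s} \<union> {s<..<t}" by auto
  moreover have "rho d x F ({0..s} \<union> {s<..<t}) = rho d x F {0..s} + rho d x F {s<..<t}" by (rule rho_Un) auto
  ultimately show ?thesis by (simp add: rmap_def lmap_def)
qed

lemma r_mono: "0 \<le> s \<Longrightarrow> s \<le> t \<Longrightarrow> r s \<le> r t"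
  using r_diff[of s t] rho_nonneg[of "{s<..t}"] by simp

lemma r_le_l: "0 \<le> s \<Longrightarrow> s < t \<Longrightarrow> r s \<le> l t"
  using lr_diff[of s t] rho_nonneg[of "{s<..<t}"] by simp

text \<open>\<open>l t\<close> is the left limit of \<open>r\<close> at \<open>t\<close>. Only
  finitely many atoms of low level lie below \<open>t\<close>; \<open>s\<close> is the largest of
  them, or \<open>a\<close> if that is larger, and between \<open>s\<close> and \<open>t\<close>
  only the tail is left.\<close>

lemma l_limit_r:
  assumes "0 \<le> a" "a < t" "0 < \<epsilon>"
  shows "\<exists>s\<in>{a..<t}. \<bar>r s - l t\<bar> \<le> \<epsilon>"
proof -
  obtain m where m: "\<forall>A. (\<forall>n<m. Dplus d x F n \<inter> A = {} \<and> Dminus d x F n \<inter> A = {}) \<longrightarrow> rho d x F A \<le> \<epsilon>"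
    using rho_small[OF assms(3)] by (rule exE)
  define P where "P = insert a {p \<in> (\<Union>n<m. Dplus d x F n \<union> Dminus d x F n). p < t}"
  have P: "finite P" "P \<noteq> {}" by (auto simp: P_def finite_Dplus finite_Dminus)
  define s where "s = Max P"
  have s: "a \<le> s" "s < t" using P assms by (auto simp: s_def P_def)
  have "rho d x F {s<..<t} \<le> \<epsilon>"
  proof (rule m[rule_format])
    fix n assume n: "n < m"
    have "p \<le> s" if "p \<in> Dplus d x F n \<union> Dminus d x F n" "p < t" for p
      unfolding s_def using P n that by (intro Max_ge) (auto simp: P_def)
    then show "Dplus d x F n \<inter> {s<..<t} = {} \<and> Dminus d x F n \<inter> {s<..<t} = {}" by force
  qed
  then show ?thesis using s assms lr_diff[of s t] r_le_l[of s t] by (intro bexI[of _ s]) auto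
qed

lemma l_in_closure:
  assumes "0 \<le> a" "a < t"
  shows "l t \<in> closure (r ` {a..<t})"
  unfolding closure_approachable
proof (intro allI impI)
  fix \<epsilon> :: real assume "0 < \<epsilon>"
  then obtain s where "s \<in> {a..<t}" "\<bar>r s - l t\<bar> \<le> \<epsilon> / 2" using l_limit_r[OF assms, of "\<epsilon> / 2"] by auto
  then show "\<exists>y\<in>r ` {a..<t}. dist y (l t) < \<epsilon>" using \<open>0 < \<epsilon>\<close> by (intro bexI[of _ "r s"]) (auto simp: dist_real_def)
qed

section \<open>Closures in \<open>K\<close> of subsets of the interval\<close>

text \<open>For \<open>S = I i\<close> this is the clopen piece \<open>Kpart d x F i\<close>.
  Admitting arbitrary sets makes the operation commute with finite unions and turns \<open>F\<close>
  into \<open>T\<close>.\<close>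

definition hat :: "real set \<Rightarrow> real set" where
  "hat S = K \<inter> closure (r ` S)"

lemma r_in_K: "t \<in> \<Omega> \<Longrightarrow> r t \<in> K"
  by (auto simp: Kset_def)

lemma x_nonneg: "j \<le> d \<Longrightarrow> 0 \<le> x j"
  using x_le[of 0 j] x0 by auto

lemma Kpart_subset:
  assumes i: "i \<in> D"
  shows "Kpart d x F i \<subseteq> closure (r ` I i)"
proof -
  have "l t \<in> closure (r ` I i)" if t: "x (i - 1) < t" "t \<le> x i" for t
  proof -
    have "l t \<in> closure (r ` {x (i - 1)..<t})" using i t by (intro l_in_closure x_nonneg) auto
    moreover have "r ` {x (i - 1)..<t} \<subseteq> r ` I i" using t by (auto simp: exch_interval_def)
    ultimately show ?thesis using closure_mono by blast
  qed
  then show ?thesis unfolding Kpart_def using closure_subset[of "r ` I i"] by (auto simp: exch_interval_def)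
qed

lemma K_subset_Kpart: "K \<subseteq> (\<Union>i\<in>D. Kpart d x F i)"
proof
  fix p assume "p \<in> K"
  then consider t where "t \<in> {0<..1}" "p = l t" | t where "t \<in> \<Omega>" "p = r t" by (auto simp: Kset_def)
  then show "p \<in> (\<Union>i\<in>D. Kpart d x F i)"
  proof cases
    case 1
    define j where "j = (LEAST j. t \<le> x j)"
    have "t \<le> x d" using 1 xd by simp
    then have j: "t \<le> x j" "j \<le> d" unfolding j_def by (rule LeastI, rule Least_le)
    have "j \<noteq> 0" using j 1 x0 by (intro notI) auto
    moreover from this have "\<not> t \<le> x (j - 1)" unfolding j_def by (intro not_less_Least) simp
    ultimately show ?thesis using j 1 by (intro UN_I[of j]) (auto simp: Kpart_def)
  next
    case 2
    then obtain j where "j \<in> D" "t \<in> I j" using union_exch by blast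
    then show ?thesis using 2 by (intro UN_I[of j]) (auto simp: Kpart_def exch_interval_def)
  qed
qed

lemma rho_point:
  assumes "i \<in> {1..<d}"
  shows "1 \<le> rho d x F {x i}"
proof -
  have "x i \<in> Dminus d x F 0" using assms by (auto simp: Dminus_def)
  then have "Dminus d x F 0 \<inter> {x i} = {x i}" by auto
  then have "1 \<le> rho_term {x i} 0" by (simp add: rho_term_def)
  also have "\<dots> = (\<Sum>n\<in>{0}. rho_term {x i} n)" by simp
  also have "\<dots> \<le> rho d x F {x i}" unfolding rho_eq
    by (rule sum_le_suminf[OF summable_rho]) (auto intro: rho_term_nonneg)
  finally show ?thesis .
qed

text \<open>A marked point between the two intervals is an atom of level 0, so it leaves a gap of
  length at least 1 from \<open>l (x i)\<close> to \<open>r (x i)\<close>, and the closures lie on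
  different sides of it.\<close>

lemma closure_exch_disjoint:
  assumes ij: "i \<in> D" "j \<in> D" "i \<noteq> j"
  shows "closure (r ` I i) \<inter> closure (r ` I j) = {}"
proof -
  have *: "closure (r ` I i) \<inter> closure (r ` I j) = {}" if ij: "i \<in> D" "j \<in> D" "i < j" for i j
  proof -
    have i: "i \<in> {1..<d}" using ij by auto
    have "0 \<le> x (i - 1)" using ij by (intro x_nonneg) auto
    then have "closure (r ` I i) \<subseteq> {..l (x i)}"
      by (intro closure_minimal) (auto simp: exch_interval_def intro!: r_le_l)
    moreover have "closure (r ` I j) \<subseteq> {r (x i)..}"
    proof (rule closure_minimal)
      have "x i \<le> x (j - 1)" using ij by (intro x_le) auto
      then show "r ` I j \<subseteq> {r (x i)..}" using x_nonneg[of i] ij by (auto simp: exch_interval_def intro!: r_mono)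
    qed simp
    moreover have "l (x i) < r (x i)"
    proof -
      have "{0..x i} = {0..<x i} \<union> {x i}" using x_nonneg[of i] ij by auto
      moreover have "rho d x F ({0..<x i} \<union> {x i}) = rho d x F {0..<x i} + rho d x F {x i}" by (rule rho_Un) auto
      ultimately have "r (x i) = l (x i) + rho d x F {x i}" by (simp add: rmap_def lmap_def)
      then show ?thesis using rho_point[OF i] by simp
    qed
    ultimately show ?thesis by fastforce
  qed
  show ?thesis using *[of i j] *[of j i] ij by (cases "i < j") auto
qed

lemma cocycle_K_eq:
  assumes i: "i \<in> D" and p: "p \<in> hat (I i)"
  shows "cocycle_K d x F \<phi> p = \<phi> i"
proof -
  have u: "k = i" if "k \<in> D" "p \<in> Kpart d x F k" for k
    using closure_exch_disjoint[OF that(1) i] Kpart_subset[OF that(1)] that(2) p by (auto simp: hat_def)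
  obtain k where k: "k \<in> D" "p \<in> Kpart d x F k" using K_subset_Kpart p by (auto simp: hat_def)
  have "(THE k. k \<in> D \<and> p \<in> Kpart d x F k) = i"
    by (rule the_equality) (use u k in blast)+
  then show ?thesis by (simp add: cocycle_K_def)
qed

lemma hat_mono: "S \<subseteq> U \<Longrightarrow> hat S \<subseteq> hat U"
  unfolding hat_def by (intro Int_mono order_refl closure_mono image_mono)

lemma hat_Un: "hat (S \<union> U) = hat S \<union> hat U"
  by (auto simp: hat_def image_Un closure_Un)

lemma hat_empty: "hat {} = {}"
  by (simp add: hat_def)

lemma hat_Omega: "hat \<Omega> = K"
proof
  have "Kpart d x F i \<subseteq> closure (r ` \<Omega>)" if "i \<in> D" for i
  proof -
    have "r ` I i \<subseteq> r ` \<Omega>" using that union_exch by blast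
    then show ?thesis using Kpart_subset[OF that] closure_mono by blast
  qed
  then have "K \<subseteq> closure (r ` \<Omega>)" using K_subset_Kpart by blast
  then show "K \<subseteq> hat \<Omega>" by (simp add: hat_def)
qed (simp add: hat_def)

lemma r_in_hat: "S \<subseteq> \<Omega> \<Longrightarrow> t \<in> S \<Longrightarrow> r t \<in> hat S"
  unfolding hat_def using closure_subset[of "r ` S"] by (auto intro: r_in_K)

text \<open>A homeomorphism of \<open>K\<close> commutes with closures taken relative to
  \<open>K\<close>, and on the values of \<open>r\<close> it acts as \<open>F\<close>.\<close>

lemma hat_image:
  assumes T: "continuous_extension d x F T" and S: "S \<subseteq> \<Omega>"
  shows "T ` hat S = hat (F ` S)"
proof -
  obtain R where R: "homeomorphism K K T R" using T by (auto simp: continuous_extension_def)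
  have sub: "r ` S \<subseteq> K" using S r_in_K by blast
  have img: "T ` r ` S = r ` F ` S"
    unfolding image_image using T S by (intro image_cong) (auto simp: continuous_extension_def)
  have TK: "T ` K = K" "continuous_on K T" "continuous_on K R" "R ` K = K"
    and RT: "\<And>p. p \<in> K \<Longrightarrow> R (T p) = p" "\<And>p. p \<in> K \<Longrightarrow> T (R p) = p"
    using R by (auto simp: homeomorphism_def)
  have "(\<lambda>p. R (T p)) ` r ` S = (\<lambda>p. p) ` r ` S" using sub RT(1) by (intro image_cong) auto
  then have "R ` T ` r ` S = r ` S" by (simp add: image_image)
  then have Rsub: "R ` (K \<inter> closure (T ` r ` S)) \<subseteq> closure (r ` S)"
    using continuous_image_closure_within[OF TK(3), of "T ` r ` S"] sub TK(1) by auto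
  show ?thesis
  proof
    have "T ` hat S \<subseteq> closure (T ` r ` S)" unfolding hat_def by (rule continuous_image_closure_within[OF TK(2) sub])
    then show "T ` hat S \<subseteq> hat (F ` S)" using TK(1) by (auto simp: hat_def img)
    show "hat (F ` S) \<subseteq> T ` hat S"
    proof
      fix p assume "p \<in> hat (F ` S)"
      then have p: "p \<in> K" "p \<in> closure (T ` r ` S)" by (auto simp: hat_def img)
      then have "R p \<in> hat S" using Rsub TK(4) by (auto simp: hat_def)
      then show "p \<in> T ` hat S" using RT(2)[OF p(1)] by force
    qed
  qed
qed

text \<open>The instance that carries every tower over to \<open>K\<close>. It rests on
  compatibility of \<open>hat\<close> with unions and with \<open>T\<close>, and on the gaps at the
  marked points.\<close>

lemma separation_hat:
  assumes T: "continuous_extension d x F T"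
  shows "separation D (\<lambda>S U. hat S \<inter> hat U = {}) F \<Omega> I"
proof
  have inj: "inj_on T K" using T unfolding continuous_extension_def homeomorphism_def by (metis inj_on_inverseI)
  show "hat (S \<union> S') \<inter> hat U = {}" if "hat S \<inter> hat U = {}" "hat S' \<inter> hat U = {}" for S S' U
    using that by (auto simp: hat_Un)
  show "hat S' \<inter> hat U' = {}" if "hat S \<inter> hat U = {}" "S' \<subseteq> S" "U' \<subseteq> U" for S S' U U'
    using hat_mono[OF that(2)] hat_mono[OF that(3)] that(1) by blast
  show "hat (I i) \<inter> hat (I j) = {}" if "i \<in> D" "j \<in> D" "i \<noteq> j" for i j
    using closure_exch_disjoint[OF that] by (auto simp: hat_def)
  fix S U assume SU: "S \<subseteq> \<Omega>" "U \<subseteq> \<Omega>"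
  show "S \<inter> U = {}" if "hat S \<inter> hat U = {}" using r_in_hat[OF SU(1)] r_in_hat[OF SU(2)] that by blast
  have "T ` (hat S \<inter> hat U) = hat (F ` S) \<inter> hat (F ` U)"
    unfolding hat_image[OF T SU(1), symmetric] hat_image[OF T SU(2), symmetric]
    by (rule inj_on_image_Int[OF inj]) (auto simp: hat_def)
  then show "hat (F ` S) \<inter> hat (F ` U) = {} \<longleftrightarrow> hat S \<inter> hat U = {}" by auto
qed (use union_exch F_in in \<open>auto simp: hat_empty\<close>)

section \<open>Orbits of marked points and the diameter of tower floors\<close>

text \<open>A translation on the interval containing the preimage of 0 cannot push the left endpoint
  below 0, so the preimage is this endpoint.\<close>

lemma preimage_0:
  obtains k where "k < d" "\<And>u. u \<in> \<Omega> \<Longrightarrow> F u = 0 \<Longrightarrow> u = x k"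
proof -
  have "0 \<in> F ` \<Omega>" using bijF by (auto simp: bij_betw_def)
  then obtain u where u: "u \<in> \<Omega>" "F u = 0" by auto
  obtain j where j: "j \<in> D" "u \<in> I j" using union_exch u(1) by blast
  obtain \<tau> where \<tau>: "\<And>t. t \<in> I j \<Longrightarrow> F t = t + \<tau>" using F_trans[OF j(1)] by blast
  note e = exch_nonempty[OF j(1)]
  have "x (j - 1) \<in> \<Omega>" using e j(1) union_exch by blast
  then have "0 \<le> F (x (j - 1))" using F_in by fastforce
  moreover have "F (x (j - 1)) = x (j - 1) - u" using \<tau>[OF e] \<tau>[OF j(2)] u by simp
  moreover have "x (j - 1) \<le> u" using j(2) by (simp add: exch_interval_def)
  ultimately have "u = x (j - 1)" by simp
  moreover have "v = u" if "v \<in> \<Omega>" "F v = 0" for v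
    by (rule inj_onD[OF F_inj]) (use u that in auto)
  ultimately show thesis using j(1) by (intro that[of "j - 1"]) auto
qed

lemma F_iter_in: "t \<in> \<Omega> \<Longrightarrow> (F ^^ n) t \<in> \<Omega>"
  by (induction n) (use F_in in auto)

lemma x_in: "i < d \<Longrightarrow> x i \<in> \<Omega>"
  using x_less[of i d] x_nonneg[of i] xd by auto

text \<open>One step before 0 the orbit is at the preimage of 0, a marked point. At a positive time
  the Keane condition leaves only \<open>x 0 = 0\<close>, so 0 was hit one step earlier already, and
  so on down to time 1.\<close>

lemma orbit_hits_0:
  assumes i: "i < d" and "1 \<le> k" "(F ^^ k) (x i) = 0"
  shows "F (x i) = 0"
  using assms(2,3)
proof (induction k rule: dec_induct)
  case (step k)
  obtain k0 where k0: "k0 < d" "\<And>u. u \<in> \<Omega> \<Longrightarrow> F u = 0 \<Longrightarrow> u = x k0" using preimage_0 by blast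
  have "(F ^^ k) (x i) = x k0" using k0(2)[OF F_iter_in[OF x_in[OF i]]] step.prems by simp
  moreover have "(F ^^ k) (x i) \<notin> x ` {1..<d}" using keane i step.hyps unfolding keane_def by blast
  ultimately have "k0 = 0" using k0(1) by (cases "k0 = 0") auto
  then show ?case using step.IH \<open>(F ^^ k) (x i) = x k0\<close> x0 by simp
qed simp

lemma x_not_interior:
  assumes "i < d" "k \<in> D" "s \<in> I k" "x i \<in> I k" "s < x i"
  shows False
proof -
  have "x (k - 1) < x i" "x i < x k" using assms by (auto simp: exch_interval_def)
  moreover have "x i \<le> x (k - 1)" if "i \<le> k - 1" using that assms(2) by (intro x_le) auto
  moreover have "x k \<le> x i" if "k \<le> i" using that assms(1) by (intro x_le) auto
  ultimately have "\<not> i \<le> k - 1" "\<not> k \<le> i" by auto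
  then show False by simp
qed

lemma inv_iter:
  assumes "y \<in> \<Omega>"
  shows "(inv_into \<Omega> F ^^ n) y \<in> \<Omega> \<and> (k \<le> n \<longrightarrow> (F ^^ k) ((inv_into \<Omega> F ^^ n) y) = (inv_into \<Omega> F ^^ (n - k)) y)"
proof -
  have in': "inv_into \<Omega> F z \<in> \<Omega>" "F (inv_into \<Omega> F z) = z" if "z \<in> \<Omega>" for z
    using that bijF by (auto simp: bij_betw_def intro: inv_into_into f_inv_into_f) (metis inv_into_into atLeastLessThan_iff)+
  have 1: "(inv_into \<Omega> F ^^ n) y \<in> \<Omega>" for n by (induction n) (use assms in' in auto)
  have "k \<le> n \<longrightarrow> (F ^^ k) ((inv_into \<Omega> F ^^ n) y) = (inv_into \<Omega> F ^^ (n - k)) y"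
  proof (induction k)
    case (Suc k)
    show ?case
    proof
      assume k: "Suc k \<le> n"
      then have "n - k = Suc (n - Suc k)" by simp
      then have "(inv_into \<Omega> F ^^ (n - k)) y = inv_into \<Omega> F ((inv_into \<Omega> F ^^ (n - Suc k)) y)" by simp
      then show "(F ^^ Suc k) ((inv_into \<Omega> F ^^ n) y) = (inv_into \<Omega> F ^^ (n - Suc k)) y"
        using Suc k in'(2)[OF 1] by simp
    qed
  qed simp
  then show ?thesis using 1 by blast
qed

lemma funpow_inj: "s \<in> \<Omega> \<Longrightarrow> t \<in> \<Omega> \<Longrightarrow> (F ^^ n) s = (F ^^ n) t \<Longrightarrow> s = t"
proof (induction n)
  case (Suc n)
  then have "(F ^^ n) s = (F ^^ n) t" using F_inj F_iter_in by (auto dest: inj_onD)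
  then show ?case using Suc by simp
qed simp

lemma floor_translation:
  assumes T: "tower D sep F \<Omega> I A J q" and j: "j \<in> D"
  shows "n < q j \<Longrightarrow> \<exists>\<tau>. \<forall>t\<in>J j. (F ^^ n) t = t + \<tau>"
proof (induction n)
  case 0
  show ?case by (intro exI[of _ 0]) simp
next
  case (Suc n)
  then obtain \<tau> where \<tau>: "\<And>t. t \<in> J j \<Longrightarrow> (F ^^ n) t = t + \<tau>" by auto
  obtain i where i: "i \<in> D" "(F ^^ n) ` J j \<subseteq> I i" using tower.floor_subset[OF T j, of n] Suc.prems by auto
  obtain \<tau>' where \<tau>': "\<And>t. t \<in> I i \<Longrightarrow> F t = t + \<tau>'" using F_trans[OF i(1)] by blast
  have "(F ^^ Suc n) t = t + (\<tau> + \<tau>')" if "t \<in> J j" for t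
    using \<tau>'[of "(F ^^ n) t"] \<tau>[OF that] i(2) that by auto
  then show ?case by blast
qed

text \<open>Atoms of level below \<open>m\<close> lie on orbit segments of bounded length, which avoid a base that is
  small enough; hence they can only be left endpoints of floors.\<close>

lemma atoms_not_inside_floors:
  obtains \<delta> where "0 < \<delta>" "\<And>sep c q j k n s p.
     \<lbrakk>tower D sep F \<Omega> I ((*) c ` \<Omega>) (\<lambda>j. (*) c ` I j) q; 0 < c; c < \<delta>; j \<in> D; k < q j; n < m;
      s \<in> (F ^^ k) ` (*) c ` I j; p \<in> (F ^^ k) ` (*) c ` I j; s < p; p \<in> Dplus d x F n \<union> Dminus d x F n\<rbrakk> \<Longrightarrow> False"
proof -
  define Q where "Q = {y \<in> (\<lambda>(n, i). (F ^^ n) (x i)) ` ({..m} \<times> {..<d}) \<union>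
      (\<lambda>(n, i). (inv_into \<Omega> F ^^ n) (x i)) ` ({..m} \<times> {..<d}). 0 < y}"
  define \<delta> where "\<delta> = Min (insert 1 Q)"
  have finQ: "finite Q" by (auto simp: Q_def)
  have \<delta>: "0 < \<delta>" using finQ by (auto simp: \<delta>_def Q_def)
  have small: "y = 0" if "y \<in> \<Omega>" "y < \<delta>" "y \<in> (\<lambda>(n, i). (F ^^ n) (x i)) ` ({..m} \<times> {..<d}) \<union>
      (\<lambda>(n, i). (inv_into \<Omega> F ^^ n) (x i)) ` ({..m} \<times> {..<d})" for y
  proof (rule ccontr)
    assume "y \<noteq> 0"
    then have "y \<in> Q" using that by (auto simp: Q_def)
    then have "\<delta> \<le> y" unfolding \<delta>_def using finQ by (intro Min_le) auto
    then show False using that by simp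
  qed
  show thesis
  proof (rule that[OF \<delta>])
    fix sep c q j k n s p
    assume T: "tower D sep F \<Omega> I ((*) c ` \<Omega>) (\<lambda>j. (*) c ` I j) q" and c: "0 < c" "c < \<delta>"
      and j: "j \<in> D" and k: "k < q j" and n: "n < m"
      and s: "s \<in> (F ^^ k) ` (*) c ` I j" and p: "p \<in> (F ^^ k) ` (*) c ` I j" and sp: "s < p"
      and atom: "p \<in> Dplus d x F n \<union> Dminus d x F n"
    interpret tower D sep F \<Omega> I "(*) c ` \<Omega>" "\<lambda>j. (*) c ` I j" q by fact
    obtain v u where v: "v \<in> (*) c ` I j" "s = (F ^^ k) v" and u: "u \<in> (*) c ` I j" "p = (F ^^ k) u"
      using s p by blast
    have v\<Omega>: "v \<in> \<Omega>" and u\<Omega>: "u \<in> \<Omega>" using v u J_subset[OF j] by blast+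
    have base: "y < \<delta>" if y: "y \<in> (*) c ` \<Omega>" for y
    proof -
      from y obtain t where "y = c * t" "t \<in> \<Omega>" by (rule imageE)
      then have "y < c" using c by simp
      then show ?thesis using c by simp
    qed
    obtain \<tau> where "\<And>t. t \<in> (*) c ` I j \<Longrightarrow> (F ^^ k) t = t + \<tau>" using floor_translation[OF T j k] by blast
    then have vu: "v < u" using v u sp by simp
    \<comment> \<open>Up to this height the column moves by translations, so the image of
      \<open>u\<close> stays to the right of the image of \<open>v\<close> in the same floor. A
      marked point in an exchanged interval is its left endpoint and has nothing of that interval to
      its left.\<close>
    have noint: False if nq: "n' < q j" and xi: "(F ^^ n') u = x i" "i < d" for n' i
    proof -
      obtain \<tau> where \<tau>: "\<And>t. t \<in> (*) c ` I j \<Longrightarrow> (F ^^ n') t = t + \<tau>" using floor_translation[OF T j nq] by blast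
      obtain i' where i': "i' \<in> D" "(F ^^ n') ` (*) c ` I j \<subseteq> I i'" using floor_subset[OF j nq] by blast
      have "(F ^^ n') v < x i" using \<tau>[OF u(1)] \<tau>[OF v(1)] xi vu by simp
      moreover have "(F ^^ n') v \<in> I i'" "(F ^^ n') u \<in> I i'" using i'(2) v(1) u(1) by blast+
      then have "(F ^^ n') v \<in> I i'" "x i \<in> I i'" by (simp_all add: xi(1))
      ultimately show False using x_not_interior[OF xi(2) i'(1)] by blast
    qed
    show False
      using atom
    proof
      assume "p \<in> Dplus d x F n"
      then obtain y where "p = (F ^^ n) y" "y \<in> F ` x ` {0..<d} - {0}" unfolding Dplus_def by (rule imageE)
      then obtain i where i: "i < d" "p = (F ^^ n) (F (x i))" "F (x i) \<noteq> 0" by auto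
      then have pi: "p = (F ^^ Suc n) (x i)" by (simp add: funpow_swap1)
      \<comment> \<open>Either the orbit from \<open>x i\<close> to the atom starts inside this
        column, where \<open>noint\<close> applies, or it passes through the base at
        \<open>u\<close>. In the latter case \<open>u\<close> is 0 by smallness of the base, and the
        construction of \<open>Dplus\<close> leaves out points \<open>F (x i)\<close> equal to
        0.\<close>
      show False
      proof (cases "Suc n \<le> k")
        case True
        then have "(F ^^ Suc n) ((F ^^ (k - Suc n)) u) = (F ^^ Suc n) (x i)"
          using pi u(2) funpow_add[of "Suc n" "k - Suc n" F] by simp
        then have "(F ^^ (k - Suc n)) u = x i" by (rule funpow_inj[OF F_iter_in[OF u\<Omega>] x_in[OF i(1)]])
        then show False by (rule noint[OF le_less_trans[OF diff_le_self k] _ i(1)])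
      next
        case False
        then have "(F ^^ k) ((F ^^ (Suc n - k)) (x i)) = (F ^^ k) u"
          using pi u(2) funpow_add[of k "Suc n - k" F] False by (metis comp_apply le_add_diff_inverse nat_le_linear)
        then have eq: "(F ^^ (Suc n - k)) (x i) = u" by (rule funpow_inj[OF F_iter_in[OF x_in[OF i(1)]] u\<Omega>])
        have "u \<in> (*) c ` \<Omega>" using u(1) j union_J by blast
        then have "u < \<delta>" by (rule base)
        moreover have "(Suc n - k, i) \<in> {..m} \<times> {..<d}" using n i by auto
        ultimately have "u = 0" using eq u\<Omega> by (intro small) force+
        moreover have "1 \<le> Suc n - k" using False by linarith
        ultimately show False using orbit_hits_0[OF i(1), of "Suc n - k"] eq i(3) by blast
      qed
    next
      assume "p \<in> Dminus d x F n"
      then obtain i where i: "1 \<le> i" "i < d" "p = (inv_into \<Omega> F ^^ n) (x i)" by (auto simp: Dminus_def)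
      note inv = inv_iter[OF x_in[OF i(2)], of n, folded i(3)]
      \<comment> \<open>Either the marked point is reached before the top of the column, where
        \<open>noint\<close> applies, or the orbit first returns to the base. There it must be at 0,
        which is no \<open>x i\<close> with i \<ge> 1 and whose forward orbit avoids these points by
        the Keane condition.\<close>
      show False
      proof (cases "k + n < q j")
        case True
        have "(F ^^ (n + k)) u = x i" using inv[of n] u(2) by (simp add: funpow_add)
        then show False using noint[of "n + k" i] True i(2) by (simp add: add.commute)
      next
        case False
        define h where "h = q j - k"
        have h: "1 \<le> h" "h \<le> n" "q j = h + k" using False k by (auto simp: h_def)
        have "(F ^^ q j) u = (F ^^ h) p" using h u(2) by (simp add: funpow_add)
        moreover have "(F ^^ q j) u \<in> (*) c ` \<Omega>" using top_returns[OF j] u(1) by blast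
        moreover have "(F ^^ h) p = (inv_into \<Omega> F ^^ (n - h)) (x i)" using inv[of h] h by simp
        moreover have "(n - h, i) \<in> {..m} \<times> {..<d}" using n i by auto
        moreover have "(F ^^ h) p \<in> \<Omega>" using inv by (intro F_iter_in) blast
        ultimately have "(inv_into \<Omega> F ^^ (n - h)) (x i) = 0" using base by (intro small) force+
        then have "(F ^^ (n - h)) 0 = x i" using inv_iter[OF x_in[OF i(2)], of "n - h" "n - h"] by simp
        moreover have "x i \<noteq> 0" using x_less[of 0 i] i x0 by simp
        moreover have "(F ^^ (n - h)) (x 0) \<notin> x ` {1..<d}" if "1 \<le> n - h"
          using keane d that unfolding keane_def by auto
        ultimately show False using i x0 by (cases "n - h = 0") auto
      qed
    qed
  qed
qed

text \<open>The left endpoint of a floor may be an atom of low level, but the difference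
  \<open>r t - r s\<close> only counts atoms in the half-open interval from s, excluded, to t,
  included. Hence \<open>r\<close> varies little on a floor, and so do the limits of its
  values.\<close>

lemma hat_floor_small:
  assumes "0 < \<epsilon>"
  obtains \<delta> where "0 < \<delta>" "\<And>sep c q j k p p'.
     \<lbrakk>tower D sep F \<Omega> I ((*) c ` \<Omega>) (\<lambda>j. (*) c ` I j) q; 0 < c; c < \<delta>; j \<in> D; k < q j;
      p \<in> hat ((F ^^ k) ` (*) c ` I j); p' \<in> hat ((F ^^ k) ` (*) c ` I j)\<rbrakk> \<Longrightarrow> \<bar>p - p'\<bar> \<le> \<epsilon>"
proof -
  have e2: "0 < \<epsilon> / 2" using assms by simp
  obtain m where m: "\<forall>A. (\<forall>n<m. Dplus d x F n \<inter> A = {} \<and> Dminus d x F n \<inter> A = {}) \<longrightarrow> rho d x F A \<le> \<epsilon> / 2"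
    using rho_small[OF e2] by (rule exE)
  obtain \<delta> where \<delta>: "0 < \<delta>" and no: "\<And>sep c q j k n s p.
     \<lbrakk>tower D sep F \<Omega> I ((*) c ` \<Omega>) (\<lambda>j. (*) c ` I j) q; 0 < c; c < \<delta>; j \<in> D; k < q j; n < m;
      s \<in> (F ^^ k) ` (*) c ` I j; p \<in> (F ^^ k) ` (*) c ` I j; s < p; p \<in> Dplus d x F n \<union> Dminus d x F n\<rbrakk> \<Longrightarrow> False"
    by (rule atoms_not_inside_floors[of m]) (rule that)
  show thesis
  proof (rule that[OF \<delta>])
    fix sep c q j k p p'
    assume T: "tower D sep F \<Omega> I ((*) c ` \<Omega>) (\<lambda>j. (*) c ` I j) q" and c: "0 < c" "c < \<delta>" and j: "j \<in> D"
      and k: "k < q j" and p: "p \<in> hat ((F ^^ k) ` (*) c ` I j)" and p': "p' \<in> hat ((F ^^ k) ` (*) c ` I j)"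
    interpret tower D sep F \<Omega> I "(*) c ` \<Omega>" "\<lambda>j. (*) c ` I j" q by fact
    define S where "S = (F ^^ k) ` (*) c ` I j"
    have S\<Omega>: "S \<subseteq> \<Omega>" unfolding S_def by (rule iter_maps[OF J_subset[OF j]])
    obtain \<tau> where \<tau>: "\<And>t. t \<in> (*) c ` I j \<Longrightarrow> (F ^^ k) t = t + \<tau>" using floor_translation[OF T j k] by blast
    have "S = (\<lambda>t. t + \<tau>) ` (*) c ` I j" unfolding S_def using \<tau> by (intro image_cong) auto
    then have S_eq: "S = {c * x (j - 1) + \<tau>..<c * x j + \<tau>}"
      using c(1) by (simp add: exch_interval_def image_mult_Ico)
    have le: "r t - r s \<le> \<epsilon> / 2" if "s \<in> S" "t \<in> S" "s \<le> t" for s t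
    proof -
      have "rho d x F {s<..t} \<le> \<epsilon> / 2"
      proof (rule m[rule_format])
        fix n assume n: "n < m"
        have "a \<notin> {s<..t}" if a: "a \<in> Dplus d x F n \<union> Dminus d x F n" for a
        proof
          assume "a \<in> {s<..t}"
          then have "s < a" "a \<in> S" using \<open>s \<in> S\<close> \<open>t \<in> S\<close> by (auto simp: S_eq)
          then show False using no[OF T c j k n _ _ _ a, of s] \<open>s \<in> S\<close> by (simp add: S_def)
        qed
        then show "Dplus d x F n \<inter> {s<..t} = {} \<and> Dminus d x F n \<inter> {s<..t} = {}" by blast
      qed
      then show ?thesis using r_diff[of s t] that S\<Omega> by auto
    qed
    define s0 where "s0 = c * x (j - 1) + \<tau>"
    have s0: "s0 \<in> S" unfolding S_eq s0_def using c exch_nonempty[OF j] by (auto simp: exch_interval_def)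
    have "r ` S \<subseteq> {r s0..r s0 + \<epsilon> / 2}"
    proof
      fix y assume "y \<in> r ` S"
      then obtain t where t: "t \<in> S" "y = r t" by blast
      then have "s0 \<le> t" by (simp add: S_eq s0_def)
      then show "y \<in> {r s0..r s0 + \<epsilon> / 2}" using le[OF s0 t(1)] t(2) r_mono[of s0 t] S\<Omega> s0 by auto
    qed
    then have "closure (r ` S) \<subseteq> {r s0..r s0 + \<epsilon> / 2}" by (intro closure_minimal) auto
    then have "p \<in> {r s0..r s0 + \<epsilon> / 2}" "p' \<in> {r s0..r s0 + \<epsilon> / 2}" using p p' by (auto simp: hat_def S_def)
    then show "\<bar>p - p'\<bar> \<le> \<epsilon>" using assms by auto
  qed
qed

end


section \<open>Conformal measures on towers\<close>

text \<open>The weight in \<open>m_image\<close> is evaluated at an arbitrary point of the piece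
  instead of being indexed by a label, so that a Birkhoff sum can take the place of the cocycle when
  passing to a return map.\<close>

locale conformal = separation D sep F \<Omega> I
  for D :: "'i set" and sep :: "'a set \<Rightarrow> 'a set \<Rightarrow> bool" and F :: "'a \<Rightarrow> 'a" and \<Omega> :: "'a set" and I :: "'i \<Rightarrow> 'a set" +
  fixes m :: "'a set \<Rightarrow> real" and f :: "'a \<Rightarrow> 'g::ab_group_add" and \<psi> :: "'g \<Rightarrow> real"
  assumes m_nonneg: "0 \<le> m S"
    and m_empty: "m {} = 0"
    and m_Un: "sep S U \<Longrightarrow> m (S \<union> U) = m S + m U"
    and m_image: "i \<in> D \<Longrightarrow> S \<subseteq> I i \<Longrightarrow> t \<in> I i \<Longrightarrow> m (F ` S) = exp (- \<psi> (f t)) * m S"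
    and \<psi>: "Modules.additive \<psi>"
begin

lemma m_UN:
  "finite Z \<Longrightarrow> (\<And>y z. y \<in> Z \<Longrightarrow> z \<in> Z \<Longrightarrow> y \<noteq> z \<Longrightarrow> sep (S y) (S z)) \<Longrightarrow> m (\<Union>z\<in>Z. S z) = (\<Sum>z\<in>Z. m (S z))"
proof (induction Z rule: finite_induct)
  case (insert y Z)
  have "sep (\<Union>z\<in>Z. S z) (S y)" using insert by (intro sep_UN) auto
  then have "m (S y \<union> (\<Union>z\<in>Z. S z)) = m (S y) + m (\<Union>z\<in>Z. S z)" by (rule m_Un[OF sep_sym])
  then show ?case using insert by auto
qed (simp add: m_empty)

lemma m_floor:
  assumes T: "tower D sep F \<Omega> I A J q" and j: "j \<in> D" and S: "S \<subseteq> J j" and t: "t \<in> J j"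
  shows "n \<le> q j \<Longrightarrow> m ((F ^^ n) ` S) = exp (- \<psi> (birkhoff f F n t)) * m S"
proof (induction n)
  case 0
  then show ?case using Modules.additive.zero[OF \<psi>] by (simp add: birkhoff_def)
next
  case (Suc n)
  obtain i where i: "i \<in> D" "(F ^^ n) ` J j \<subseteq> I i" using tower.floor_subset[OF T j, of n] Suc.prems by auto
  have "m ((F ^^ Suc n) ` S) = m (F ` (F ^^ n) ` S)" by (simp add: image_comp)
  also have "\<dots> = exp (- \<psi> (f ((F ^^ n) t))) * m ((F ^^ n) ` S)"
    using i S t by (intro m_image[OF i(1)]) blast+
  also have "\<dots> = exp (- \<psi> (birkhoff f F (Suc n) t)) * m S"
    using Suc Modules.additive.add[OF \<psi>] by (simp add: birkhoff_def exp_add[symmetric])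
  finally show ?case .
qed

lemma conformal_induced:
  assumes ind: "induced D F \<Omega> I A J q R"
    and g: "\<And>j t. j \<in> D \<Longrightarrow> t \<in> J j \<Longrightarrow> birkhoff f F (q j) t = g t"
  shows "conformal D sep R A J m g \<psi>"
proof -
  interpret R: separation D sep R A J by (rule separation_induced[OF separation_axioms ind])
  have T: "tower D sep F \<Omega> I A J q" by (rule inducedD(1)[OF ind separation_axioms])
  show ?thesis
  proof
    show "0 \<le> m S" for S by (rule m_nonneg)
    show "m {} = 0" by (rule m_empty)
    show "m (S \<union> U) = m S + m U" if "sep S U" for S U by (rule m_Un[OF that])
    show "\<psi> (a + b) = \<psi> a + \<psi> b" for a b by (rule Modules.additive.add[OF \<psi>])
    show "m (R ` S) = exp (- \<psi> (g t)) * m S" if "j \<in> D" "S \<subseteq> J j" "t \<in> J j" for j S t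
    proof -
      have "R ` S = (F ^^ q j) ` S" using inducedD(2)[OF ind that(1)] that(2) by (intro image_cong) auto
      then show ?thesis using m_floor[OF T that order_refl] g[OF that(1,3)] by simp
    qed
  qed
qed

text \<open>The measures of the floors contained in one exchanged set add up: this is the transition
  matrix of the tower, weighted by the density of the conformal measure.\<close>

lemma m_tower:
  assumes T: "tower D sep F \<Omega> I A J q" and i: "i \<in> D" and t: "\<And>j. j \<in> D \<Longrightarrow> t j \<in> J j"
  shows "m (I i) = (\<Sum>j\<in>D. (\<Sum>n | n < q j \<and> (F ^^ n) ` J j \<subseteq> I i. exp (- \<psi> (birkhoff f F n (t j)))) * m (J j))"
proof -
  interpret T: tower D sep F \<Omega> I A J q by fact
  define Z where "Z = (SIGMA j:D. {n. n < q j \<and> (F ^^ n) ` J j \<subseteq> I i})"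
  have "I i = (\<Union>(j,n)\<in>Z. (F ^^ n) ` J j)"
  proof
    show "I i \<subseteq> (\<Union>(j,n)\<in>Z. (F ^^ n) ` J j)"
    proof
      fix s assume s: "s \<in> I i"
      then have "s \<in> \<Omega>" using I_subset[OF i] by blast
      then obtain j n where jn: "j \<in> D" "n < q j" "s \<in> (F ^^ n) ` J j" using T.floors_cover by blast
      obtain k where k: "k \<in> D" "(F ^^ n) ` J j \<subseteq> I k" using T.floor_subset[OF jn(1,2)] by blast
      then have "k = i" using I_disjoint[OF k(1) i] s jn(3) by blast
      then have "(j, n) \<in> Z" using jn k by (simp add: Z_def)
      then show "s \<in> (\<Union>(j,n)\<in>Z. (F ^^ n) ` J j)" using jn(3) by blast
    qed
  qed (auto simp: Z_def)
  then have "m (I i) = m (\<Union>z\<in>Z. (F ^^ snd z) ` J (fst z))" by (simp only: case_prod_unfold)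
  also have "\<dots> = (\<Sum>z\<in>Z. m ((F ^^ snd z) ` J (fst z)))"
  proof (rule m_UN)
    show "finite Z" using finite_D by (auto simp: Z_def)
    show "sep ((F ^^ snd y) ` J (fst y)) ((F ^^ snd z) ` J (fst z))" if "y \<in> Z" "z \<in> Z" "y \<noteq> z" for y z
      by (rule T.floors_sep) (use that in \<open>auto simp: Z_def prod_eq_iff\<close>)
  qed
  also have "\<dots> = (\<Sum>j\<in>D. \<Sum>n | n < q j \<and> (F ^^ n) ` J j \<subseteq> I i. m ((F ^^ n) ` J j))"
    using finite_D by (subst sum.Sigma) (auto simp: Z_def case_prod_unfold)
  also have "\<dots> = (\<Sum>j\<in>D. (\<Sum>n | n < q j \<and> (F ^^ n) ` J j \<subseteq> I i. exp (- \<psi> (birkhoff f F n (t j)))) * m (J j))"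
    unfolding sum_distrib_right using m_floor[OF T _ order_refl t] by (intro sum.cong) auto
  finally show ?thesis .
qed

end

text \<open>The set function is conformal for the return map to the small base, which by
  self-similarity is a scaled copy of \<open>F\<close> with a scaled copy of \<open>f\<close>.
  Pulling back by the scaling gives a new set function for the old \<open>F\<close> and
  \<open>f\<close>; this is why the transition matrix is the same at all levels.\<close>

lemma conformal_selfsim:
  assumes c: "conformal D sep F \<Omega> I m f \<psi>" and ss: "selfsim D F \<Omega> I f c q"
  shows "conformal D (\<lambda>S U. sep ((*) c ` S) ((*) c ` U)) F \<Omega> I (\<lambda>S. m ((*) c ` S)) f \<psi>"
proof -
  interpret conformal D sep F \<Omega> I m f \<psi> by fact
  have c0: "0 < c" using ss by (simp add: selfsim_def)
  define R where "R t = c * F (t / c)" for t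
  have ind: "induced D F \<Omega> I ((*) c ` \<Omega>) (\<lambda>j. (*) c ` I j) q R"
    using ss by (simp add: selfsim_def R_def[abs_def])
  interpret R: conformal D sep R "(*) c ` \<Omega>" "\<lambda>j. (*) c ` I j" m "\<lambda>t. f (t / c)" \<psi>
    by (rule conformal_induced[OF ind]) (use ss in \<open>auto simp: selfsim_def\<close>)
  interpret S: separation D "\<lambda>S U. sep ((*) c ` S) ((*) c ` U)" F \<Omega> I
    by (rule separation_conjugate[OF R.separation_axioms]) (use c0 in \<open>auto simp: inj_def R_def\<close>)
  show ?thesis
  proof
    show "m ((*) c ` (S \<union> U)) = m ((*) c ` S) + m ((*) c ` U)" if "sep ((*) c ` S) ((*) c ` U)" for S U
      using m_Un[OF that] by (simp add: image_Un)
    fix i S t assume i: "i \<in> D" "S \<subseteq> I i" "t \<in> I i"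
    have "(*) c ` F ` S = R ` (*) c ` S" using c0 by (simp add: image_image R_def)
    then show "m ((*) c ` F ` S) = exp (- \<psi> (f t)) * m ((*) c ` S)"
      using R.m_image[OF i(1), of "(*) c ` S" "c * t"] i c0 by auto
  qed (auto simp: m_nonneg m_empty Modules.additive.add[OF \<psi>])
qed

section \<open>Integration over slices and functions of compact support\<close>

lemma has_bochner_integral_slice:
  fixes g :: "'a \<Rightarrow> real" and b :: "'g::countable"
  assumes \<nu>: "finite_measure \<nu>" and g: "integrable \<nu> g"
  shows "has_bochner_integral (\<nu> \<Otimes>\<^sub>M count_space UNIV) (\<lambda>z. g (fst z) * indicator {b} (snd z)) (\<integral>p. g p \<partial>\<nu>)"
proof -
  interpret finite_measure \<nu> by fact
  interpret C: sigma_finite_measure "count_space (UNIV :: 'g set)"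
    by (rule sigma_finite_measure_count_space)
  interpret pair_sigma_finite \<nu> "count_space (UNIV :: 'g set)" ..
  have gm[measurable]: "g \<in> borel_measurable \<nu>" using g by simp
  have int1: "integrable (count_space (UNIV::'g set)) (indicator {b} :: 'g \<Rightarrow> real)"
    by (simp add: integrable_indicator_iff)
  have int: "integrable (\<nu> \<Otimes>\<^sub>M count_space UNIV) (\<lambda>z. g (fst z) * indicator {b} (snd z))"
  proof (rule Fubini_integrable)
    show "integrable \<nu> (\<lambda>p. \<integral>a. norm (g (fst (p, a)) * indicator {b} (snd (p, a))) \<partial>count_space UNIV)"
      using g by (simp add: abs_mult)
    show "AE p in \<nu>. integrable (count_space UNIV) (\<lambda>a. g (fst (p, a)) * indicator {b} (snd (p, a)))"
      using int1 by simp
  qed measurable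
  have "(\<integral>z. g (fst z) * indicator {b} (snd z) \<partial>(\<nu> \<Otimes>\<^sub>M count_space UNIV)) = (\<integral>p. g p \<partial>\<nu>)"
    by (subst integral_fst'[OF int, symmetric]) simp
  then show ?thesis using int by (simp add: has_bochner_integral_iff)
qed

lemma finite_if_compact_int_vec:
  fixes S :: "(int ^ 'm) set"
  assumes "compact S"
  shows "finite S"
proof -
  have op: "open {a}" for a :: "int ^ 'm"
  proof -
    have "{a} = (\<Inter>i\<in>UNIV. (\<lambda>v. v $ i) -` {a $ i})" by (auto simp: vec_eq_iff)
    also have "open \<dots>" by (intro open_INT ballI open_vimage open_discrete continuous_intros) simp
    finally show ?thesis .
  qed
  obtain T where T: "T \<subseteq> (\<lambda>a. {a}) ` S" "finite T" "S \<subseteq> \<Union>T"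
    using compactE[OF assms, of "(\<lambda>a. {a}) ` S"] op by (auto simp: subset_iff)
  have "finite (\<Union>T)" using T by (intro finite_Union) auto
  then show ?thesis using T(3) finite_subset by blast
qed

text \<open>A Lebesgue number for a cover of the support handles all pairs with at least one point
  in \<open>C\<close>; for the other pairs both values are 0.\<close>

lemma uniformly_continuous_compact_support:
  fixes g :: "'a::metric_space \<Rightarrow> real"
  assumes g: "continuous_on K g" and C: "compact C" "C \<subseteq> K" "\<And>p. p \<in> K - C \<Longrightarrow> g p = 0" and e: "0 < \<epsilon>"
  obtains \<delta> where "0 < \<delta>" "\<And>p p'. p \<in> K \<Longrightarrow> p' \<in> K \<Longrightarrow> dist p p' < \<delta> \<Longrightarrow> \<bar>g p - g p'\<bar> < \<epsilon>"
proof -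
  define G where "G = {U. open U \<and> (\<forall>a\<in>U \<inter> K. \<forall>b\<in>U \<inter> K. \<bar>g a - g b\<bar> < \<epsilon>)}"
  have cover: "C \<subseteq> \<Union>G"
  proof
    fix p assume "p \<in> C"
    then have "p \<in> K" using C by blast
    then obtain \<delta> where \<delta>: "0 < \<delta>" "\<And>a. a \<in> K \<Longrightarrow> dist a p < \<delta> \<Longrightarrow> dist (g a) (g p) < \<epsilon> / 2"
      using g e unfolding continuous_on_iff by (meson half_gt_zero)
    have "ball p \<delta> \<in> G" unfolding G_def
    proof (intro CollectI conjI ballI open_ball)
      fix a b assume "a \<in> ball p \<delta> \<inter> K" "b \<in> ball p \<delta> \<inter> K"
      then have "dist (g a) (g p) < \<epsilon> / 2" "dist (g b) (g p) < \<epsilon> / 2"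
        by (intro \<delta>(2); simp add: dist_commute)+
      then show "\<bar>g a - g b\<bar> < \<epsilon>" unfolding dist_real_def by linarith
    qed
    then show "p \<in> \<Union>G" using \<delta>(1) by (intro UnionI[of "ball p \<delta>"]) auto
  qed
  have opG: "open U" if "U \<in> G" for U using that by (simp add: G_def)
  obtain \<delta> where \<delta>: "0 < \<delta>" "\<forall>p\<in>C. \<exists>U\<in>G. ball p \<delta> \<subseteq> U"
    using Heine_Borel_lemma[OF C(1) cover opG] by metis
  have near: "\<bar>g p - g p'\<bar> < \<epsilon>" if "p \<in> C" "p' \<in> K" "dist p p' < \<delta>" for p p'
  proof -
    have "\<exists>U\<in>G. ball p \<delta> \<subseteq> U" using \<delta>(2) that(1) by (rule bspec)
    then obtain U where U: "U \<in> G" "ball p \<delta> \<subseteq> U" by blast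
    have "p \<in> ball p \<delta>" "p' \<in> ball p \<delta>" using that(3) \<delta>(1) by simp_all
    then have "p \<in> U" "p' \<in> U" using U(2) by blast+
    moreover have "p \<in> K" using that(1) C(2) by blast
    ultimately show ?thesis using U(1) that(2) by (simp add: G_def)
  qed
  show thesis
  proof (rule that[OF \<delta>(1)])
    fix p p' assume p: "p \<in> K" "p' \<in> K" "dist p p' < \<delta>"
    consider "p \<in> C" | "p' \<in> C" | "p \<notin> C" "p' \<notin> C" by blast
    then show "\<bar>g p - g p'\<bar> < \<epsilon>"
    proof cases
      case 1
      then show ?thesis using near p by blast
    next
      case 2
      then show ?thesis using near[of p' p] p by (simp add: dist_commute abs_minus_commute)
    next
      case 3
      then show ?thesis using C(3) p e by simp
    qed
  qed
qed

section \<open>Conformal measures as set functions, and Riemann sums over floors\<close>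

context iet_setting
begin

lemma exch_cocycle:
  assumes "i \<in> D" "t \<in> I i"
  shows "cocycle_I d x \<phi> t = \<phi> i"
proof -
  have "(THE k. k \<in> D \<and> t \<in> I k) = i"
    by (rule the_equality) (use assms exch_disjoint in blast)+
  then show ?thesis by (simp add: cocycle_I_def)
qed

context
  fixes T :: "real \<Rightarrow> real" and \<phi> :: "nat \<Rightarrow> 'g::ab_group_add" and \<psi> :: "'g \<Rightarrow> real" and \<nu> :: "real measure"
  assumes T: "continuous_extension d x F T" and \<nu>: "conformal_measure d x F T \<phi> \<psi> \<nu>"
begin

lemma space_nu: "space \<nu> = K"
proof -
  have "sets \<nu> = sets (restrict_space borel K)" using \<nu> by (simp add: conformal_measure_def)
  from sets_eq_imp_space_eq[OF this] show ?thesis by (simp add: space_restrict_space)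
qed

lemma hat_sets: "hat S \<in> sets \<nu>"
proof -
  have "sets \<nu> = sets (restrict_space borel K)" using \<nu> by (simp add: conformal_measure_def)
  then show ?thesis by (auto simp: hat_def sets_restrict_space)
qed

lemma finite_nu: "finite_measure \<nu>"
  using \<nu> by (simp add: conformal_measure_def)

text \<open>For \<open>S\<close> inside one exchanged interval, \<open>hat S\<close> lies in one
  piece of \<open>K\<close>, where the Radon--Nikodym derivative is constant; integrating it is a
  multiplication.\<close>

lemma conformal_hat:
  assumes \<psi>: "Modules.additive \<psi>"
  shows "conformal D (\<lambda>S U. hat S \<inter> hat U = {}) F \<Omega> I (\<lambda>S. measure \<nu> (hat S)) (cocycle_I d x \<phi>) \<psi>"
proof -
  interpret separation D "\<lambda>S U. hat S \<inter> hat U = {}" F \<Omega> I by (rule separation_hat[OF T])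
  interpret finite_measure \<nu> by (rule finite_nu)
  show ?thesis
  proof
    show "measure \<nu> (hat (S \<union> U)) = measure \<nu> (hat S) + measure \<nu> (hat U)" if "hat S \<inter> hat U = {}" for S U
      unfolding hat_Un by (rule finite_measure_Union[OF hat_sets hat_sets that])
    fix i S t assume i: "i \<in> D" and S: "S \<subseteq> I i" and t: "t \<in> I i"
    let ?e = "exp (- \<psi> (\<phi> i))"
    have "emeasure \<nu> (hat (F ` S)) = (\<integral>\<^sup>+p\<in>hat S. ennreal (exp (- \<psi> (cocycle_K d x F \<phi> p))) \<partial>\<nu>)"
    proof -
      have "T ` hat S = hat (F ` S)" using S I_subset[OF i] by (intro hat_image[OF T]) blast
      moreover have "emeasure \<nu> (T ` hat S) = (\<integral>\<^sup>+p\<in>hat S. ennreal (exp (- \<psi> (cocycle_K d x F \<phi> p))) \<partial>\<nu>)"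
        using \<nu> hat_sets[of S] unfolding conformal_measure_def by blast
      ultimately show ?thesis by simp
    qed
    also have "\<dots> = (\<integral>\<^sup>+p. ennreal ?e * indicator (hat S) p \<partial>\<nu>)"
    proof -
      have "cocycle_K d x F \<phi> p = \<phi> i" if "p \<in> hat S" for p
        using hat_mono[OF S] that by (intro cocycle_K_eq[OF i]) blast
      then show ?thesis by (intro nn_integral_cong) (auto simp: indicator_def)
    qed
    also have "\<dots> = ennreal ?e * emeasure \<nu> (hat S)"
      using hat_sets by (rule nn_integral_cmult_indicator)
    finally show "measure \<nu> (hat (F ` S)) = exp (- \<psi> (cocycle_I d x \<phi> t)) * measure \<nu> (hat S)"
      by (simp add: measure_def enn2real_mult exch_cocycle[OF i t])
  qed (auto simp: hat_empty Modules.additive.add[OF \<psi>])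
qed

text \<open>The closures of the floors partition \<open>K\<close>, so the sum is the integral of a
  step function within \<open>\<epsilon>\<close> of \<open>g\<close>. Integrability comes out at the
  same time, \<open>g\<close> being a bounded measurable perturbation of that step function.\<close>

lemma integral_step_approx:
  assumes tow: "tower D (\<lambda>S U. hat S \<inter> hat U = {}) F \<Omega> I A J q"
    and g: "continuous_on K g"
    and close: "\<And>j n p p'. j \<in> D \<Longrightarrow> n < q j \<Longrightarrow> p \<in> hat ((F ^^ n) ` J j) \<Longrightarrow> p' \<in> hat ((F ^^ n) ` J j) \<Longrightarrow> \<bar>g p - g p'\<bar> \<le> \<epsilon>"
    and pt: "\<And>j n. j \<in> D \<Longrightarrow> n < q j \<Longrightarrow> hat ((F ^^ n) ` J j) \<noteq> {} \<Longrightarrow> pt j n \<in> hat ((F ^^ n) ` J j)"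
  shows "integrable \<nu> g"
    and "\<bar>(\<integral>p. g p \<partial>\<nu>) - (\<Sum>j\<in>D. \<Sum>n<q j. g (pt j n) * measure \<nu> (hat ((F ^^ n) ` J j)))\<bar> \<le> \<epsilon> * measure \<nu> K"
proof -
  interpret tower D "\<lambda>S U. hat S \<inter> hat U = {}" F \<Omega> I A J q by fact
  interpret finite_measure \<nu> by (rule finite_nu)
  have hat_Int_K: "hat S \<inter> K = hat S" for S by (auto simp: hat_def)
  define Z where "Z = (SIGMA j:D. {..<q j})"
  define E where "E z = hat ((F ^^ snd z) ` J (fst z))" for z
  define s where "s p = (\<Sum>z\<in>Z. g (pt (fst z) (snd z)) * indicator (E z) p)" for p
  have finZ: "finite Z" using finite_D by (auto simp: Z_def)
  have disj: "E y \<inter> E z = {}" if "y \<in> Z" "z \<in> Z" "y \<noteq> z" for y z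
    unfolding E_def using that by (intro floors_sep) (auto simp: Z_def prod_eq_iff)
  have hat_UN: "hat (\<Union>z\<in>Z. S z) \<subseteq> (\<Union>z\<in>Z. hat (S z))" for S :: "nat \<times> nat \<Rightarrow> real set"
    using finZ by (induction Z rule: finite_induct) (auto simp: hat_empty hat_Un)
  have "\<Omega> \<subseteq> (\<Union>z\<in>Z. (F ^^ snd z) ` J (fst z))" using floors_cover by (fastforce simp: Z_def)
  then have "K \<subseteq> hat (\<Union>z\<in>Z. (F ^^ snd z) ` J (fst z))" unfolding hat_Omega[symmetric] by (rule hat_mono)
  also have "\<dots> \<subseteq> (\<Union>z\<in>Z. E z)" unfolding E_def by (rule hat_UN)
  finally have cover: "K \<subseteq> (\<Union>z\<in>Z. E z)" .
  have near: "\<bar>g p - s p\<bar> \<le> \<epsilon>" if p: "p \<in> K" for p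
  proof -
    obtain z where z: "z \<in> Z" "p \<in> E z" using cover p by blast
    have "s p = (\<Sum>y\<in>{z}. g (pt (fst y) (snd y)) * indicator (E y) p)"
      unfolding s_def using finZ z disj[OF z(1)]
      by (intro sum.mono_neutral_right) (auto simp: indicator_def)
    then have "s p = g (pt (fst z) (snd z))" using z by simp
    moreover have jn: "fst z \<in> D" "snd z < q (fst z)" using z(1) by (auto simp: Z_def)
    moreover have "pt (fst z) (snd z) \<in> E z"
      unfolding E_def using z(2) by (intro pt[OF jn]) (auto simp: E_def)
    ultimately show ?thesis using close[OF jn] z(2) by (simp add: E_def)
  qed
  have s_int: "integrable \<nu> s" unfolding s_def
    by (intro Bochner_Integration.integrable_sum integrable_mult_right integrable_real_indicator)
      (auto simp: E_def hat_sets emeasure_finite less_top[symmetric])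
  have "g \<in> borel_measurable (restrict_space borel K)" by (rule borel_measurable_continuous_on_restrict[OF g])
  moreover have "sets \<nu> = sets (restrict_space borel K)" using \<nu> by (simp add: conformal_measure_def)
  ultimately have gm: "g \<in> borel_measurable \<nu>" by (simp cong: measurable_cong_sets)
  have diff_int: "integrable \<nu> (\<lambda>p. g p - s p)"
    using near gm s_int by (intro integrable_const_bound[where B = \<epsilon>]) (auto simp: space_nu)
  have "integrable \<nu> (\<lambda>p. (g p - s p) + s p)" by (rule Bochner_Integration.integrable_add[OF diff_int s_int])
  then show g_int: "integrable \<nu> g" by simp
  have "(\<integral>p. s p \<partial>\<nu>) = (\<Sum>z\<in>Z. g (pt (fst z) (snd z)) * measure \<nu> (E z))"
    unfolding s_def using hat_sets
    by (subst Bochner_Integration.integral_sum)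
       (auto simp: E_def emeasure_finite less_top[symmetric] space_nu hat_Int_K intro!: sum.cong)
  also have "\<dots> = (\<Sum>j\<in>D. \<Sum>n<q j. g (pt j n) * measure \<nu> (hat ((F ^^ n) ` J j)))"
    using finite_D by (subst sum.Sigma) (auto simp: Z_def E_def case_prod_unfold)
  finally have s_eq: "(\<integral>p. s p \<partial>\<nu>) = (\<Sum>j\<in>D. \<Sum>n<q j. g (pt j n) * measure \<nu> (hat ((F ^^ n) ` J j)))" .
  have "\<bar>(\<integral>p. g p \<partial>\<nu>) - (\<integral>p. s p \<partial>\<nu>)\<bar> = \<bar>\<integral>p. g p - s p \<partial>\<nu>\<bar>"
    using g_int s_int by simp
  also have "\<dots> \<le> (\<integral>p. \<bar>g p - s p\<bar> \<partial>\<nu>)" by (rule integral_abs_bound)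
  also have "\<dots> \<le> (\<integral>p. \<epsilon> \<partial>\<nu>)" using near diff_int by (intro integral_mono) (auto simp: space_nu)
  also have "\<dots> = \<epsilon> * measure \<nu> K" by (simp add: space_nu)
  finally show "\<bar>(\<integral>p. g p \<partial>\<nu>) - (\<Sum>j\<in>D. \<Sum>n<q j. g (pt j n) * measure \<nu> (hat ((F ^^ n) ` J j)))\<bar> \<le> \<epsilon> * measure \<nu> K"
    by (simp only: s_eq)
qed

end

end

lemma (in iet_setting) continuous_integral_conformal:
  fixes \<phi> :: "nat \<Rightarrow> 'g::ab_group_add" and \<nu> :: "('g \<Rightarrow> real) \<Rightarrow> real measure" and g :: "real \<Rightarrow> real"
  assumes T: "continuous_extension d x F T" and per: "periodic_type d x F \<phi>"
    and ic: "infinitely_complete d x F"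
    and \<nu>: "\<And>\<psi>. \<psi> \<in> Hom_real \<Longrightarrow> conformal_measure d x F T \<phi> \<psi> (\<nu> \<psi>)"
    and norm: "\<And>\<psi>. \<psi> \<in> Hom_real \<Longrightarrow> measure (\<nu> \<psi>) K = 1"
    and g: "continuous_on K g" and C: "compact C" "C \<subseteq> K" "\<And>p. p \<in> K - C \<Longrightarrow> g p = 0"
  shows "(\<forall>\<psi>\<in>Hom_real. integrable (\<nu> \<psi>) g) \<and> continuous_on Hom_real (\<lambda>\<psi>. \<integral>p. g p \<partial>\<nu> \<psi>)"
proof -
  define f where "f = cocycle_I d x \<phi>"
  obtain c q where ss': "selfsim D F \<Omega> I (cocycle_I d x \<phi>) c q"
    and vis: "\<And>i j. i \<in> D \<Longrightarrow> j \<in> D \<Longrightarrow> \<exists>l<q j. (F ^^ l) ` (*) c ` I j \<subseteq> I i"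
    by (rule selfsim_positive[OF per ic]) (rule that)
  have ss: "selfsim D F \<Omega> I f c q" using ss' by (simp add: f_def)
  have c: "0 < c" "c < 1" using ss by (auto simp: selfsim_def)
  obtain Q where Q: "\<And>k. selfsim D F \<Omega> I f (c ^ Suc k) (Q k)"
    using selfsim_power[OF separation_disj ss] by metis
  have tow: "tower D sep F \<Omega> I ((*) (c ^ Suc k) ` \<Omega>) (\<lambda>j. (*) (c ^ Suc k) ` I j) (Q k)"
    if "separation D sep F \<Omega> I" for sep k
    using Q[of k] that unfolding selfsim_def by (blast intro: inducedD(1))
  define m where "m \<psi> S = measure (\<nu> \<psi>) (hat S)" for \<psi> S
  define y where "y j = x (j - 1)" for j
  have y: "y j \<in> I j" if "j \<in> D" for j unfolding y_def by (rule exch_nonempty[OF that])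
  \<comment> \<open>\<open>M\<close> depends on \<open>\<psi>\<close> only through its values at
    finitely many group elements, so it is continuous for pointwise convergence.\<close>
  define M where "M \<psi> i j = (\<Sum>n | n < q j \<and> (F ^^ n) ` (*) c ` I j \<subseteq> I i. exp (- \<psi> (birkhoff f F n (c * y j))))"
    for \<psi> :: "'g \<Rightarrow> real" and i j
  define V where "V \<psi> k i = m \<psi> ((*) (c ^ k) ` I i)" for \<psi> k i
  have add: "Modules.additive \<psi>" if "\<psi> \<in> Hom_real" for \<psi> :: "'g \<Rightarrow> real"
    using that by (simp add: Hom_real_def)
  have conf0: "conformal D (\<lambda>S U. hat S \<inter> hat U = {}) F \<Omega> I (m \<psi>) f \<psi>" if "\<psi> \<in> Hom_real" for \<psi>
    unfolding m_def[abs_def] f_def by (rule conformal_hat[OF T \<nu>[OF that] add[OF that]])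
  have conf: "\<exists>sep. conformal D sep F \<Omega> I (\<lambda>S. m \<psi> ((*) (c ^ k) ` S)) f \<psi>" if "\<psi> \<in> Hom_real" for \<psi> k
  proof (cases k)
    case 0
    have "(*) (c ^ k) = id" using 0 by (simp add: fun_eq_iff)
    then show ?thesis using conf0[OF that] by auto
  next
    case (Suc n)
    then show ?thesis using conformal_selfsim[OF conf0[OF that] Q[of n]] by blast
  qed
  \<comment> \<open>The tower of ratio \<open>c\<close> is applied to the set function rescaled by
    \<open>c ^ k\<close>. The weights involve only \<open>f\<close> and \<open>\<psi>\<close>, so
    \<open>k\<close> does not enter the matrix.\<close>
  have rec: "V \<psi> k i = (\<Sum>j\<in>D. M \<psi> i j * V \<psi> (Suc k) j)" if hom: "\<psi> \<in> Hom_real" and i: "i \<in> D" for \<psi> k i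
  proof -
    obtain sep where s: "conformal D sep F \<Omega> I (\<lambda>S. m \<psi> ((*) (c ^ k) ` S)) f \<psi>" using conf[OF hom] by blast
    have "separation D sep F \<Omega> I" using s by (simp add: conformal_def)
    then have t: "tower D sep F \<Omega> I ((*) c ` \<Omega>) (\<lambda>j. (*) c ` I j) q"
      using ss unfolding selfsim_def by (blast intro: inducedD(1))
    have "V \<psi> k i = (\<Sum>j\<in>D. M \<psi> i j * m \<psi> ((*) (c ^ k) ` (*) c ` I j))"
      unfolding V_def M_def using conformal.m_tower[OF s t i, of "\<lambda>j. c * y j"] y by blast
    then show ?thesis by (simp add: V_def image_image mult.assoc mult.left_commute)
  qed
  have eval: "continuous_on Hom_real (\<lambda>\<psi>. \<psi> a)" for a :: 'g
    by (rule continuous_on_product_then_coordinatewise[OF continuous_on_id])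
  have Vcont: "continuous_on Hom_real (\<lambda>\<psi>. V \<psi> k i)" if i: "i \<in> D" for k i
  proof (rule continuous_on_backward_orbit[where D = D and M = M and i = i])
    show "finite D" "D \<noteq> {}" "i \<in> D" using i by auto
    show "0 < M \<psi> i j" if "i \<in> D" "j \<in> D" for \<psi> i j
      unfolding M_def using vis[OF that] by (intro sum_pos) auto
    show "continuous_on Hom_real (\<lambda>\<psi>. M \<psi> i j)" for i j
      unfolding M_def by (intro continuous_intros eval)
    show "0 \<le> V \<psi> k i" for \<psi> k i by (simp add: V_def m_def)
    show "V \<psi> k i = (\<Sum>j\<in>D. M \<psi> i j * V \<psi> (Suc k) j)" if "\<psi> \<in> Hom_real" "i \<in> D" for \<psi> k i
      by (rule rec[OF that])
    fix \<psi> :: "'g \<Rightarrow> real" assume hom: "\<psi> \<in> Hom_real"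
    interpret conformal D "\<lambda>S U. hat S \<inter> hat U = {}" F \<Omega> I "m \<psi>" f \<psi> by (rule conf0[OF hom])
    have "(*) (1::real) = id" by (simp add: fun_eq_iff)
    then have "(\<Sum>i\<in>D. V \<psi> 0 i) = (\<Sum>i\<in>D. m \<psi> (I i))" by (simp add: V_def)
    also have "\<dots> = m \<psi> (\<Union>i\<in>D. I i)" by (rule m_UN[symmetric, OF finite_D sep_I])
    also have "\<dots> = 1" unfolding union_exch m_def hat_Omega by (rule norm[OF hom])
    finally show "(\<Sum>i\<in>D. V \<psi> 0 i) = 1" .
  qed
  define E where "E k j n = (F ^^ n) ` (*) (c ^ Suc k) ` I j" for k j n
  \<comment> \<open>If the set is empty the value is arbitrary; its weight in \<open>A\<close> is
    then 0.\<close>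
  define pt where "pt k j n = (SOME p. p \<in> hat (E k j n))" for k j n
  define A where "A k \<psi> = (\<Sum>j\<in>D. \<Sum>n<Q k j. g (pt k j n) * m \<psi> (E k j n))" for k \<psi>
  have Acont: "continuous_on Hom_real (A k)" for k
  proof -
    have E: "m \<psi> (E k j n) = exp (- \<psi> (birkhoff f F n (c ^ Suc k * y j))) * V \<psi> (Suc k) j"
      if hom: "\<psi> \<in> Hom_real" and j: "j \<in> D" and n: "n < Q k j" for \<psi> j n
    proof -
      interpret conformal D "\<lambda>S U. hat S \<inter> hat U = {}" F \<Omega> I "m \<psi>" f \<psi> by (rule conf0[OF hom])
      show ?thesis unfolding E_def V_def
        using n y[OF j] by (intro m_floor[OF tow[OF separation_axioms] j order_refl]) auto
    qed
    have "continuous_on Hom_real (\<lambda>\<psi>. m \<psi> (E k j n))" if "j \<in> D" "n < Q k j" for j n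
    proof -
      have "continuous_on Hom_real (\<lambda>\<psi>. exp (- \<psi> (birkhoff f F n (c ^ Suc k * y j))) * V \<psi> (Suc k) j)"
        using that by (intro continuous_intros eval Vcont)
      then show ?thesis using E that by (simp cong: continuous_on_cong)
    qed
    then show ?thesis unfolding A_def[abs_def] by (intro continuous_intros) auto
  qed
  \<comment> \<open>\<open>k0\<close> comes from the modulus of continuity of \<open>g\<close> and
    the mesh of the floors, neither of which involves \<open>\<psi>\<close>, and the total mass is 1
    for every \<open>\<psi>\<close>. So the approximation is uniform.\<close>
  have approx: "\<exists>k0. \<forall>k\<ge>k0. \<forall>\<psi>\<in>Hom_real. integrable (\<nu> \<psi>) g \<and> \<bar>(\<integral>p. g p \<partial>\<nu> \<psi>) - A k \<psi>\<bar> \<le> \<epsilon>"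
    if \<epsilon>: "0 < \<epsilon>" for \<epsilon>
  proof -
    obtain \<delta> where \<delta>: "0 < \<delta>" "\<And>p p'. p \<in> K \<Longrightarrow> p' \<in> K \<Longrightarrow> dist p p' < \<delta> \<Longrightarrow> \<bar>g p - g p'\<bar> < \<epsilon>"
      by (rule uniformly_continuous_compact_support[OF g C \<epsilon>]) (assumption, rule that)
    have "0 < \<delta> / 2" using \<delta> by simp
    then obtain \<eta> where \<eta>: "0 < \<eta>" and small: "\<And>sep c q j k p p'.
       \<lbrakk>tower D sep F \<Omega> I ((*) c ` \<Omega>) (\<lambda>j. (*) c ` I j) q; 0 < c; c < \<eta>; j \<in> D; k < q j;
        p \<in> hat ((F ^^ k) ` (*) c ` I j); p' \<in> hat ((F ^^ k) ` (*) c ` I j)\<rbrakk> \<Longrightarrow> \<bar>p - p'\<bar> \<le> \<delta> / 2"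
      by (rule hat_floor_small) (rule that)
    obtain k0 where k0: "c ^ k0 < \<eta>" using real_arch_pow_inv[OF \<eta> c(2)] by blast
    show ?thesis
    proof (intro exI[of _ k0] allI impI ballI)
      fix k and \<psi> :: "'g \<Rightarrow> real" assume k: "k0 \<le> k" and hom: "\<psi> \<in> Hom_real"
      have "c ^ Suc k \<le> c ^ k0" using c k by (intro power_decreasing) auto
      then have ck: "c ^ Suc k < \<eta>" using k0 by simp
      have cp: "0 < c ^ Suc k" using c by simp
      have t: "tower D (\<lambda>S U. hat S \<inter> hat U = {}) F \<Omega> I ((*) (c ^ Suc k) ` \<Omega>) (\<lambda>j. (*) (c ^ Suc k) ` I j) (Q k)"
        by (rule tow[OF separation_hat[OF T]])
      have close: "\<bar>g p - g p'\<bar> \<le> \<epsilon>" if j: "j \<in> D" "n < Q k j"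
        and p: "p \<in> hat ((F ^^ n) ` (*) (c ^ Suc k) ` I j)" "p' \<in> hat ((F ^^ n) ` (*) (c ^ Suc k) ` I j)" for j n p p'
      proof -
        have "\<bar>p - p'\<bar> \<le> \<delta> / 2" by (rule small[OF t cp ck j p])
        then have "dist p p' < \<delta>" using \<delta>(1) by (simp add: dist_real_def)
        moreover have "p \<in> K" "p' \<in> K" using p by (auto simp: hat_def)
        ultimately show ?thesis using \<delta>(2)[of p p'] by simp
      qed
      have pt: "pt k j n \<in> hat ((F ^^ n) ` (*) (c ^ Suc k) ` I j)"
        if "hat ((F ^^ n) ` (*) (c ^ Suc k) ` I j) \<noteq> {}" for j n
        using that unfolding pt_def E_def some_in_eq .
      have "integrable (\<nu> \<psi>) g"
        by (rule integral_step_approx(1)[OF T \<nu>[OF hom] t g, where pt = "pt k"])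
          (rule close pt; assumption)+
      moreover have "\<bar>(\<integral>p. g p \<partial>\<nu> \<psi>) - A k \<psi>\<bar> \<le> \<epsilon> * measure (\<nu> \<psi>) K"
        unfolding A_def m_def E_def
        by (rule integral_step_approx(2)[OF T \<nu>[OF hom] t g, where pt = "pt k"])
          (rule close pt; assumption)+
      ultimately show "integrable (\<nu> \<psi>) g \<and> \<bar>(\<integral>p. g p \<partial>\<nu> \<psi>) - A k \<psi>\<bar> \<le> \<epsilon>"
        using norm[OF hom] by simp
    qed
  qed
  have "uniform_limit Hom_real A (\<lambda>\<psi>. \<integral>p. g p \<partial>\<nu> \<psi>) sequentially"
  proof (rule uniform_limitI)
    fix \<epsilon> :: real assume "0 < \<epsilon>"
    then obtain k0 where k0: "\<forall>k\<ge>k0. \<forall>\<psi>\<in>Hom_real. integrable (\<nu> \<psi>) g \<and> \<bar>(\<integral>p. g p \<partial>\<nu> \<psi>) - A k \<psi>\<bar> \<le> \<epsilon> / 2"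
      using approx[of "\<epsilon> / 2"] by auto
    have "dist (A k \<psi>) (\<integral>p. g p \<partial>\<nu> \<psi>) < \<epsilon>" if "k0 \<le> k" "\<psi> \<in> Hom_real" for k \<psi>
    proof -
      have "\<bar>(\<integral>p. g p \<partial>\<nu> \<psi>) - A k \<psi>\<bar> \<le> \<epsilon> / 2" using k0 that by blast
      then show ?thesis using \<open>0 < \<epsilon>\<close> unfolding dist_real_def by linarith
    qed
    then show "\<forall>\<^sub>F k in sequentially. \<forall>\<psi>\<in>Hom_real. dist (A k \<psi>) (\<integral>p. g p \<partial>\<nu> \<psi>) < \<epsilon>"
      unfolding eventually_sequentially by blast
  qed
  then have "continuous_on Hom_real (\<lambda>\<psi>. \<integral>p. g p \<partial>\<nu> \<psi>)"
    by (intro uniform_limit_theorem[where f = A and F = sequentially]) (simp_all add: Acont)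
  moreover have "\<forall>\<psi>\<in>Hom_real. integrable (\<nu> \<psi>) g" using approx[of 1] by auto
  ultimately show ?thesis by blast
qed

section \<open>From conformal measures to Maharam measures\<close>

text \<open>The density is 1 on the slice over 0 because \<open>\<psi> 0 = 0\<close>; thus the
  normalisation of the Maharam measure is that of the conformal measure.\<close>

lemma emeasure_density_slice_0:
  fixes \<nu> :: "real measure" and \<psi> :: "'g::{countable,ab_group_add} \<Rightarrow> real"
  assumes \<nu>: "finite_measure \<nu>" and \<psi>: "Modules.additive \<psi>"
  shows "emeasure (density (\<nu> \<Otimes>\<^sub>M count_space UNIV) (\<lambda>(p, a). ennreal (exp (\<psi> a)))) (space \<nu> \<times> {0}) = emeasure \<nu> (space \<nu>)"
proof -
  interpret finite_measure \<nu> by fact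
  interpret C: sigma_finite_measure "count_space (UNIV :: 'g set)" by (rule sigma_finite_measure_count_space)
  have S: "space \<nu> \<times> {0} \<in> sets (\<nu> \<Otimes>\<^sub>M count_space (UNIV :: 'g set))" by (intro pair_measureI) auto
  have "emeasure (density (\<nu> \<Otimes>\<^sub>M count_space UNIV) (\<lambda>(p, a). ennreal (exp (\<psi> a)))) (space \<nu> \<times> {0})
      = (\<integral>\<^sup>+z. (case z of (p, a) \<Rightarrow> ennreal (exp (\<psi> a))) * indicator (space \<nu> \<times> {0}) z \<partial>(\<nu> \<Otimes>\<^sub>M count_space UNIV))"
    by (rule emeasure_density[OF _ S]) measurable
  also have "\<dots> = (\<integral>\<^sup>+z. indicator (space \<nu> \<times> {0}) z \<partial>(\<nu> \<Otimes>\<^sub>M count_space (UNIV :: 'g set)))"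
    using Modules.additive.zero[OF \<psi>] by (intro nn_integral_cong) (auto simp: indicator_def)
  also have "\<dots> = emeasure (\<nu> \<Otimes>\<^sub>M count_space (UNIV :: 'g set)) (space \<nu> \<times> {0})" using S by simp
  also have "\<dots> = emeasure \<nu> (space \<nu>)" by (subst C.emeasure_pair_measure_Times) auto
  finally show ?thesis .
qed

lemma integral_maharam:
  fixes \<nu> :: "real measure" and \<psi> :: "'g::countable \<Rightarrow> real" and h :: "real \<times> 'g \<Rightarrow> real"
  assumes \<nu>: "finite_measure \<nu>" and B: "finite B"
    and h: "\<And>p a. p \<in> space \<nu> \<Longrightarrow> a \<notin> B \<Longrightarrow> h (p, a) = 0"
    and int: "\<And>a. a \<in> B \<Longrightarrow> integrable \<nu> (\<lambda>p. h (p, a))"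
  shows "(\<integral>z. h z \<partial>density (\<nu> \<Otimes>\<^sub>M count_space UNIV) (\<lambda>(p, a). ennreal (exp (\<psi> a)))) =
     (\<Sum>a\<in>B. exp (\<psi> a) * (\<integral>p. h (p, a) \<partial>\<nu>))"
proof -
  let ?P = "\<nu> \<Otimes>\<^sub>M count_space (UNIV :: 'g set)"
  \<comment> \<open>\<open>k\<close> agrees with \<open>h\<close> on the whole space and makes
    measurability on the product a matter of single slices.\<close>
  define k where "k z = (\<Sum>a\<in>B. h (fst z, a) * indicator {a} (snd z))" for z
  have slice: "has_bochner_integral ?P (\<lambda>z. (exp (\<psi> a) * h (fst z, a)) * indicator {a} (snd z)) (exp (\<psi> a) * (\<integral>p. h (p, a) \<partial>\<nu>))"
    if "a \<in> B" for a
    using has_bochner_integral_slice[OF \<nu> integrable_mult_right[OF int[OF that]], of "exp (\<psi> a)" a] int[OF that] by simp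
  have hm[measurable]: "(\<lambda>p. h (p, a)) \<in> borel_measurable \<nu>" if "a \<in> B" for a using int[OF that] by simp
  have km: "k \<in> borel_measurable ?P" unfolding k_def
  proof (intro borel_measurable_sum borel_measurable_times)
    fix a assume "a \<in> B"
    then show "(\<lambda>z. h (fst z, a)) \<in> borel_measurable ?P"
      by (intro measurable_compose[OF measurable_fst hm])
    show "(\<lambda>z. indicator {a} (snd z)) \<in> borel_measurable ?P" by measurable
  qed
  have em: "(\<lambda>z. exp (\<psi> (snd z))) \<in> borel_measurable ?P"
    by (rule measurable_compose[OF measurable_snd]) simp
  have hk: "h z = k z" if zP: "z \<in> space ?P" for z
  proof -
    obtain p a where z: "z = (p, a)" "p \<in> space \<nu>" using zP by (auto simp: space_pair_measure)
    have "k z = (\<Sum>b\<in>B. if b = a then h (p, a) else 0)"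
      unfolding k_def z by (intro sum.cong) (auto simp: indicator_def)
    also have "\<dots> = h z" using B h z by (simp add: sum.delta)
    finally show ?thesis by simp
  qed
  have "(\<integral>z. h z \<partial>density ?P (\<lambda>(p, a). ennreal (exp (\<psi> a)))) = (\<integral>z. k z \<partial>density ?P (\<lambda>z. ennreal (exp (\<psi> (snd z)))))"
    using hk by (intro Bochner_Integration.integral_cong) (auto simp: case_prod_unfold)
  also have "\<dots> = (\<integral>z. exp (\<psi> (snd z)) *\<^sub>R k z \<partial>?P)"
    by (rule integral_density[OF km em]) simp
  also have "\<dots> = (\<integral>z. (\<Sum>a\<in>B. (exp (\<psi> a) * h (fst z, a)) * indicator {a} (snd z)) \<partial>?P)"
    unfolding k_def scaleR_sum_right
    by (intro Bochner_Integration.integral_cong sum.cong refl) (auto simp: indicator_def)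
  also have "\<dots> = (\<Sum>a\<in>B. exp (\<psi> a) * (\<integral>p. h (p, a) \<partial>\<nu>))"
    by (rule has_bochner_integral_integral_eq[OF has_bochner_integral_sum[OF slice]])
  finally show ?thesis .
qed

theorem theorem2:
  fixes d :: nat and x :: "nat \<Rightarrow> real" and F T :: "real \<Rightarrow> real"
    and \<phi> :: "nat \<Rightarrow> int ^ 'm"
    and \<mu> :: "(int ^ 'm \<Rightarrow> real) \<Rightarrow> (real \<times> (int ^ 'm)) measure"
    and h :: "real \<times> (int ^ 'm) \<Rightarrow> real"
  assumes "d \<ge> 2"
    and "iet d 0 1 x F"
    and "keane d x F"
    and "infinitely_complete d x F"
    and "continuous_extension d x F T"
    and "group_closure (\<phi> ` {1..d}) = UNIV"
    and "periodic_type d x F \<phi>"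
    and "\<And>\<psi>. \<psi> \<in> Hom_real \<Longrightarrow> maharam_measure d x F T \<phi> \<psi> (\<mu> \<psi>)"
    and "\<And>\<psi>. \<psi> \<in> Hom_real \<Longrightarrow> emeasure (\<mu> \<psi>) (Kset d x F \<times> {0}) = 1"
    and "continuous_on (Kset d x F \<times> UNIV) h"
    and "\<exists>C. compact C \<and> C \<subseteq> Kset d x F \<times> UNIV \<and> (\<forall>p \<in> Kset d x F \<times> UNIV - C. h p = 0)"
  shows "continuous_on Hom_real (\<lambda>\<psi>. \<integral>p. h p \<partial>\<mu> \<psi>)"
proof -
  interpret iet_setting d x F using assms(1,2,3) by unfold_locales
  \<comment> \<open>Chosen separately for each \<open>\<psi>\<close>; coherence of the choices comes
    from the contraction estimate, which applies to any normalised family.\<close>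
  obtain \<nu> where \<nu>: "\<And>\<psi>. \<psi> \<in> Hom_real \<Longrightarrow> conformal_measure d x F T \<phi> \<psi> (\<nu> \<psi>)"
    and \<mu>: "\<And>\<psi>. \<psi> \<in> Hom_real \<Longrightarrow> \<mu> \<psi> = density (\<nu> \<psi> \<Otimes>\<^sub>M count_space UNIV) (\<lambda>(p, a). ennreal (exp (\<psi> a)))"
    using assms(8) unfolding maharam_measure_def by metis
  have space: "space (\<nu> \<psi>) = K" and fin: "finite_measure (\<nu> \<psi>)" if "\<psi> \<in> Hom_real" for \<psi>
    using space_nu[OF assms(5) \<nu>[OF that]] finite_nu[OF assms(5) \<nu>[OF that]] by auto
  have norm: "measure (\<nu> \<psi>) K = 1" if "\<psi> \<in> Hom_real" for \<psi>
  proof -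
    have "emeasure (\<nu> \<psi>) K = 1"
      using emeasure_density_slice_0[OF fin[OF that], of \<psi>] assms(9)[OF that] that
      by (simp add: \<mu>[OF that] space[OF that] Hom_real_def)
    then show ?thesis by (simp add: measure_def)
  qed
  obtain C where C: "compact C" "C \<subseteq> K \<times> UNIV" and h0: "\<forall>z\<in>K \<times> UNIV - C. h z = 0"
    using assms(11) by (elim exE conjE)
  \<comment> \<open>The group is discrete, so a compact support meets only finitely many slices and
    the integral becomes a finite sum.\<close>
  define B where "B = snd ` C"
  have B: "finite B" unfolding B_def
    by (intro finite_if_compact_int_vec compact_continuous_image[OF _ C(1)] continuous_intros)
  have C1: "compact (fst ` C)" by (intro compact_continuous_image[OF _ C(1)] continuous_intros)
  have C1sub: "fst ` C \<subseteq> K" using C(2) by auto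
  have slice: "(\<forall>\<psi>\<in>Hom_real. integrable (\<nu> \<psi>) (\<lambda>p. h (p, a))) \<and> continuous_on Hom_real (\<lambda>\<psi>. \<integral>p. h (p, a) \<partial>\<nu> \<psi>)" for a
  proof (rule continuous_integral_conformal[OF assms(5,7,4) \<nu> norm _ C1 C1sub])
    show "continuous_on K (\<lambda>p. h (p, a))"
      by (rule continuous_on_compose2[OF assms(10)]) (auto intro!: continuous_intros)
    show "h (p, a) = 0" if "p \<in> K - fst ` C" for p using that by (intro bspec[OF h0]) force
  qed
  have eval: "continuous_on Hom_real (\<lambda>\<psi>. \<psi> a)" for a :: "int ^ 'm"
    by (rule continuous_on_product_then_coordinatewise[OF continuous_on_id])
  have "(\<integral>p. h p \<partial>\<mu> \<psi>) = (\<Sum>a\<in>B. exp (\<psi> a) * (\<integral>p. h (p, a) \<partial>\<nu> \<psi>))" if "\<psi> \<in> Hom_real" for \<psi>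
    unfolding \<mu>[OF that]
  proof (rule integral_maharam[OF fin[OF that] B])
    show "h (p, a) = 0" if "p \<in> space (\<nu> \<psi>)" "a \<notin> B" for p a
      using that space[OF \<open>\<psi> \<in> Hom_real\<close>] by (intro bspec[OF h0]) (force simp: B_def)
    show "integrable (\<nu> \<psi>) (\<lambda>p. h (p, a))" for a using slice that by blast
  qed
  moreover have "continuous_on Hom_real (\<lambda>\<psi>. \<Sum>a\<in>B. exp (\<psi> a) * (\<integral>p. h (p, a) \<partial>\<nu> \<psi>))"
    using slice by (intro continuous_intros eval) blast
  ultimately show ?thesis by (simp cong: continuous_on_cong)
qed

end
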